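(* Let $E$ be the self-affine Moran set with frequency $\mathbf{f}=\{f_\gamma\}_{\gamma\in\Gamma}$ and $\zeta\le1$. Let $\mu$ be the self-affine Moran measure on $E$ given by the positive probability vectors $(p_\gamma(w))_{w\in\mathcal{D}_\gamma}$, $\gamma\in\Gamma$. Suppose that for all $\gamma\ne\gamma'\in\Gamma$: (1) $r_\gamma(0)=r_{\gamma'}(0)$ and $r_\gamma(m_\gamma-1)=r_{\gamma'}(m_{\gamma'}-1)$; (2) $\{p_{\gamma'}(i,0)\}_{(i,0)\in\mathcal{D}_{\gamma'}}$ and $\{p_{\gamma'}(i,m_{\gamma'}-1)\}_{(i,m_{\gamma'}-1)\in\mathcal{D}_{\gamma'}}$ are permutations of $\{p_\gamma(i,0)\}_{(i,0)\in\mathcal{D}_\gamma}$ and $\{p_\gamma(i,m_\gamma-1)\}_{(i,m_\gamma-1)\in\mathcal{D}_\gamma}$, respectively. Then for every $\alpha\in(\alpha_{\min},\alpha_{\max})$, $$H(\alpha)=\inf_{t\in\mathbb{R}}\{\alpha t+\beta(t)\}.$$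
   Context: Setting. Let $\{(n_k,m_k)\}_{k\ge1}$ be integer pairs with $n_k\ge2$, $m_k\ge2$ and $\sup_k\{n_k,m_k\}<\infty$, and let $\mathcal{D}_k\subset\{0,\dots,n_k-1\}\times\{0,\dots,m_k-1\}$ with $\operatorname{card}\mathcal{D}_k\ge2$. Let $\Gamma$ be the finite set of all patterns $\gamma=(n_\gamma,m_\gamma,\mathcal{D}_\gamma)$ occurring in the sequence $\{(n_k,m_k,\mathcal{D}_k)\}_{k\ge1}$. Assume that for each $\gamma\in\Gamma$ the limit $f_\gamma=\lim_{n\to\infty}\frac1n\operatorname{card}\{1\le k\le n:(n_k,m_k,\mathcal{D}_k)=\gamma\}$ exists and $\sum_{\gamma\in\Gamma}f_\gamma=1$. Let $\Sigma^\infty=\prod_{k\ge1}\mathcal{D}_k$; write $\mathbf{w}=w_1w_2\cdots\in\Sigma^\infty$ with $w_k=(i_k,j_k)$. Define $\Pi:\Sigma^\infty\to\mathbb{R}^2$ by $\Pi(\mathbf{w})=\sum_{k\ge1}\big(\frac{i_k}{n_1\cdots n_k},\frac{j_k}{m_1\cdots m_k}\big)$. The set $E=\Pi(\Sigma^\infty)$ is the self-affine Moran set with frequency $\mathbf{f}=\{f_\gamma\}$. For each $\gamma\in\Gamma$ let $(p_\gamma(w))_{w\in\mathcal{D}_\gamma}$ be a probability vector with all $p_\gamma(w)>0$; put $p_k=p_\gamma$ when $(n_k,m_k,\mathcal{D}_k)=\gamma$. Let $\widetilde\mu$ be the product Borel probability measure on $\Sigma^\infty$ with $\widetilde\mu(\{\mathbf{v}:v_1=w_1,\dots,v_k=w_k\})=p_1(w_1)\cdots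 p_k(w_k)$, and $\mu=\widetilde\mu\circ\Pi^{-1}$ (the self-affine Moran measure). For $w=(i,j)\in\mathcal{D}_\gamma$ let $q_\gamma(w)=q_\gamma(j)=\sum_{i':(i',j)\in\mathcal{D}_\gamma}p_\gamma(i',j)$. For each $j$ let $r_\gamma(j)=\operatorname{card}\{i:(i,j)\in\mathcal{D}_\gamma\}$. Let $\zeta=\frac{\sum_\gamma f_\gamma\log m_\gamma}{\sum_\gamma f_\gamma\log n_\gamma}$. For $t\in\mathbb{R}$ let $u_\gamma(j)=\frac{q_\gamma(j)^t}{\sum_{i':(i',j)\in\mathcal{D}_\gamma}p_\gamma(i',j)^t}$. For $\zeta\le1$, let $\beta_\gamma(t)$ be the unique solution of $m_\gamma^{-\beta_\gamma(t)}\sum_{(i,j)\in\mathcal{D}_\gamma}p_\gamma(i,j)^t\,u_\gamma(j)^{1-\zeta}=1$, and $\beta(t)=\frac{\sum_\gamma f_\gamma\beta_\gamma(t)\log m_\gamma}{\sum_\gamma f_\gamma\log m_\gamma}$. Let $\alpha_{\min}=\frac{\sum_\gamma f_\gamma\min_{w\in\mathcal{D}_\gamma}\{-\zeta\log p_\gamma(w)-(1-\zeta)\log q_\gamma(w)\}}{\sum_\gamma f_\gamma\log m_\gamma}$ and let $\alpha_{\max}$ be the same expression with $\max$ in place of $\min$. The local dimension of $\mu$ at $x$ is $\dim_{\rm loc}\mu(x)=\lim_{r\to0}\frac{\log\mu(B(x,r))}{\log r}$ when the limit exists; $E_\alpha=\{x\in\mathbb{R}^2:\dim_{\rm loc}\mu(x)=\alpha\}$;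 $H(\alpha)=\dim_{\rm H}E_\alpha$ (Hausdorff dimension). *)

theory Defs
  imports "HOL-Probability.Probability"
begin

section \<open>Hausdorff dimension\<close>

text \<open>The weight \<open>diam(U)\<^sup>s\<close> of a covering set, with the usual conventions at \<open>s = 0\<close>: it is 1 for a
  nonempty set (also for a singleton) and 0 for the empty set. The case distinction is needed
  because \<open>0 powr 0 = 0\<close> in the library.\<close>

definition hausdorff_weight :: "real \<Rightarrow> 'a::metric_space set \<Rightarrow> ennreal" where
  "hausdorff_weight s U =
     (if U = {} then 0 else if s = 0 then 1 else ennreal (diameter U powr s))"

text \<open>Covering sets are required to be bounded since \<open>diameter\<close> is not meaningful otherwise.\<close>

definition delta_covers :: "real \<Rightarrow> 'a::metric_space set \<Rightarrow> (nat \<Rightarrow> 'a set) set" where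
  "delta_covers \<delta> A =
     {U. A \<subseteq> (\<Union>i. U i) \<and> (\<forall>i. bounded (U i) \<and> diameter (U i) \<le> \<delta>)}"

definition hausdorff_content :: "real \<Rightarrow> real \<Rightarrow> 'a::metric_space set \<Rightarrow> ennreal" where
  "hausdorff_content s \<delta> A = (INF U\<in>delta_covers \<delta> A. \<Sum>i. hausdorff_weight s (U i))"

text \<open>The content increases as \<open>\<delta>\<close> decreases, so the supremum is the limit as \<open>\<delta> \<longlongrightarrow> 0\<close>.\<close>

definition hausdorff_measure :: "real \<Rightarrow> 'a::metric_space set \<Rightarrow> ennreal" where
  "hausdorff_measure s A = (SUP \<delta>\<in>{0<..}. hausdorff_content s \<delta> A)"

definition hausdorff_dim :: "'a::metric_space set \<Rightarrow> ereal" where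
  "hausdorff_dim A = Inf (ereal ` {s. 0 \<le> s \<and> hausdorff_measure s A = 0})"


section \<open>Local dimension\<close>

text \<open>\<open>has_local_dim \<mu> x \<alpha>\<close> says that the local dimension of \<open>\<mu>\<close> at \<open>x\<close> exists and is the real number
  \<open>\<alpha>\<close>. Off the support of \<open>\<mu>\<close> the logarithm of \<open>\<mu>(B(x,r))\<close> is \<open>-\<infinity>\<close> for small \<open>r\<close>, so the local
  dimension is not a real number there; the positivity clause is needed because \<open>ln 0 = 0\<close> in the
  library.\<close>

definition has_local_dim :: "'a::metric_space measure \<Rightarrow> 'a \<Rightarrow> real \<Rightarrow> bool" where
  "has_local_dim \<mu> x \<alpha> \<longleftrightarrow>
     (\<forall>r>0. measure \<mu> (ball x r) > 0) \<and>
     ((\<lambda>r. ln (measure \<mu> (ball x r)) / ln r) \<longlongrightarrow> \<alpha>) (at_right 0)"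

definition local_dim_level :: "'a::metric_space measure \<Rightarrow> real \<Rightarrow> 'a set" where
  "local_dim_level \<mu> \<alpha> = {x. has_local_dim \<mu> x \<alpha>}"


section \<open>Self-affine Moran sets and measures\<close>

datatype pattern = Pattern (pat_n: nat) (pat_m: nat) (pat_D: "(nat \<times> nat) set")

text \<open>Sequences are indexed from 0: entry \<open>k\<close> of a sequence is the entry with index \<open>k + 1\<close> in the
  convention \<open>k \<ge> 1\<close>.\<close>

definition moran_code :: "(nat \<Rightarrow> pattern) \<Rightarrow> (nat \<Rightarrow> nat \<times> nat) set" where
  "moran_code pat = (\<Pi>\<^sub>E k\<in>UNIV. pat_D (pat k))"

definition moran_proj :: "(nat \<Rightarrow> pattern) \<Rightarrow> (nat \<Rightarrow> nat \<times> nat) \<Rightarrow> real \<times> real" where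
  "moran_proj pat w =
     ((\<Sum>k. real (fst (w k)) / (\<Prod>l\<le>k. real (pat_n (pat l)))),
      (\<Sum>k. real (snd (w k)) / (\<Prod>l\<le>k. real (pat_m (pat l)))))"

definition moran_set :: "(nat \<Rightarrow> pattern) \<Rightarrow> (real \<times> real) set" where
  "moran_set pat = moran_proj pat ` moran_code pat"

definition moran_code_measure ::
    "(nat \<Rightarrow> pattern) \<Rightarrow> (pattern \<Rightarrow> nat \<times> nat \<Rightarrow> real) \<Rightarrow> (nat \<Rightarrow> nat \<times> nat) measure" where
  "moran_code_measure pat p =
     (\<Pi>\<^sub>M k\<in>UNIV. point_measure (pat_D (pat k)) (\<lambda>w. ennreal (p (pat k) w)))"

definition moran_measure ::
    "(nat \<Rightarrow> pattern) \<Rightarrow> (pattern \<Rightarrow> nat \<times> nat \<Rightarrow> real) \<Rightarrow> (real \<times> real) measure" where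
  "moran_measure pat p = distr (moran_code_measure pat p) borel (moran_proj pat)"

text \<open>The frequency of \<open>\<gamma>\<close> among the first \<open>n\<close> patterns.\<close>

definition pattern_freq :: "(nat \<Rightarrow> pattern) \<Rightarrow> pattern \<Rightarrow> nat \<Rightarrow> real" where
  "pattern_freq pat \<gamma> n = real (card {k. k < n \<and> pat k = \<gamma>}) / real n"

definition row_card :: "pattern \<Rightarrow> nat \<Rightarrow> nat" where
  "row_card \<gamma> j = card {i. (i, j) \<in> pat_D \<gamma>}"

text \<open>The family of probabilities in row \<open>j\<close>, up to permutation.\<close>

definition row_family :: "(pattern \<Rightarrow> nat \<times> nat \<Rightarrow> real) \<Rightarrow> pattern \<Rightarrow> nat \<Rightarrow> real multiset" where
  "row_family p \<gamma> j = {# p \<gamma> (i, j). i \<in># mset_set {i. (i, j) \<in> pat_D \<gamma>} #}"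

definition row_prob :: "(pattern \<Rightarrow> nat \<times> nat \<Rightarrow> real) \<Rightarrow> pattern \<Rightarrow> nat \<Rightarrow> real" where
  "row_prob p \<gamma> j = (\<Sum>i | (i, j) \<in> pat_D \<gamma>. p \<gamma> (i, j))"

definition row_ratio :: "(pattern \<Rightarrow> nat \<times> nat \<Rightarrow> real) \<Rightarrow> pattern \<Rightarrow> real \<Rightarrow> nat \<Rightarrow> real" where
  "row_ratio p \<gamma> t j =
     row_prob p \<gamma> j powr t / (\<Sum>i | (i, j) \<in> pat_D \<gamma>. p \<gamma> (i, j) powr t)"

text \<open>In the following, \<open>G\<close> is the finite set of patterns and \<open>f\<close> the frequency vector; \<open>z\<close> stands
  for \<open>\<zeta>\<close>.\<close>

definition moran_zeta :: "pattern set \<Rightarrow> (pattern \<Rightarrow> real) \<Rightarrow> real" where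
  "moran_zeta G f =
     (\<Sum>\<gamma>\<in>G. f \<gamma> * ln (real (pat_m \<gamma>))) / (\<Sum>\<gamma>\<in>G. f \<gamma> * ln (real (pat_n \<gamma>)))"

definition beta_eq ::
    "real \<Rightarrow> (pattern \<Rightarrow> nat \<times> nat \<Rightarrow> real) \<Rightarrow> pattern \<Rightarrow> real \<Rightarrow> real \<Rightarrow> bool" where
  "beta_eq z p \<gamma> t b \<longleftrightarrow>
     real (pat_m \<gamma>) powr (- b) *
       (\<Sum>(i, j)\<in>pat_D \<gamma>. p \<gamma> (i, j) powr t * row_ratio p \<gamma> t j powr (1 - z)) = 1"

definition beta_pat ::
    "real \<Rightarrow> (pattern \<Rightarrow> nat \<times> nat \<Rightarrow> real) \<Rightarrow> pattern \<Rightarrow> real \<Rightarrow> real" where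
  "beta_pat z p \<gamma> t = (THE b. beta_eq z p \<gamma> t b)"

definition moran_beta ::
    "pattern set \<Rightarrow> (pattern \<Rightarrow> real) \<Rightarrow> (pattern \<Rightarrow> nat \<times> nat \<Rightarrow> real) \<Rightarrow> real \<Rightarrow> real" where
  "moran_beta G f p t =
     (\<Sum>\<gamma>\<in>G. f \<gamma> * beta_pat (moran_zeta G f) p \<gamma> t * ln (real (pat_m \<gamma>))) /
     (\<Sum>\<gamma>\<in>G. f \<gamma> * ln (real (pat_m \<gamma>)))"

definition digit_energy ::
    "real \<Rightarrow> (pattern \<Rightarrow> nat \<times> nat \<Rightarrow> real) \<Rightarrow> pattern \<Rightarrow> nat \<times> nat \<Rightarrow> real" where
  "digit_energy z p \<gamma> w = - z * ln (p \<gamma> w) - (1 - z) * ln (row_prob p \<gamma> (snd w))"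

definition alpha_min ::
    "pattern set \<Rightarrow> (pattern \<Rightarrow> real) \<Rightarrow> (pattern \<Rightarrow> nat \<times> nat \<Rightarrow> real) \<Rightarrow> real" where
  "alpha_min G f p =
     (\<Sum>\<gamma>\<in>G. f \<gamma> * Min (digit_energy (moran_zeta G f) p \<gamma> ` pat_D \<gamma>)) /
     (\<Sum>\<gamma>\<in>G. f \<gamma> * ln (real (pat_m \<gamma>)))"

definition alpha_max ::
    "pattern set \<Rightarrow> (pattern \<Rightarrow> real) \<Rightarrow> (pattern \<Rightarrow> nat \<times> nat \<Rightarrow> real) \<Rightarrow> real" where
  "alpha_max G f p =
     (\<Sum>\<gamma>\<in>G. f \<gamma> * Max (digit_energy (moran_zeta G f) p \<gamma> ` pat_D \<gamma>)) /
     (\<Sum>\<gamma>\<in>G. f \<gamma> * ln (real (pat_m \<gamma>)))"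


section \<open>Well-definedness\<close>

lemma space_moran_code_measure: "space (moran_code_measure pat p) = moran_code pat"
  by (simp add: moran_code_measure_def moran_code_def space_PiM space_point_measure)

lemma emeasure_moran_cylinder:
  assumes fin: "\<And>k. finite (pat_D (pat k))"
    and pos: "\<And>k w. w \<in> pat_D (pat k) \<Longrightarrow> 0 < p (pat k) w"
    and prob: "\<And>k. (\<Sum>w\<in>pat_D (pat k). p (pat k) w) = 1"
    and w: "\<And>k. k < n \<Longrightarrow> w k \<in> pat_D (pat k)"
  shows "emeasure (moran_code_measure pat p) {v \<in> moran_code pat. \<forall>k<n. v k = w k}
           = ennreal (\<Prod>k<n. p (pat k) (w k))"
proof -
  let ?M = "\<lambda>k. point_measure (pat_D (pat k)) (\<lambda>w. ennreal (p (pat k) w))"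
  have ps: "prob_space (?M k)" for k
  proof
    have "emeasure (?M k) (pat_D (pat k)) = (\<Sum>w\<in>pat_D (pat k). ennreal (p (pat k) w))"
      using fin[of k] by (subst emeasure_point_measure_finite) auto
    also have "\<dots> = 1"
      using prob[of k] pos[of _ k] by (subst sum_ennreal) (auto intro: less_imp_le)
    finally show "emeasure (?M k) (space (?M k)) = 1" by (simp add: space_point_measure)
  qed
  interpret product_prob_space ?M UNIV
    by (intro product_prob_spaceI ps)
  have eq: "{v \<in> moran_code pat. \<forall>k<n. v k = w k} =
      prod_emb UNIV ?M {..<n} (\<Pi>\<^sub>E k\<in>{..<n}. {w k})"
    by (auto simp: prod_emb_def moran_code_def space_point_measure PiE_iff restrict_def
        extensional_def fun_eq_iff)
  have "emeasure (?M k) {w k} = ennreal (p (pat k) (w k))" if "k < n" for k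
    using fin[of k] w[OF that] by (subst emeasure_point_measure_finite) auto
  then have "(\<Prod>k<n. emeasure (?M k) {w k}) = (\<Prod>k<n. ennreal (p (pat k) (w k)))" by simp
  also have "\<dots> = ennreal (\<Prod>k<n. p (pat k) (w k))"
    by (intro prod_ennreal) (metis pos w less_imp_le lessThan_iff)
  finally show ?thesis
    unfolding eq moran_code_measure_def
    by (subst emeasure_PiM_emb) (use w in \<open>auto simp: sets_point_measure\<close>)
qed

lemma measurable_moran_proj: "moran_proj pat \<in> moran_code_measure pat p \<rightarrow>\<^sub>M borel"
proof -
  have m: "(\<lambda>w. g (w k)) \<in> moran_code_measure pat p \<rightarrow>\<^sub>M borel"
    for g :: "nat \<times> nat \<Rightarrow> real" and k
  proof -
    have "g \<in> point_measure (pat_D (pat k)) (\<lambda>w. ennreal (p (pat k) w)) \<rightarrow>\<^sub>M borel" by simp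
    then show ?thesis unfolding moran_code_measure_def
      by (rule measurable_compose[OF measurable_component_singleton, rotated]) simp
  qed
  have "(\<lambda>w. \<Sum>k. g k (w k)) \<in> moran_code_measure pat p \<rightarrow>\<^sub>M borel"
    for g :: "nat \<Rightarrow> nat \<times> nat \<Rightarrow> real"
    by (intro borel_measurable_suminf m)
  from this[of "\<lambda>k v. real (fst v) / (\<Prod>l\<le>k. real (pat_n (pat l)))"]
    this[of "\<lambda>k v. real (snd v) / (\<Prod>l\<le>k. real (pat_m (pat l)))"]
  show ?thesis unfolding moran_proj_def[abs_def] by (rule borel_measurable_Pair)
qed

lemma beta_eq_unique:
  assumes "2 \<le> pat_m \<gamma>" "finite (pat_D \<gamma>)" "pat_D \<gamma> \<noteq> {}"
    and pos: "\<And>w. w \<in> pat_D \<gamma> \<Longrightarrow> 0 < p \<gamma> w"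
  shows "\<exists>!b. beta_eq z p \<gamma> t b"
proof -
  define S where
    "S = (\<Sum>(i, j)\<in>pat_D \<gamma>. p \<gamma> (i, j) powr t * row_ratio p \<gamma> t j powr (1 - z))"
  have fin: "finite {i. (i, j) \<in> pat_D \<gamma>}" for j
    by (rule finite_subset[of _ "fst ` pat_D \<gamma>"]) (use assms(2) in force)+
  have "0 < row_ratio p \<gamma> t j" if "(i, j) \<in> pat_D \<gamma>" for i j
  proof -
    have "0 < row_prob p \<gamma> j" unfolding row_prob_def
      using fin that pos by (intro sum_pos) auto
    moreover have "0 < (\<Sum>i | (i, j) \<in> pat_D \<gamma>. p \<gamma> (i, j) powr t)"
      using fin that pos by (intro sum_pos) (force dest: pos)+
    ultimately show ?thesis unfolding row_ratio_def by simp
  qed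
  then have "0 < p \<gamma> (i, j) powr t * row_ratio p \<gamma> t j powr (1 - z)"
    if "(i, j) \<in> pat_D \<gamma>" for i j
    using that pos[OF that] by (metis mult_pos_pos powr_gt_zero less_irrefl)
  then have S: "0 < S" unfolding S_def
    using assms(2,3) by (intro sum_pos) auto
  let ?m = "real (pat_m \<gamma>)"
  have m: "1 < ?m" using assms(1) by simp
  have "?m powr (- b) * S = 1 \<longleftrightarrow> b = log ?m S" for b
  proof -
    have "?m powr (- b) * S = 1 \<longleftrightarrow> S = ?m powr b"
      using m by (auto simp: powr_minus field_simps)
    also have "\<dots> \<longleftrightarrow> b = log ?m S" using m S by (auto simp: powr_log_cancel log_powr_cancel)
    finally show ?thesis .
  qed
  then show ?thesis unfolding beta_eq_def S_def[symmetric] by simp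
qed

end

theory Submission
  imports Defs
begin

text \<open>The level set is measured with the family of tilted product measures. Write \<open>A\<close> for the mean of
  \<open>log m\<close> with respect to the frequencies. An approximate square of order \<open>k\<close> fixes the digits
  \<open>(i, j)\<close> up to \<open>\<zeta>k\<close> and the row digits \<open>j\<close> up to \<open>k\<close>; because the frequencies exist, both its sides
  are \<open>e\<^bsup>-kA + o(k)\<^esup>\<close>. For a real \<open>t\<close> let \<open>\<mu>\<^sub>t\<close> be the Moran measure with the weights
  \<open>m\<^bsup>-\<beta>(t)\<^esup> p\<^sup>t u(j)\<^bsup>1 - \<zeta>\<^esup>\<close>, with the \<open>m\<close> and \<open>\<beta>\<close> of the respective pattern. Summing over a row
  shows that the row weights are \<open>m\<^bsup>-\<beta>(t)\<^esup> q\<^sup>t u(j)\<^bsup>-\<zeta>\<^esup>\<close>, so for an approximate square \<open>Q\<close> around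
  a code with row digits \<open>j\<^sub>0, j\<^sub>1, \<dots>\<close>, now with the averaged \<open>\<beta>\<close>,

    \<open>log \<mu>\<^sub>t(Q) = - k A \<beta>(t) + t log \<mu>(Q) + S\<^bsub>\<zeta>k\<^esub> - \<zeta> S\<^sub>k + o(k)\<close>,

  where \<open>S\<^sub>k\<close> is the sum of \<open>log u(j\<^sub>i)\<close> over \<open>i < k\<close> (\<open>ln_measure_tilted_square\<close>).

  The function \<open>\<alpha>t + \<beta>(t)\<close> tends to infinity at both ends since \<open>\<alpha>\<close> lies strictly between \<open>\<alpha>\<^sub>m\<^sub>i\<^sub>n\<close> and
  \<open>\<alpha>\<^sub>m\<^sub>a\<^sub>x\<close>. At its minimum \<open>t\<close> the derivative vanishes, and this says that the mean energy of the digits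
  under \<open>\<mu>\<^sub>t\<close> is \<open>\<alpha>A\<close> (\<open>exists_minimising_tilt\<close>). Only this one \<open>t\<close> is used.

  Lower bound. By the strong law of large numbers, \<open>\<mu>\<^sub>t\<close>-almost every code has convergent averages of
  the finitely many digit functions that matter. At such a code the local dimension of \<open>\<mu>\<close> is \<open>\<alpha>\<close>
  and that of \<open>\<mu>\<^sub>t\<close> is \<open>\<alpha>t + \<beta>(t)\<close>, and the mass distribution principle applies to \<open>\<mu>\<^sub>t\<close>. The point to be
  settled is that a ball can meet squares far away in code space. This happens only through a carry,
  which forces a long run of digits at one end of the alphabet; each digit that can take part
  in a carry competes with an admissible digit at the opposite end, so a typical code has no such
  runs of length proportional to their position (\<open>has_local_dim_if_carry_sparse\<close>).

  Upper bound. If \<open>x\<close> has local dimension \<open>\<alpha>\<close>, then for infinitely many \<open>k\<close> there is an approximate square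
  of order \<open>k\<close> close to \<open>x\<close> with \<open>\<mu>\<^sub>t\<close>-mass at least \<open>e\<^bsup>-kA(\<alpha>t + \<beta>(t)) - o(k)\<^esup>\<close>; counting these squares
  bounds the Hausdorff dimension. The term \<open>t log \<mu>(Q)\<close> is controlled by the local dimension: for \<open>t \<le> 0\<close> with the
  square around \<open>x\<close>, for \<open>t \<ge> 0\<close> with a neighbouring square that carries a ninth of the mass of a ball.
  The term \<open>S\<^bsub>\<zeta>k\<^esub> - \<zeta>S\<^sub>k\<close> is almost nonnegative whenever \<open>S\<^sub>k / k\<close> is near its lower limit. In the case
  \<open>t \<ge> 0\<close> this has to hold for the neighbouring square, whose row digits may differ from those of
  \<open>x\<close> by a carry; the orders \<open>k\<close> are therefore chosen where no carry reaches back before \<open>k\<close>. This is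
  possible unless the row digits of \<open>x\<close> are eventually constant at one end, and then \<open>S\<^sub>k\<close> is
  asymptotically linear for all neighbours because the extreme rows carry the same probabilities in
  all patterns (\<open>frequently_row_sum_ge\<close>).\<close>

section \<open>Mixed-radix expansions\<close>

text \<open>The truncated expansion scaled to an integer. It numbers the basic intervals of order \<open>k\<close> from left
  to right, so adjacent intervals have consecutive numbers.\<close>

fun digit_num :: "(nat \<Rightarrow> nat) \<Rightarrow> (nat \<Rightarrow> nat) \<Rightarrow> nat \<Rightarrow> int" where
  "digit_num b d 0 = 0"
| "digit_num b d (Suc k) = digit_num b d k * int (b k) + int (d k)"

definition base_prod :: "(nat \<Rightarrow> nat) \<Rightarrow> nat \<Rightarrow> real" where
  "base_prod b k = (\<Prod>l<k. real (b l))"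

definition expansion :: "(nat \<Rightarrow> nat) \<Rightarrow> (nat \<Rightarrow> nat) \<Rightarrow> real" where
  "expansion b d = (\<Sum>k. real (d k) / base_prod b (Suc k))"

lemma base_prod_simps [simp]:
  "base_prod b 0 = 1" "base_prod b (Suc k) = base_prod b k * real (b k)"
  by (simp_all add: base_prod_def)

lemma digit_num_cong:
  assumes "\<And>l. l < k \<Longrightarrow> d l = e l"
  shows "digit_num b d k = digit_num b e k"
  using assms by (induction k) auto

locale mixed_radix =
  fixes b :: "nat \<Rightarrow> nat"
  assumes base_ge_2: "2 \<le> b k"
begin

lemma base_prod_pos: "0 < base_prod b k"
proof (induction k)
  case (Suc k)
  then show ?case using base_ge_2[of k] by simp
qed simp

lemma base_prod_ge_pow: "2 ^ k \<le> base_prod b k"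
proof (induction k)
  case (Suc k)
  have "(2::real) ^ k * 2 \<le> base_prod b k * real (b k)"
    using Suc base_ge_2[of k] by (intro mult_mono) (auto simp: base_prod_pos less_imp_le)
  then show ?case by (simp add: mult.commute)
qed simp

lemma base_prod_tendsto_0: "(\<lambda>k. 1 / base_prod b k) \<longlonglongrightarrow> 0"
proof (rule tendsto_sandwich[of "\<lambda>_. 0" _ _ "\<lambda>k. (1 / 2) ^ k"])
  have "1 / base_prod b k \<le> 1 / 2 ^ k" for k
    using base_prod_ge_pow[of k] by (intro divide_left_mono) (auto simp: base_prod_pos)
  then show "\<forall>\<^sub>F k in sequentially. 1 / base_prod b k \<le> (1 / 2) ^ k"
    by (simp add: power_divide)
  show "(\<lambda>k. (1 / 2 :: real) ^ k) \<longlonglongrightarrow> 0" by (rule LIMSEQ_realpow_zero) auto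
qed (auto simp: base_prod_pos less_imp_le)

lemma base_prod_mono: "k \<le> l \<Longrightarrow> base_prod b k \<le> base_prod b l"
proof (induction rule: dec_induct)
  case (step n)
  have "base_prod b n * 1 \<le> base_prod b n * real (b n)"
    using base_ge_2[of n] by (intro mult_left_mono) (auto simp: base_prod_pos less_imp_le)
  with step show ?case by simp
qed simp

lemma digit_num_partial_sum:
  "(\<Sum>l<k. real (d l) / base_prod b (Suc l)) = of_int (digit_num b d k) / base_prod b k"
proof (induction k)
  case (Suc k)
  then show ?case using base_prod_pos[of k] base_ge_2[of k] by (auto simp: field_simps)
qed simp

lemma digit_term_le:
  assumes "d k < b k"
  shows "real (d k) / base_prod b (Suc k) \<le> 1 / base_prod b k - 1 / base_prod b (Suc k)"
proof -
  have "real (d k) + 1 \<le> real (b k)" using assms by linarith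
  then show ?thesis using base_prod_pos[of k] base_ge_2[of k]
    by (auto simp: field_simps)
qed

lemma summable_expansion:
  assumes "\<And>k. d k < b k"
  shows "summable (\<lambda>k. real (d k) / base_prod b (Suc k))"
proof (rule summable_comparison_test')
  show "summable (\<lambda>k. 1 / base_prod b k - 1 / base_prod b (Suc k))"
    using telescope_summable'[OF base_prod_tendsto_0] by simp
  show "norm (real (d k) / base_prod b (Suc k)) \<le> 1 / base_prod b k - 1 / base_prod b (Suc k)"
    if "0 \<le> k" for k
  proof -
    have "0 \<le> real (d k) / base_prod b (Suc k)"
      by (intro divide_nonneg_pos base_prod_pos) simp
    then show ?thesis using digit_term_le[of d k, OF assms] by (simp only: real_norm_def abs_of_nonneg)
  qed
qed

lemma expansion_bounds:
  assumes d: "\<And>k. d k < b k"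
  shows "of_int (digit_num b d k) \<le> expansion b d * base_prod b k"
    and "expansion b d * base_prod b k \<le> of_int (digit_num b d k) + 1"
proof -
  let ?t = "\<lambda>k. real (d k) / base_prod b (Suc k)"
  note sm = summable_expansion[OF d]
  have split: "expansion b d = (\<Sum>l. ?t (l + k)) + of_int (digit_num b d k) / base_prod b k"
    unfolding expansion_def
    by (subst suminf_split_initial_segment[OF sm, of k]) (simp only: digit_num_partial_sum)
  have nn: "0 \<le> ?t l" for l by (intro divide_nonneg_pos base_prod_pos) simp
  have "0 \<le> (\<Sum>l. ?t (l + k))"
    by (intro suminf_nonneg summable_ignore_initial_segment sm nn)
  then have *: "of_int (digit_num b d k) / base_prod b k \<le> expansion b d" by (simp only: split)
  have lim: "(\<lambda>l. 1 / base_prod b (l + k)) \<longlonglongrightarrow> 0"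
    using base_prod_tendsto_0 by (rule LIMSEQ_ignore_initial_segment)
  have "(\<Sum>l. ?t (l + k)) \<le> (\<Sum>l. 1 / base_prod b (l + k) - 1 / base_prod b (Suc l + k))"
    using telescope_summable'[OF lim] digit_term_le[of d, OF d]
    by (intro suminf_le summable_ignore_initial_segment sm) auto
  also have "\<dots> = 1 / base_prod b k"
    using telescope_sums'[OF lim] by (simp add: sums_iff)
  finally have **: "expansion b d \<le> (of_int (digit_num b d k) + 1) / base_prod b k"
    unfolding split by (simp add: add_divide_distrib)
  show "of_int (digit_num b d k) \<le> expansion b d * base_prod b k"
    using * base_prod_pos[of k] by (simp add: field_simps)
  show "expansion b d * base_prod b k \<le> of_int (digit_num b d k) + 1"
    using ** base_prod_pos[of k] by (simp add: field_simps)
qed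

lemma expansion_dist_same_num:
  assumes "\<And>k. d k < b k" "\<And>k. e k < b k" "digit_num b d k = digit_num b e k"
  shows "\<bar>expansion b d - expansion b e\<bar> \<le> 1 / base_prod b k"
proof -
  have "\<bar>expansion b d * base_prod b k - expansion b e * base_prod b k\<bar> \<le> 1"
    using expansion_bounds[OF assms(1), of k] expansion_bounds[OF assms(2), of k] assms(3) by linarith
  then have "\<bar>expansion b d - expansion b e\<bar> * base_prod b k \<le> 1"
    using base_prod_pos[of k] by (simp add: abs_mult flip: left_diff_distrib)
  then show ?thesis using base_prod_pos[of k] by (simp add: field_simps)
qed

lemma digit_num_adjacent:
  assumes "\<And>k. d k < b k" "\<And>k. e k < b k" "\<bar>expansion b d - expansion b e\<bar> < 1 / base_prod b k"
  shows "\<bar>digit_num b d k - digit_num b e k\<bar> \<le> 1"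
proof -
  have "\<bar>expansion b d - expansion b e\<bar> * base_prod b k < 1"
    using assms(3) base_prod_pos[of k] by (simp add: field_simps)
  then have "\<bar>expansion b d * base_prod b k - expansion b e * base_prod b k\<bar> < 1"
    using base_prod_pos[of k] by (simp add: abs_mult flip: left_diff_distrib)
  then have "real_of_int \<bar>digit_num b d k - digit_num b e k\<bar> < 2"
    using expansion_bounds[OF assms(1), of k] expansion_bounds[OF assms(2), of k] by linarith
  then show ?thesis by linarith
qed

lemma digit_num_inject:
  assumes "\<And>k. d k < b k" "\<And>k. e k < b k" "digit_num b d k = digit_num b e k" "l < k"
  shows "d l = e l"
  using assms(3,4)
proof (induction k)
  case (Suc k)
  have dm: "int (f k) = digit_num b f (Suc k) mod int (b k)"
    "digit_num b f k = digit_num b f (Suc k) div int (b k)" if "\<And>k. f k < b k" for f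
    using that[of k] base_ge_2[of k] by auto
  have "d k = e k" using dm(1)[of d, OF assms(1)] dm(1)[of e, OF assms(2)] Suc.prems(1) by (metis of_nat_eq_iff)
  moreover have "digit_num b d k = digit_num b e k"
    using dm(2)[of d, OF assms(1)] dm(2)[of e, OF assms(2)] Suc.prems(1) by metis
  ultimately show ?case using Suc by (cases "l = k") auto
qed simp

text \<open>Two expansions can be close although their digits differ early only through a carry: after
  the first difference one expansion continues with the digit 0 and the other with the largest
  digit. This is the only way in which a point can be close to a cylinder that does not contain
  it.\<close>

lemma digit_num_carry:
  assumes d: "\<And>k. d k < b k" and e: "\<And>k. e k < b k" and "k \<le> n"
    and "\<bar>digit_num b d n - digit_num b e n\<bar> \<le> 1" and "digit_num b d k \<noteq> digit_num b e k"
  shows "(digit_num b d n = digit_num b e n + 1 \<and> (\<forall>l\<in>{k..<n}. d l = 0 \<and> e l = b l - 1)) \<or>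
         (digit_num b d n = digit_num b e n - 1 \<and> (\<forall>l\<in>{k..<n}. d l = b l - 1 \<and> e l = 0))"
  using assms(3,4)
proof (induction n rule: dec_induct)
  case base
  then show ?case using assms(5) by auto
next
  case (step n)
  let ?a = "digit_num b d n" and ?a' = "digit_num b e n" and ?m = "int (b n)"
  have ne: "?a \<noteq> ?a'"
    using digit_num_inject[OF d e] step(1) assms(5) digit_num_cong[of k d e b] by force
  have bd: "int (d n) < ?m" "int (e n) < ?m" "2 \<le> ?m" using d e base_ge_2 by auto
  have "(?a - ?a') * ?m \<le> int (e n) - int (d n) + 1" "(?a' - ?a) * ?m \<le> int (d n) - int (e n) + 1"
    using step.prems by (auto simp: algebra_simps)
  then have le: "(?a - ?a') * ?m \<le> ?m" "(?a' - ?a) * ?m \<le> ?m" using bd by linarith+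
  then have "?a - ?a' \<le> 1" "?a' - ?a \<le> 1" using bd(3) by (simp_all add: mult_le_cancel_right2)
  with ne consider "?a = ?a' + 1" | "?a = ?a' - 1" by linarith
  then show ?case
  proof cases
    case 1
    with step.prems bd have "int (d n) = 0 \<and> int (e n) = ?m - 1" by (simp add: algebra_simps)
    then have "d n = 0 \<and> e n = b n - 1" using bd(3) by linarith
    moreover from this 1 have "digit_num b d (Suc n) = digit_num b e (Suc n) + 1"
      using bd(3) by (simp add: algebra_simps)
    ultimately show ?thesis using step.IH 1 by (auto simp: less_Suc_eq)
  next
    case 2
    with step.prems bd have "int (e n) = 0 \<and> int (d n) = ?m - 1" by (simp add: algebra_simps)
    then have "e n = 0 \<and> d n = b n - 1" using bd(3) by linarith
    moreover have "digit_num b d (Suc n) = digit_num b e (Suc n) - 1"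
    proof -
      have "digit_num b e n = digit_num b d n + 1" using 2 by simp
      then show ?thesis using calculation bd(3) by (simp add: algebra_simps of_nat_diff)
    qed
    ultimately show ?thesis using step.IH 2 by (auto simp: less_Suc_eq)
  qed
qed

end

section \<open>Bounds for the Hausdorff dimension\<close>

text \<open>Each tail of the sequence of covers still covers the limsup set, and the tails of the convergent
  series of total weights are arbitrarily small.\<close>

lemma hausdorff_measure_eq_0_if_limsup_cover:
  fixes X :: "'a::metric_space set"
  assumes s: "0 < s"
    and fin: "\<And>k. finite (\<U> k)"
    and diam: "\<And>k U. U \<in> \<U> k \<Longrightarrow> bounded U \<and> diameter U \<le> d k"
    and d0: "d \<longlonglongrightarrow> 0"
    and sm: "summable (\<lambda>k. real (card (\<U> k)) * d k powr s)"
    and cover: "\<And>x. x \<in> X \<Longrightarrow> \<exists>\<^sub>F k in sequentially. x \<in> \<Union>(\<U> k)"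
  shows "hausdorff_measure s X = 0"
proof -
  have content: "hausdorff_content s \<delta> X \<le> ennreal \<epsilon>" if "0 < \<delta>" "0 < \<epsilon>" for \<delta> \<epsilon>
  proof -
    let ?c = "\<lambda>k. real (card (\<U> k)) * d k powr s"
    have "\<forall>\<^sub>F N in sequentially. d N < \<delta>" using order_tendstoD(2)[OF d0] that by simp
    then obtain N1 where N1: "\<And>k. N1 \<le> k \<Longrightarrow> d k < \<delta>" by (auto simp: eventually_sequentially)
    have "\<forall>\<^sub>F N in sequentially. (\<Sum>k. ?c (k + N)) < \<epsilon>"
      using order_tendstoD(2)[OF suminf_exist_split2[OF sm]] that by simp
    then obtain N2 where N2: "\<And>N. N2 \<le> N \<Longrightarrow> (\<Sum>k. ?c (k + N)) < \<epsilon>"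
      by (auto simp: eventually_sequentially)
    define N where "N = max N1 N2"
    obtain e where e: "\<And>k. bij_betw (e k) {0..<card (\<U> k)} (\<U> k)"
      using ex_bij_betw_nat_finite[OF fin] by metis
    define V where "V = (\<lambda>(k, i). if i < card (\<U> (k + N)) then e (k + N) i else {})"
    have V_in: "V (k, i) \<in> \<U> (k + N)" if "i < card (\<U> (k + N))" for k i
      using e[of "k + N"] that by (auto simp: V_def bij_betw_def)
    have w: "hausdorff_weight s (V (k, i)) \<le>
        (if i < card (\<U> (k + N)) then ennreal (d (k + N) powr s) else 0)" for k i
    proof (cases "i < card (\<U> (k + N))")
      case True
      have "diameter (V (k, i)) powr s \<le> d (k + N) powr s"
        using diam[OF V_in[OF True]] s by (intro powr_mono2) (auto simp: diameter_ge_0)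
      then show ?thesis using True s by (auto simp: hausdorff_weight_def intro: ennreal_leI)
    qed (auto simp: V_def hausdorff_weight_def)
    have "(\<lambda>n. V (prod_decode n)) \<in> delta_covers \<delta> X"
      unfolding delta_covers_def
    proof (intro CollectI conjI subsetI allI)
      fix x assume "x \<in> X"
      from cover[OF this] obtain k where k: "N \<le> k" "x \<in> \<Union>(\<U> k)"
        unfolding frequently_sequentially by blast
      then obtain U where U: "U \<in> \<U> k" "x \<in> U" by auto
      moreover have "e k ` {0..<card (\<U> k)} = \<U> k" using e[of k] by (simp add: bij_betw_def)
      ultimately obtain i where "i < card (\<U> k)" "e k i = U" by (metis atLeastLessThan_iff imageE)
      then have "x \<in> V (k - N, i)" using U k by (simp add: V_def)
      then show "x \<in> (\<Union>n. V (prod_decode n))" by (metis UN_iff UNIV_I prod_encode_inverse)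
    next
      fix n
      obtain k i where n: "prod_decode n = (k, i)" by fastforce
      show "bounded (V (prod_decode n))"
        using diam[OF V_in] by (cases "i < card (\<U> (k + N))") (auto simp: n, simp add: V_def)
      show "diameter (V (prod_decode n)) \<le> \<delta>"
      proof (cases "i < card (\<U> (k + N))")
        case True
        have "d (k + N) < \<delta>" by (rule N1) (simp add: N_def)
        then show ?thesis using diam[OF V_in[OF True]] by (auto simp: n)
      qed (use \<open>0 < \<delta>\<close> in \<open>simp add: n V_def\<close>)
    qed
    then have "hausdorff_content s \<delta> X \<le> (\<Sum>n. hausdorff_weight s (V (prod_decode n)))"
      unfolding hausdorff_content_def by (rule INF_lower)
    also have "\<dots> = (\<Sum>k. \<Sum>i. hausdorff_weight s (V (k, i)))"
      by (rule suminf_ennreal_2dimen[where f = "\<lambda>p. hausdorff_weight s (V p)"]) simp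
    also have "\<dots> \<le> (\<Sum>k. ennreal (?c (k + N)))"
    proof (intro suminf_le)
      fix k
      have "(\<Sum>i. hausdorff_weight s (V (k, i))) \<le>
          (\<Sum>i. if i < card (\<U> (k + N)) then ennreal (d (k + N) powr s) else 0)"
        by (intro suminf_le w) auto
      also have "\<dots> = (\<Sum>i<card (\<U> (k + N)). ennreal (d (k + N) powr s))"
        by (subst suminf_finite[of "{..<card (\<U> (k + N))}"]) auto
      also have "\<dots> = ennreal (?c (k + N))"
        by (simp add: ennreal_mult ennreal_of_nat_eq_real_of_nat)
      finally show "(\<Sum>i. hausdorff_weight s (V (k, i))) \<le> ennreal (?c (k + N))" .
    qed auto
    also have "\<dots> = ennreal (\<Sum>k. ?c (k + N))"
      using summable_ignore_initial_segment[OF sm] by (intro suminf_ennreal2) auto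
    also have "\<dots> \<le> ennreal \<epsilon>" using N2[of N] by (intro ennreal_leI) (auto simp: N_def)
    finally show ?thesis .
  qed
  have "hausdorff_content s \<delta> X = 0" if "0 < \<delta>" for \<delta>
  proof -
    have "hausdorff_content s \<delta> X \<le> 0"
      by (rule ennreal_le_epsilon) (use content[OF that] in simp)
    then show ?thesis by simp
  qed
  then show ?thesis unfolding hausdorff_measure_def by simp
qed

lemma hausdorff_dim_leI:
  assumes "0 \<le> D" "\<And>s. D < s \<Longrightarrow> hausdorff_measure s X = 0"
  shows "hausdorff_dim X \<le> ereal D"
proof (rule ereal_le_epsilon2)
  fix e :: real assume "0 < e"
  then have "D + e \<in> {s. 0 \<le> s \<and> hausdorff_measure s X = 0}" using assms by simp
  then show "hausdorff_dim X \<le> ereal D + ereal e"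
    unfolding hausdorff_dim_def by (intro Inf_lower) auto
qed

lemma hausdorff_dim_geI:
  assumes "\<And>s. 0 \<le> s \<Longrightarrow> s < D \<Longrightarrow> hausdorff_measure s X \<noteq> 0"
  shows "ereal D \<le> hausdorff_dim X"
  unfolding hausdorff_dim_def using assms by (intro Inf_greatest) (force simp: not_less)

text \<open>Balls vary lower semicontinuously with their centre: almost all of the mass of \<open>ball x r\<close> lies in
  a smaller concentric ball, which is contained in the balls of radius \<open>r\<close> around nearby points.\<close>

lemma closed_measure_ball_le:
  fixes \<nu> :: "'a::metric_space measure"
  assumes "finite_measure \<nu>" and sets: "sets \<nu> = sets borel"
  shows "closed {x. measure \<nu> (ball x r) \<le> c}"
proof -
  interpret finite_measure \<nu> by fact
  have "open {x. c < measure \<nu> (ball x r)}"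
  proof (subst open_dist, intro ballI)
    fix x assume x: "x \<in> {x. c < measure \<nu> (ball x r)}"
    let ?B = "\<lambda>n. ball x (r - inverse (real (Suc n)))"
    have "incseq ?B" by (intro incseq_SucI subset_ball) (simp add: frac_le inverse_eq_divide)
    then have "(\<lambda>n. measure \<nu> (?B n)) \<longlonglongrightarrow> measure \<nu> (\<Union>n. ?B n)"
      by (intro finite_Lim_measure_incseq) (auto simp: sets)
    also have "(\<Union>n. ?B n) = ball x r"
    proof
      show "(\<Union>n. ?B n) \<subseteq> ball x r"
        by (intro UN_least subset_ball) (simp add: less_imp_le)
      show "ball x r \<subseteq> (\<Union>n. ?B n)"
      proof
        fix y assume "y \<in> ball x r"
        then obtain n where "inverse (real (Suc n)) < r - dist x y"
          using reals_Archimedean[of "r - dist x y"] by auto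
        then show "y \<in> (\<Union>n. ?B n)" by (intro UN_I[of n]) auto
      qed
    qed
    finally have "\<forall>\<^sub>F n in sequentially. c < measure \<nu> (?B n)"
      using x by (intro order_tendstoD(1)) auto
    then obtain n where n: "c < measure \<nu> (?B n)" by (auto simp: eventually_sequentially)
    show "\<exists>e>0. \<forall>y. dist y x < e \<longrightarrow> y \<in> {x. c < measure \<nu> (ball x r)}"
    proof (intro exI[of _ "inverse (real (Suc n))"] conjI allI impI CollectI)
      fix y assume y: "dist y x < inverse (real (Suc n))"
      have "?B n \<subseteq> ball y r"
      proof
        fix z assume "z \<in> ?B n"
        then show "z \<in> ball y r" using y dist_triangle[of y z x] by auto
      qed
      then have "measure \<nu> (?B n) \<le> measure \<nu> (ball y r)"
        by (intro finite_measure_mono) (auto simp: sets)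
      then show "c < measure \<nu> (ball y r)" using n by linarith
    qed simp
  qed
  moreover have "{x. measure \<nu> (ball x r) \<le> c} = - {x. c < measure \<nu> (ball x r)}" by auto
  ultimately show ?thesis by (simp add: closed_def)
qed

text \<open>The mass distribution principle. By semicontinuity the points whose balls of radius below
  \<open>1 / n\<close> have mass at most \<open>r\<^sup>s\<close> form a closed set; one of these sets has positive mass, and every
  fine cover of it has total weight at least that mass. The points are given through a map \<open>\<pi>\<close> from a
  probability space because no measurability of \<open>X\<close> is assumed.\<close>

lemma mass_distribution_principle:
  fixes \<pi> :: "'w \<Rightarrow> 'a::metric_space"
  assumes "prob_space M" and \<pi>[measurable]: "\<pi> \<in> M \<rightarrow>\<^sub>M borel"
    and ae: "AE w in M. \<pi> w \<in> X \<and>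
      (\<forall>\<^sub>F r in at_right 0. measure (distr M borel \<pi>) (ball (\<pi> w) r) \<le> r powr s)"
    and s: "0 \<le> s"
  shows "hausdorff_measure s X \<noteq> 0"
proof -
  interpret M: prob_space M by fact
  define \<nu> where "\<nu> = distr M borel \<pi>"
  interpret \<nu>: prob_space \<nu> unfolding \<nu>_def by (rule M.prob_space_distr) simp
  have sets_\<nu>[simp]: "sets \<nu> = sets borel" by (simp add: \<nu>_def)
  define F where "F n = (\<Inter>r\<in>{0<..<inverse (real (Suc n))}. {x. measure \<nu> (ball x r) \<le> r powr s})"
    for n
  have F_closed: "closed (F n)" for n
    unfolding F_def by (intro closed_INT ballI closed_measure_ball_le \<nu>.finite_measure_axioms) simp
  have [measurable]: "F n \<in> sets borel" for n using F_closed by simp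
  define E where "E n = \<pi> -` F n \<inter> space M" for n
  have [measurable]: "E n \<in> sets M" for n unfolding E_def by measurable
  have in_E: "\<exists>n. w \<in> E n" if "w \<in> space M"
    "\<forall>\<^sub>F r in at_right 0. measure \<nu> (ball (\<pi> w) r) \<le> r powr s" for w
  proof -
    from that(2) obtain r0 where "0 < r0" "\<And>r. 0 < r \<Longrightarrow> r < r0 \<Longrightarrow> measure \<nu> (ball (\<pi> w) r) \<le> r powr s"
      by (auto simp: eventually_at_right_field)
    moreover from this(1) obtain n where "inverse (real (Suc n)) < r0"
      using reals_Archimedean by auto
    ultimately show ?thesis using that(1) by (auto simp: E_def F_def intro!: exI[of _ n])
  qed
  have "emeasure M (\<Union>n. E n) = 1"
  proof -
    have "AE w in M. w \<in> (\<Union>n. E n)" using ae AE_space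
      by eventually_elim (use in_E in \<open>auto simp: \<nu>_def\<close>)
    then show ?thesis by (intro M.emeasure_eq_1_AE) auto
  qed
  then obtain n where n: "emeasure M (E n) \<noteq> 0"
    using emeasure_UN_eq_0[of M E] by fastforce
  from ae obtain Z where Z: "Z \<in> null_sets M" "\<And>w. w \<in> space M \<Longrightarrow> w \<notin> Z \<Longrightarrow> \<pi> w \<in> X"
    by (auto simp: eventually_ae_filter)
  have cball_le: "measure \<nu> (cball x \<rho>) \<le> \<rho> powr s"
    if "x \<in> F n" "0 \<le> \<rho>" "\<rho> < inverse (real (Suc n))" "0 < s" for x \<rho>
  proof (rule tendsto_lowerbound)
    show "((\<lambda>r. r powr s) \<longlongrightarrow> \<rho> powr s) (at_right \<rho>)"
      using that by (intro tendsto_powr2 tendsto_intros) (auto simp: eventually_at_filter)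
    have "\<forall>\<^sub>F r in at_right \<rho>. \<rho> < r \<and> r < inverse (real (Suc n))"
      using that by (auto simp: eventually_at_right_field)
    then show "\<forall>\<^sub>F r in at_right \<rho>. measure \<nu> (cball x \<rho>) \<le> r powr s"
    proof eventually_elim
      case (elim r)
      have "measure \<nu> (cball x \<rho>) \<le> measure \<nu> (ball x r)"
        using elim by (intro \<nu>.finite_measure_mono) auto
      also have "\<dots> \<le> r powr s" using that elim by (auto simp: F_def)
      finally show ?case .
    qed
  qed simp
  let ?\<delta> = "inverse (real (Suc n)) / 2"
  have "emeasure M (E n) \<le> hausdorff_content s ?\<delta> X"
    unfolding hausdorff_content_def
  proof (rule INF_greatest)
    fix U :: "nat \<Rightarrow> 'a set" assume U: "U \<in> delta_covers ?\<delta> X"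
    have "\<exists>C. C \<in> sets borel \<and> U i \<inter> F n \<subseteq> C \<and> emeasure \<nu> C \<le> hausdorff_weight s (U i)" for i
    proof (cases "U i \<inter> F n = {}")
      case True then show ?thesis by (intro exI[of _ "{}"]) auto
    next
      case False
      then obtain x where x: "x \<in> U i" "x \<in> F n" by auto
      show ?thesis
      proof (cases "s = 0")
        case True
        then show ?thesis using x
          by (intro exI[of _ UNIV]) (auto simp: hausdorff_weight_def \<nu>.emeasure_le_1)
      next
        case s0: False
        have b: "bounded (U i)" "diameter (U i) \<le> ?\<delta>" using U by (auto simp: delta_covers_def)
        have "?\<delta> < inverse (real (Suc n))" by simp
        with b(2) have "diameter (U i) < inverse (real (Suc n))" by (rule le_less_trans)
        then have "measure \<nu> (cball x (diameter (U i))) \<le> diameter (U i) powr s"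
          using s s0 by (intro cball_le x diameter_ge_0 b) auto
        then have "emeasure \<nu> (cball x (diameter (U i))) \<le> hausdorff_weight s (U i)"
          using x s0 by (auto simp: hausdorff_weight_def \<nu>.emeasure_eq_measure intro: ennreal_leI)
        then show ?thesis using diameter_bounded_bound[OF b(1) x(1)]
          by (intro exI[of _ "cball x (diameter (U i))"]) auto
      qed
    qed
    then obtain C where C: "\<And>i. C i \<in> sets borel" "\<And>i. U i \<inter> F n \<subseteq> C i"
      "\<And>i. emeasure \<nu> (C i) \<le> hausdorff_weight s (U i)" by metis
    have [measurable]: "C i \<in> sets borel" for i by (rule C)
    have "emeasure M (E n) = emeasure M (E n - Z)"
      using Z(1) by (simp add: emeasure_Diff_null_set)
    also have "\<dots> \<le> emeasure M (\<pi> -` (\<Union>i. C i) \<inter> space M)"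
    proof (rule emeasure_mono)
      show "E n - Z \<subseteq> \<pi> -` (\<Union>i. C i) \<inter> space M"
      proof
        fix w assume w: "w \<in> E n - Z"
        then have "\<pi> w \<in> X" "\<pi> w \<in> F n" "w \<in> space M" using Z(2) by (auto simp: E_def)
        moreover from this U obtain i where "\<pi> w \<in> U i" by (auto simp: delta_covers_def)
        ultimately show "w \<in> \<pi> -` (\<Union>i. C i) \<inter> space M" using C(2)[of i] by auto
      qed
    qed measurable
    also have "\<dots> = emeasure \<nu> (\<Union>i. C i)" unfolding \<nu>_def by (subst emeasure_distr) auto
    also have "\<dots> \<le> (\<Sum>i. emeasure \<nu> (C i))"
      by (intro emeasure_subadditive_countably) auto
    also have "\<dots> \<le> (\<Sum>i. hausdorff_weight s (U i))" by (intro suminf_le C) auto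
    finally show "emeasure M (E n) \<le> (\<Sum>i. hausdorff_weight s (U i))" .
  qed
  also have "\<dots> \<le> hausdorff_measure s X" unfolding hausdorff_measure_def by (rule SUP_upper) simp
  finally show ?thesis using n by auto
qed

lemma hausdorff_dim_ge_if_AE_local_dim:
  fixes \<pi> :: "'w \<Rightarrow> 'a::metric_space"
  assumes M: "prob_space M" and \<pi>: "\<pi> \<in> M \<rightarrow>\<^sub>M borel"
    and ae: "AE w in M. \<pi> w \<in> X \<and> has_local_dim (distr M borel \<pi>) (\<pi> w) D"
  shows "ereal D \<le> hausdorff_dim X"
proof (rule hausdorff_dim_geI, rule mass_distribution_principle[OF M \<pi>])
  fix s assume s: "0 \<le> s" "s < D"
  show "AE w in M. \<pi> w \<in> X \<and>
      (\<forall>\<^sub>F r in at_right 0. measure (distr M borel \<pi>) (ball (\<pi> w) r) \<le> r powr s)"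
    using ae
  proof eventually_elim
    case (elim w)
    let ?F = "\<lambda>r. measure (distr M borel \<pi>) (ball (\<pi> w) r)"
    have pos: "0 < ?F r" if "0 < r" for r using elim that by (auto simp: has_local_dim_def)
    have "((\<lambda>r. ln (?F r) / ln r) \<longlongrightarrow> D) (at_right 0)" using elim by (auto simp: has_local_dim_def)
    then have "\<forall>\<^sub>F r in at_right 0. s < ln (?F r) / ln r" using s by (intro order_tendstoD)
    moreover have "\<forall>\<^sub>F r in at_right 0. 0 < r \<and> r < (1::real)"
      by (auto simp: eventually_at_right_field intro: exI[of _ 1])
    ultimately have "\<forall>\<^sub>F r in at_right 0. ?F r \<le> r powr s"
    proof eventually_elim
      case (elim r)
      then have "ln (?F r) \<le> s * ln r" by (simp add: field_simps)
      then have "exp (ln (?F r)) \<le> exp (s * ln r)" by simp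
      then show ?case using elim pos[of r] by (simp add: powr_def)
    qed
    with elim show ?case by simp
  qed
qed

lemma nat_floor_ratio_tendsto:
  fixes c :: real
  assumes "0 \<le> c"
  shows "((\<lambda>x. real (nat \<lfloor>c * x\<rfloor>) / x) \<longlongrightarrow> c) at_top"
proof (rule tendsto_sandwich[of "\<lambda>x. c - 1 / x" _ _ "\<lambda>_. c"])
  have gt: "\<forall>\<^sub>F x in at_top. (0::real) < x" by (rule eventually_gt_at_top)
  from gt show "\<forall>\<^sub>F x in at_top. c - 1 / x \<le> real (nat \<lfloor>c * x\<rfloor>) / x"
  proof eventually_elim
    case (elim x)
    have "c * x - 1 \<le> real (nat \<lfloor>c * x\<rfloor>)" by linarith
    then have "(c * x - 1) / x \<le> real (nat \<lfloor>c * x\<rfloor>) / x" using elim by (intro divide_right_mono) auto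
    then show ?case using elim by (simp add: diff_divide_distrib)
  qed
  from gt show "\<forall>\<^sub>F x in at_top. real (nat \<lfloor>c * x\<rfloor>) / x \<le> c"
  proof eventually_elim
    case (elim x)
    have "0 \<le> c * x" using elim assms by simp
    then have "real (nat \<lfloor>c * x\<rfloor>) \<le> c * x" by linarith
    then show ?case using elim by (simp add: field_simps)
  qed
  have "((\<lambda>x::real. 1 / x) \<longlongrightarrow> 0) at_top"
    by (intro tendsto_divide_0[OF tendsto_const] filterlim_at_top_imp_at_infinity filterlim_ident)
  then show "((\<lambda>x. c - 1 / x) \<longlongrightarrow> c) at_top" by (auto intro: tendsto_eq_intros)
qed simp

text \<open>The logarithms of consecutive radii \<open>e\<^bsup>-ka\<^esup>\<close> have ratios tending to 1 and the mass of a ball is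
  monotone in its radius, so these radii determine the local dimension. Errors \<open>e\<^bsup>\<plusminus>k\<delta>\<^esup>\<close> in the radii and
  in the masses change the quotient of the logarithms only by an amount that vanishes with \<open>\<delta>\<close>.\<close>

lemma has_local_dim_geometricI:
  fixes \<nu> :: "'a::metric_space measure"
  assumes "finite_measure \<nu>" and sets: "sets \<nu> = sets borel" and a: "0 < a"
    and upper: "\<And>\<delta>. 0 < \<delta> \<Longrightarrow>
      \<forall>\<^sub>F k in sequentially. measure \<nu> (ball x (exp (- real k * (a + \<delta>)))) \<le> exp (- real k * (h - \<delta>))"
    and lower: "\<And>\<delta>. 0 < \<delta> \<Longrightarrow> \<delta> < a \<Longrightarrow>
      \<forall>\<^sub>F k in sequentially. exp (- real k * (h + \<delta>)) \<le> measure \<nu> (ball x (exp (- real k * (a - \<delta>))))"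
  shows "has_local_dim \<nu> x (h / a)"
proof -
  interpret finite_measure \<nu> by fact
  let ?F = "\<lambda>r. measure \<nu> (ball x r)"
  have mono: "?F r \<le> ?F r'" if "r \<le> r'" for r r'
    using that by (intro finite_measure_mono) (auto simp: sets)
  have radii: "(\<lambda>k. exp (- real k * c)) \<longlonglongrightarrow> 0" if "0 < c" for c :: real
  proof -
    have "LIM k sequentially. - real k * c :> at_bot"
      using filterlim_tendsto_pos_mult_at_top[OF tendsto_const[of c] that filterlim_real_sequentially]
      by (simp add: filterlim_uminus_at_bot mult.commute)
    then show ?thesis by (rule filterlim_compose[OF exp_at_bot])
  qed
  have pos: "0 < ?F r" if "0 < r" for r
  proof -
    have "\<forall>\<^sub>F k in sequentially. exp (- real k * (a - a / 2)) < r"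
      using order_tendstoD(2)[OF radii[of "a - a / 2"] that] a by simp
    moreover have "\<forall>\<^sub>F k in sequentially.
        exp (- real k * (h + a / 2)) \<le> ?F (exp (- real k * (a - a / 2)))" using a by (intro lower) auto
    ultimately have "\<forall>\<^sub>F k in sequentially. 0 < ?F r"
    proof eventually_elim
      case (elim k)
      have "0 < exp (- real k * (h + a / 2))" by simp
      also have "\<dots> \<le> ?F r" using elim mono[of "exp (- real k * (a - a / 2))" r] by auto
      finally show ?case .
    qed
    then show ?thesis by (auto simp: eventually_sequentially)
  qed
  have inv: "filterlim (\<lambda>r::real. - ln r) at_top (at_right 0)"
    using ln_at_0 by (simp add: filterlim_uminus_at_bot)
  have L_pos: "\<forall>\<^sub>F r in at_right 0. 0 < r \<and> 0 < - ln (r::real)"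
  proof -
    have "\<forall>\<^sub>F r in at_right 0. 0 < r \<and> r < (1::real)"
      by (auto simp: eventually_at_right_field intro: exI[of _ 1])
    then show ?thesis by eventually_elim auto
  qed
  have k_lim: "((\<lambda>r. real (nat \<lfloor>(1 / c) * - ln r\<rfloor>) / - ln r) \<longlongrightarrow> 1 / c) (at_right 0)" if "0 < c" for c :: real
    using that by (intro filterlim_compose[OF nat_floor_ratio_tendsto inv]) simp
  have k_top: "filterlim (\<lambda>r. nat \<lfloor>(1 / c) * - ln r\<rfloor>) sequentially (at_right 0)" if "0 < c" for c :: real
  proof -
    have "filterlim (\<lambda>r::real. (1 / c) * - ln r) at_top (at_right 0)"
      using filterlim_tendsto_pos_mult_at_top[OF tendsto_const[of "1 / c"] _ inv] that by simp
    then show ?thesis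
      by (intro filterlim_compose[OF filterlim_nat_sequentially]
          filterlim_compose[OF filterlim_floor_sequentially])
  qed
  have lim: "((\<lambda>r. ln (?F r) / ln r) \<longlongrightarrow> h / a) (at_right 0)"
  proof (rule order_tendstoI)
    fix y assume y: "y < h / a"
    have "((\<lambda>\<delta>. 1 / (a + \<delta>) * (h - \<delta>)) \<longlongrightarrow> 1 / (a + 0) * (h - 0)) (at_right 0)"
      using a by (intro tendsto_intros) auto
    then have "\<forall>\<^sub>F \<delta> in at_right 0. y < 1 / (a + \<delta>) * (h - \<delta>)" using y by (intro order_tendstoD) auto
    moreover have "\<forall>\<^sub>F \<delta> in at_right 0. 0 < (\<delta>::real)" by (simp add: eventually_at_right_less)
    ultimately have "\<exists>\<delta>. y < 1 / (a + \<delta>) * (h - \<delta>) \<and> 0 < \<delta>"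
      by (intro eventually_happens'[of "at_right (0::real)"] eventually_conj) auto
    then obtain \<delta> where \<delta>: "y < 1 / (a + \<delta>) * (h - \<delta>)" "0 < \<delta>" by auto
    let ?k = "\<lambda>r. nat \<lfloor>(1 / (a + \<delta>)) * - ln r\<rfloor>"
    have "\<forall>\<^sub>F r in at_right 0. y < real (?k r) / - ln r * (h - \<delta>)"
      using \<delta> a by (intro order_tendstoD(1)[OF tendsto_mult[OF k_lim tendsto_const]]) auto
    moreover have "\<forall>\<^sub>F r in at_right 0. ?F (exp (- real (?k r) * (a + \<delta>))) \<le> exp (- real (?k r) * (h - \<delta>))"
      using \<delta> a by (intro eventually_compose_filterlim[OF upper k_top]) auto
    ultimately show "\<forall>\<^sub>F r in at_right 0. y < ln (?F r) / ln r" using L_pos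
    proof eventually_elim
      case (elim r)
      have "real (?k r) \<le> 1 / (a + \<delta>) * - ln r"
        using elim \<delta> a by (intro of_nat_floor) (auto intro!: divide_nonpos_pos)
      then have "ln r \<le> - real (?k r) * (a + \<delta>)" using \<delta> a by (simp add: field_simps)
      then have "r \<le> exp (- real (?k r) * (a + \<delta>))" using elim by (metis exp_le_cancel_iff exp_ln)
      from mono[OF this] elim have "?F r \<le> exp (- real (?k r) * (h - \<delta>))" by linarith
      then have "ln (?F r) \<le> - real (?k r) * (h - \<delta>)" using pos[of r] elim
        by (metis exp_le_cancel_iff exp_ln)
      then have "real (?k r) * (h - \<delta>) / - ln r \<le> - ln (?F r) / - ln r"
        using elim by (intro divide_right_mono) auto
      then show ?case using elim by simp
    qed
  next
    fix y assume y: "h / a < y"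
    have "((\<lambda>\<delta>. 1 / (a - \<delta>) * (h + \<delta>)) \<longlongrightarrow> 1 / (a - 0) * (h + 0)) (at_right 0)"
      using a by (intro tendsto_intros) auto
    then have "\<forall>\<^sub>F \<delta> in at_right 0. 1 / (a - \<delta>) * (h + \<delta>) < y" using y by (intro order_tendstoD) auto
    moreover have "\<forall>\<^sub>F \<delta> in at_right 0. 0 < (\<delta>::real) \<and> \<delta> < a"
      using a by (auto simp: eventually_at_right_field)
    ultimately have "\<forall>\<^sub>F \<delta> in at_right 0. 1 / (a - \<delta>) * (h + \<delta>) < y \<and> 0 < \<delta> \<and> \<delta> < a"
      by eventually_elim simp
    then have "\<exists>\<delta>. 1 / (a - \<delta>) * (h + \<delta>) < y \<and> 0 < \<delta> \<and> \<delta> < a"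
      by (intro eventually_happens'[of "at_right (0::real)"]) auto
    then obtain \<delta> where \<delta>: "1 / (a - \<delta>) * (h + \<delta>) < y" "0 < \<delta>" "\<delta> < a" by auto
    let ?k = "\<lambda>r. Suc (nat \<lfloor>(1 / (a - \<delta>)) * - ln r\<rfloor>)"
    have "((\<lambda>r. real (nat \<lfloor>(1 / (a - \<delta>)) * - ln r\<rfloor>) / - ln r + 1 / - ln r) \<longlongrightarrow> 1 / (a - \<delta>) + 0) (at_right 0)"
      using \<delta> by (intro tendsto_add k_lim tendsto_divide_0[OF tendsto_const]
          filterlim_at_top_imp_at_infinity inv) auto
    then have "\<forall>\<^sub>F r in at_right 0.
        (real (nat \<lfloor>(1 / (a - \<delta>)) * - ln r\<rfloor>) / - ln r + 1 / - ln r) * (h + \<delta>) < y"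
      using \<delta> a by (intro order_tendstoD(2)[OF tendsto_mult[OF _ tendsto_const]]) auto
    moreover have "\<forall>\<^sub>F r in at_right 0.
        exp (- real (?k r) * (h + \<delta>)) \<le> ?F (exp (- real (?k r) * (a - \<delta>)))"
      using \<delta> a by (intro eventually_compose_filterlim[OF lower
            filterlim_compose[OF filterlim_Suc k_top]]) auto
    ultimately show "\<forall>\<^sub>F r in at_right 0. ln (?F r) / ln r < y" using L_pos
    proof eventually_elim
      case (elim r)
      have "1 / (a - \<delta>) * - ln r \<le> real (?k r)" by linarith
      then have "- real (?k r) * (a - \<delta>) \<le> ln r" using \<delta> a by (simp add: field_simps)
      then have "exp (- real (?k r) * (a - \<delta>)) \<le> r" using elim by (metis exp_le_cancel_iff exp_ln)
      from mono[OF this] elim have "exp (- real (?k r) * (h + \<delta>)) \<le> ?F r" by linarith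
      then have "- real (?k r) * (h + \<delta>) \<le> ln (?F r)" using pos[of r] elim
        by (metis exp_le_cancel_iff exp_ln)
      then have "- ln (?F r) \<le> real (?k r) * (h + \<delta>)"
        unfolding mult_minus_left by linarith
      then have "- ln (?F r) / - ln r \<le> real (?k r) * (h + \<delta>) / - ln r"
        using elim by (intro divide_right_mono) auto
      also have "\<dots> = (real (nat \<lfloor>(1 / (a - \<delta>)) * - ln r\<rfloor>) / - ln r + 1 / - ln r) * (h + \<delta>)"
        unfolding of_nat_Suc by (simp only: add_divide_distrib[symmetric] times_divide_eq_left add.commute)
      also note elim(1)
      finally show ?case by simp
    qed
  qed
  show ?thesis unfolding has_local_dim_def using pos lim by auto
qed

section \<open>Ergodic averages of digit functions\<close>

definition positive_weights :: "(nat \<Rightarrow> pattern) \<Rightarrow> (pattern \<Rightarrow> nat \<times> nat \<Rightarrow> real) \<Rightarrow> bool" where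
  "positive_weights pat P \<longleftrightarrow>
     (\<forall>k. (\<forall>w\<in>pat_D (pat k). 0 < P (pat k) w) \<and> (\<Sum>w\<in>pat_D (pat k). P (pat k) w) = 1)"

definition digit_sum ::
    "(nat \<Rightarrow> pattern) \<Rightarrow> (pattern \<Rightarrow> nat \<times> nat \<Rightarrow> real) \<Rightarrow> (nat \<Rightarrow> nat \<times> nat) \<Rightarrow> nat \<Rightarrow> real" where
  "digit_sum pat g w k = (\<Sum>l<k. g (pat l) (w l))"

definition digit_mean ::
    "(pattern \<Rightarrow> nat \<times> nat \<Rightarrow> real) \<Rightarrow> (pattern \<Rightarrow> nat \<times> nat \<Rightarrow> real) \<Rightarrow> pattern \<Rightarrow> real" where
  "digit_mean P g \<gamma> = (\<Sum>w\<in>pat_D \<gamma>. P \<gamma> w * g \<gamma> w)"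

locale moran =
  fixes pat :: "nat \<Rightarrow> pattern" and f :: "pattern \<Rightarrow> real"
  assumes pat_n_ge_2: "2 \<le> pat_n (pat k)" and pat_m_ge_2: "2 \<le> pat_m (pat k)"
    and pat_D_subset: "pat_D (pat k) \<subseteq> {..<pat_n (pat k)} \<times> {..<pat_m (pat k)}"
    and pat_D_nonempty: "pat_D (pat k) \<noteq> {}"
    and finite_range_pat: "finite (range pat)"
    and freq_limit: "\<gamma> \<in> range pat \<Longrightarrow> pattern_freq pat \<gamma> \<longlonglongrightarrow> f \<gamma>"
    and sum_freq: "(\<Sum>\<gamma>\<in>range pat. f \<gamma>) = 1"
    and zeta_le_1: "moran_zeta (range pat) f \<le> 1"
begin

definition freq_avg :: "(pattern \<Rightarrow> real) \<Rightarrow> real" where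
  "freq_avg \<phi> = (\<Sum>\<gamma>\<in>range pat. f \<gamma> * \<phi> \<gamma>)"

lemma finite_pat_D [simp]: "finite (pat_D (pat k))"
  using pat_D_subset[of k] by (rule finite_subset) auto

lemma freq_nonneg: "\<gamma> \<in> range pat \<Longrightarrow> 0 \<le> f \<gamma>"
  by (rule tendsto_lowerbound[OF freq_limit]) (auto simp: pattern_freq_def)

lemma freq_avg_cong: "(\<And>k. \<phi> (pat k) = \<psi> (pat k)) \<Longrightarrow> freq_avg \<phi> = freq_avg \<psi>"
  unfolding freq_avg_def by (intro sum.cong) auto

lemma freq_avg_mono: "(\<And>k. \<phi> (pat k) \<le> \<psi> (pat k)) \<Longrightarrow> freq_avg \<phi> \<le> freq_avg \<psi>"
  unfolding freq_avg_def by (intro sum_mono mult_left_mono) (auto intro: freq_nonneg)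

lemma freq_avg_linear:
  "freq_avg (\<lambda>\<gamma>. \<phi> \<gamma> + \<psi> \<gamma>) = freq_avg \<phi> + freq_avg \<psi>"
  "freq_avg (\<lambda>\<gamma>. \<phi> \<gamma> - \<psi> \<gamma>) = freq_avg \<phi> - freq_avg \<psi>"
  "freq_avg (\<lambda>\<gamma>. c * \<phi> \<gamma>) = c * freq_avg \<phi>"
  "freq_avg (\<lambda>\<gamma>. - \<phi> \<gamma>) = - freq_avg \<phi>"
  by (simp_all add: freq_avg_def algebra_simps sum.distrib sum_subtractf sum_distrib_left sum_negf)

lemma freq_avg_const: "freq_avg (\<lambda>_. c) = c"
  by (simp add: freq_avg_def sum_freq flip: sum_distrib_right)

lemma cesaro_tendsto_freq_avg: "(\<lambda>k. (\<Sum>l<k. \<phi> (pat l)) / real k) \<longlonglongrightarrow> freq_avg \<phi>"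
proof -
  have "(\<Sum>l<k. \<phi> (pat l)) / real k = (\<Sum>\<gamma>\<in>range pat. pattern_freq pat \<gamma> k * \<phi> \<gamma>)" for k
  proof -
    have "(\<Sum>l<k. \<phi> (pat l)) = (\<Sum>\<gamma>\<in>range pat. \<Sum>l\<in>{l \<in> {..<k}. pat l = \<gamma>}. \<phi> (pat l))"
      by (rule sum.group[symmetric]) (auto intro: finite_range_pat)
    also have "\<dots> = (\<Sum>\<gamma>\<in>range pat. real (card {l. l < k \<and> pat l = \<gamma>}) * \<phi> \<gamma>)"
      by (intro sum.cong) auto
    finally show ?thesis by (simp add: pattern_freq_def sum_divide_distrib)
  qed
  moreover have "(\<lambda>k. \<Sum>\<gamma>\<in>range pat. pattern_freq pat \<gamma> k * \<phi> \<gamma>) \<longlonglongrightarrow> freq_avg \<phi>"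
    unfolding freq_avg_def by (intro tendsto_sum tendsto_mult freq_limit tendsto_const)
  ultimately show ?thesis by simp
qed

lemma digit_function_bounded:
  obtains C where "1 \<le> C" "\<And>k w. w \<in> pat_D (pat k) \<Longrightarrow> \<bar>g (pat k) w\<bar> \<le> (C::real)"
proof -
  let ?S = "(\<lambda>(\<gamma>, w). \<bar>g \<gamma> w\<bar>) ` (SIGMA \<gamma>:range pat. pat_D \<gamma>)"
  have fin: "finite ?S"
    by (rule finite_imageI, rule finite_SigmaI[OF finite_range_pat]) auto
  show ?thesis
  proof (rule that[of "Max (insert 1 ?S)"])
    show "1 \<le> Max (insert 1 ?S)" using fin by (intro Max_ge) auto
    show "\<bar>g (pat k) w\<bar> \<le> Max (insert 1 ?S)" if "w \<in> pat_D (pat k)" for k w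
      using fin that by (intro Max_ge) force+
  qed
qed

lemma moran_code_iff: "w \<in> moran_code pat \<longleftrightarrow> (\<forall>k. w k \<in> pat_D (pat k))"
  by (auto simp: moran_code_def)

lemma prob_space_digit:
  assumes "positive_weights pat P"
  shows "prob_space (point_measure (pat_D (pat k)) (\<lambda>w. ennreal (P (pat k) w)))"
proof
  have "emeasure (point_measure (pat_D (pat k)) (\<lambda>w. ennreal (P (pat k) w))) (pat_D (pat k))
      = (\<Sum>w\<in>pat_D (pat k). ennreal (P (pat k) w))"
    by (subst emeasure_point_measure_finite) auto
  also have "\<dots> = 1"
    using assms by (subst sum_ennreal) (auto simp: positive_weights_def intro: less_imp_le)
  finally show "emeasure (point_measure (pat_D (pat k)) (\<lambda>w. ennreal (P (pat k) w)))
      (space (point_measure (pat_D (pat k)) (\<lambda>w. ennreal (P (pat k) w)))) = 1"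
    by (simp add: space_point_measure)
qed

lemma prob_space_code: "positive_weights pat P \<Longrightarrow> prob_space (moran_code_measure pat P)"
  unfolding moran_code_measure_def by (intro prob_space_PiM prob_space_digit)

lemma measurable_digit [measurable]:
  fixes g :: "nat \<times> nat \<Rightarrow> 'b::topological_space"
  shows "(\<lambda>w. g (w k)) \<in> moran_code_measure pat P \<rightarrow>\<^sub>M borel"
proof -
  have "g \<in> point_measure (pat_D (pat k)) (\<lambda>w. ennreal (P (pat k) w)) \<rightarrow>\<^sub>M borel" by simp
  then show ?thesis unfolding moran_code_measure_def
    by (rule measurable_compose[OF measurable_component_singleton, rotated]) simp
qed

lemma indep_digits:
  assumes P: "positive_weights pat P"
  shows "prob_space.indep_vars (moran_code_measure pat P) (\<lambda>_. borel)
           (\<lambda>l w. g (pat l) (w l) :: real) UNIV"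
proof -
  let ?N = "\<lambda>k. point_measure (pat_D (pat k)) (\<lambda>w. ennreal (P (pat k) w))"
  let ?M = "moran_code_measure pat P"
  interpret prob_space ?M using P by (rule prob_space_code)
  have "indep_vars ?N (\<lambda>l w. w l) UNIV"
  proof (subst indep_vars_iff_distr_eq_PiM)
    show "(\<lambda>w. w i) \<in> ?M \<rightarrow>\<^sub>M ?N i" for i
      unfolding moran_code_measure_def by (rule measurable_component_singleton) simp
    have "distr ?M (Pi\<^sub>M UNIV ?N) (\<lambda>x. \<lambda>i\<in>UNIV. x i) = Pi\<^sub>M UNIV ?N"
      by (simp add: moran_code_measure_def restrict_def)
    also have "\<dots> = Pi\<^sub>M UNIV (\<lambda>i. distr ?M (?N i) (\<lambda>w. w i))"
      unfolding moran_code_measure_def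
      by (intro PiM_cong refl distr_PiM_component[symmetric] prob_space_digit P) simp
    finally show "distr ?M (Pi\<^sub>M UNIV ?N) (\<lambda>x. \<lambda>i\<in>UNIV. x i) =
        Pi\<^sub>M UNIV (\<lambda>i. distr ?M (?N i) (\<lambda>w. w i))" .
  qed simp
  then show ?thesis by (rule indep_vars_compose2) simp
qed

lemma expectation_digit:
  assumes P: "positive_weights pat P"
  shows "(\<integral>w. g (pat l) (w l) \<partial>moran_code_measure pat P) = digit_mean P g (pat l)"
proof -
  let ?N = "\<lambda>k. point_measure (pat_D (pat k)) (\<lambda>w. ennreal (P (pat k) w))"
  have "digit_mean P g (pat l) = (\<integral>w. g (pat l) w \<partial>?N l)"
    using P by (subst lebesgue_integral_point_measure_finite)
      (auto simp: digit_mean_def positive_weights_def less_imp_le)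
  also have "?N l = distr (Pi\<^sub>M UNIV ?N) (?N l) (\<lambda>w. w l)"
    by (intro distr_PiM_component[symmetric] prob_space_digit P) simp
  also have "(\<integral>w. g (pat l) w \<partial>\<dots>) = (\<integral>w. g (pat l) (w l) \<partial>moran_code_measure pat P)"
    unfolding moran_code_measure_def
    by (rule integral_distr[OF measurable_component_singleton]) simp_all
  finally show ?thesis by simp
qed

text \<open>The strong law of large numbers for the independent, not identically distributed digits: the
  deviation probabilities decay exponentially by Hoeffding's inequality, so the lemma of Borel and
  Cantelli applies.\<close>

lemma AE_digit_average:
  assumes P: "positive_weights pat P"
  shows "AE w in moran_code_measure pat P.
           (\<lambda>k. digit_sum pat g w k / real k) \<longlonglongrightarrow> freq_avg (digit_mean P g)"
proof -
  let ?M = "moran_code_measure pat P"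
  interpret prob_space ?M using P by (rule prob_space_code)
  obtain C where C: "1 \<le> C" "\<And>k w. w \<in> pat_D (pat k) \<Longrightarrow> \<bar>g (pat k) w\<bar> \<le> C"
    using digit_function_bounded[of g] by blast
  let ?E = "\<lambda>k. \<Sum>l<k. digit_mean P g (pat l)"
  have [measurable]: "(\<lambda>w. digit_sum pat g w k) \<in> borel_measurable ?M" for k
    unfolding digit_sum_def by measurable
  have dev: "AE w in ?M. \<forall>\<^sub>F k in sequentially. \<bar>digit_sum pat g w k - ?E k\<bar> < \<delta> * real k"
    if \<delta>: "0 < \<delta>" for \<delta>
  proof -
    define A where "A k = {w \<in> space ?M. \<delta> * real k \<le> \<bar>digit_sum pat g w k - ?E k\<bar>}" for k
    have [measurable]: "A k \<in> sets ?M" for k unfolding A_def by measurable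
    have bound: "prob (A k) \<le> 2 * exp (- (\<delta>\<^sup>2 / (2 * C\<^sup>2))) ^ k" if "0 < k" for k
    proof -
      interpret Hoeffding_ineq ?M "{..<k}" "\<lambda>l w. g (pat l) (w l)" "\<lambda>_. - C" "\<lambda>_. C" "?E k"
      proof unfold_locales
        show "indep_vars (\<lambda>_. borel) (\<lambda>l w. g (pat l) (w l)) {..<k}"
          by (rule indep_vars_subset[OF indep_digits[OF P]]) simp
        show "AE w in ?M. g (pat i) (w i) \<in> {- C..C}" for i
        proof (rule AE_I2)
          fix w assume "w \<in> space ?M"
          then have "w i \<in> pat_D (pat i)" by (simp add: space_moran_code_measure moran_code_iff)
          from C(2)[OF this] show "g (pat i) (w i) \<in> {- C..C}" by (simp add: abs_le_iff)
        qed
      qed (simp_all add: expectation_digit[OF P])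
      have sq: "(\<Sum>i<k. (C - - C)\<^sup>2) = real k * (4 * C\<^sup>2)" by (simp add: power2_eq_square)
      have "prob (A k) \<le> 2 * exp (- 2 * (\<delta> * real k)\<^sup>2 / (real k * (4 * C\<^sup>2)))"
        using Hoeffding_ineq_abs_ge[of "\<delta> * real k"] \<delta> C that unfolding sq
        by (simp add: A_def digit_sum_def)
      also have "- 2 * (\<delta> * real k)\<^sup>2 / (real k * (4 * C\<^sup>2)) = real k * - (\<delta>\<^sup>2 / (2 * C\<^sup>2))"
        using that C by (simp add: power2_eq_square field_simps)
      finally show ?thesis by (simp only: exp_of_nat_mult)
    qed
    have "summable (\<lambda>k. prob (A k))"
    proof (rule summable_comparison_test'[where N = 1])
      show "summable (\<lambda>k. 2 * exp (- (\<delta>\<^sup>2 / (2 * C\<^sup>2))) ^ k)"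
        using \<delta> C by (intro summable_mult summable_geometric) simp
      show "norm (prob (A k)) \<le> 2 * exp (- (\<delta>\<^sup>2 / (2 * C\<^sup>2))) ^ k" if "1 \<le> k" for k
        using bound[of k] that by simp
    qed
    from borel_cantelli_AE1[OF _ _ this]
    have "AE w in ?M. \<forall>\<^sub>F k in sequentially. w \<in> space ?M - A k" by (simp add: less_top[symmetric])
    then show ?thesis
      by eventually_elim (auto simp: A_def not_le elim!: eventually_mono)
  qed
  have "AE w in ?M. \<forall>n. \<forall>\<^sub>F k in sequentially.
      \<bar>digit_sum pat g w k - ?E k\<bar> < inverse (real (Suc n)) * real k"
    unfolding AE_all_countable by (intro allI dev) simp
  then show ?thesis
  proof eventually_elim
    case (elim w)
    have "(\<lambda>k. digit_sum pat g w k / real k - ?E k / real k) \<longlonglongrightarrow> 0"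
    proof (rule tendstoI)
      fix e :: real assume "0 < e"
      then obtain n where n: "inverse (real (Suc n)) < e" using reals_Archimedean by auto
      show "\<forall>\<^sub>F k in sequentially. dist (digit_sum pat g w k / real k - ?E k / real k) 0 < e"
        using elim[rule_format, of n] eventually_gt_at_top[of 0]
      proof eventually_elim
        case (elim k)
        have "dist (digit_sum pat g w k / real k - ?E k / real k) 0
            = \<bar>digit_sum pat g w k - ?E k\<bar> / real k"
          using elim by (simp add: dist_real_def flip: diff_divide_distrib)
        also have "\<dots> < inverse (real (Suc n))" using elim by (simp add: field_simps)
        finally show ?case using n by linarith
      qed
    qed
    from tendsto_add[OF this cesaro_tendsto_freq_avg[of "digit_mean P g"]] show ?case by simp
  qed
qed

subsection \<open>Approximate squares\<close>

text \<open>More row digits than column digits are fixed. With \<open>l\<close> close to \<open>\<zeta>k\<close> this balances the two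
  contraction rates, while a cylinder projects in general to a long and thin set.\<close>

definition approx_square :: "(nat \<Rightarrow> nat \<times> nat) \<Rightarrow> nat \<Rightarrow> nat \<Rightarrow> (nat \<Rightarrow> nat \<times> nat) set" where
  "approx_square v l k =
     {u \<in> moran_code pat. (\<forall>i<l. u i = v i) \<and> (\<forall>i<k. snd (u i) = snd (v i))}"

lemma approx_square_self: "v \<in> moran_code pat \<Longrightarrow> v \<in> approx_square v l k"
  by (simp add: approx_square_def)

lemma approx_square_eq: "u \<in> approx_square v l k \<Longrightarrow> approx_square u l k = approx_square v l k"
  by (auto simp: approx_square_def)

lemma sum_row: "(\<Sum>w | w \<in> pat_D \<gamma> \<and> snd w = j. h w) = (\<Sum>i | (i, j) \<in> pat_D \<gamma>. h (i, j))"
  by (rule sum.reindex_bij_witness[of _ "\<lambda>i. (i, j)" fst]) auto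

lemma
  assumes P: "positive_weights pat P" and v: "v \<in> moran_code pat" and lk: "l \<le> k"
  shows sets_approx_square: "approx_square v l k \<in> sets (moran_code_measure pat P)"
    and measure_approx_square: "measure (moran_code_measure pat P) (approx_square v l k) =
      (\<Prod>i<l. P (pat i) (v i)) * (\<Prod>i\<in>{l..<k}. row_prob P (pat i) (snd (v i)))"
proof -
  let ?N = "\<lambda>k. point_measure (pat_D (pat k)) (\<lambda>w. ennreal (P (pat k) w))"
  let ?A = "\<lambda>i. if i < l then {v i} else {w \<in> pat_D (pat i). snd w = snd (v i)}"
  let ?q = "\<lambda>i. if i < l then P (pat i) (v i) else row_prob P (pat i) (snd (v i))"
  have v_in: "v i \<in> pat_D (pat i)" for i using v by (simp add: moran_code_iff)
  have "approx_square v l k = prod_emb UNIV ?N {..<k} (\<Pi>\<^sub>E i\<in>{..<k}. ?A i)"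
  proof (intro set_eqI iffI)
    fix u assume "u \<in> approx_square v l k"
    then show "u \<in> prod_emb UNIV ?N {..<k} (\<Pi>\<^sub>E i\<in>{..<k}. ?A i)"
      by (auto simp: approx_square_def prod_emb_def space_point_measure PiE_iff moran_code_def)
  next
    fix u assume u: "u \<in> prod_emb UNIV ?N {..<k} (\<Pi>\<^sub>E i\<in>{..<k}. ?A i)"
    then have 1: "u i \<in> pat_D (pat i)" for i
      by (auto simp: prod_emb_def space_point_measure PiE_iff)
    have 2: "u i \<in> ?A i" if "i < k" for i using u that by (auto simp: prod_emb_def PiE_iff restrict_def)
    have "u i = v i" if "i < l" for i using 2[of i] that lk by simp
    moreover have "snd (u i) = snd (v i)" if "i < k" for i
      using 2[of i] that by (cases "i < l") simp_all
    ultimately show "u \<in> approx_square v l k" using 1 by (simp add: approx_square_def moran_code_iff)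
  qed
  note eq = this
  have A: "?A i \<in> sets (?N i)" for i using v_in[of i] by (auto simp: sets_point_measure)
  show "approx_square v l k \<in> sets (moran_code_measure pat P)"
    unfolding eq moran_code_measure_def by (intro sets_PiM_I) (use A in auto)
  have nn: "0 \<le> P (pat i) w" if "w \<in> pat_D (pat i)" for i w
    using P that by (auto simp: positive_weights_def less_imp_le)
  have q_nn: "0 \<le> ?q i" for i
    using nn v_in by (auto simp: row_prob_def intro!: sum_nonneg)
  have em: "emeasure (?N i) (?A i) = ennreal (?q i)" for i
  proof (cases "i < l")
    case True
    then show ?thesis using v_in[of i] by (subst emeasure_point_measure_finite) auto
  next
    case False
    have "emeasure (?N i) (?A i) = (\<Sum>w | w \<in> pat_D (pat i) \<and> snd w = snd (v i). ennreal (P (pat i) w))"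
      using False by (subst emeasure_point_measure_finite) auto
    also have "\<dots> = ennreal (\<Sum>w | w \<in> pat_D (pat i) \<and> snd w = snd (v i). P (pat i) w)"
      using nn by (intro sum_ennreal) auto
    finally show ?thesis using False by (simp add: sum_row row_prob_def)
  qed
  interpret product_prob_space ?N UNIV by (intro product_prob_spaceI prob_space_digit P)
  have "emeasure (moran_code_measure pat P) (approx_square v l k) = (\<Prod>i<k. emeasure (?N i) (?A i))"
    unfolding eq moran_code_measure_def using A by (subst emeasure_PiM_emb) auto
  also have "\<dots> = ennreal (\<Prod>i<k. ?q i)" unfolding em by (intro prod_ennreal q_nn)
  finally have "measure (moran_code_measure pat P) (approx_square v l k) = (\<Prod>i<k. ?q i)"
    using q_nn by (simp only: measure_def enn2real_ennreal prod_nonneg)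
  also have "{..<k} = {..<l} \<union> {l..<k}" using lk by auto
  also have "(\<Prod>i\<in>{..<l} \<union> {l..<k}. ?q i) = (\<Prod>i<l. ?q i) * (\<Prod>i\<in>{l..<k}. ?q i)"
    by (rule prod.union_disjoint) auto
  finally show "measure (moran_code_measure pat P) (approx_square v l k) =
      (\<Prod>i<l. P (pat i) (v i)) * (\<Prod>i\<in>{l..<k}. row_prob P (pat i) (snd (v i)))"
    by simp
qed

definition log_prob :: "(pattern \<Rightarrow> nat \<times> nat \<Rightarrow> real) \<Rightarrow> pattern \<Rightarrow> nat \<times> nat \<Rightarrow> real" where
  "log_prob P \<gamma> w = ln (P \<gamma> w)"

definition log_row_prob :: "(pattern \<Rightarrow> nat \<times> nat \<Rightarrow> real) \<Rightarrow> pattern \<Rightarrow> nat \<times> nat \<Rightarrow> real" where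
  "log_row_prob P \<gamma> w = ln (row_prob P \<gamma> (snd w))"

lemma finite_row [simp]: "finite {i. (i, j) \<in> pat_D (pat k)}"
  by (rule finite_subset[of _ "fst ` pat_D (pat k)"]) (force, simp)

lemma row_prob_pos:
  assumes "positive_weights pat P" "w \<in> pat_D (pat k)"
  shows "0 < row_prob P (pat k) (snd w)"
  unfolding row_prob_def using assms
  by (intro sum_pos) (auto simp: positive_weights_def intro: exI[of _ "fst w"])

lemma
  assumes P: "positive_weights pat P" and v: "v \<in> moran_code pat" and lk: "l \<le> k"
  shows measure_approx_square_pos: "0 < measure (moran_code_measure pat P) (approx_square v l k)"
    and ln_measure_approx_square: "ln (measure (moran_code_measure pat P) (approx_square v l k)) =
      digit_sum pat (log_prob P) v l +
      (digit_sum pat (log_row_prob P) v k - digit_sum pat (log_row_prob P) v l)"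
proof -
  have v_in: "v i \<in> pat_D (pat i)" for i using v by (simp add: moran_code_iff)
  have 1: "0 < P (pat i) (v i)" for i using P v_in by (simp add: positive_weights_def)
  have 2: "0 < row_prob P (pat i) (snd (v i))" for i using P v_in by (rule row_prob_pos)
  show "0 < measure (moran_code_measure pat P) (approx_square v l k)"
    unfolding measure_approx_square[OF assms] using 1 2 by (intro mult_pos_pos prod_pos) auto
  have "digit_sum pat (log_row_prob P) v k - digit_sum pat (log_row_prob P) v l
      = (\<Sum>i\<in>{l..<k}. log_row_prob P (pat i) (v i))"
    unfolding digit_sum_def using lk by (simp add: sum_diff_nat_ivl flip: atLeast0LessThan)
  moreover have "ln ((\<Prod>i<l. P (pat i) (v i)) * (\<Prod>i\<in>{l..<k}. row_prob P (pat i) (snd (v i)))) =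
      (\<Sum>i<l. ln (P (pat i) (v i))) + (\<Sum>i\<in>{l..<k}. ln (row_prob P (pat i) (snd (v i))))"
    using 1 2 by (subst ln_mult_pos) (auto intro!: prod_pos simp: ln_prod less_imp_neq[symmetric])
  ultimately show "ln (measure (moran_code_measure pat P) (approx_square v l k)) =
      digit_sum pat (log_prob P) v l +
      (digit_sum pat (log_row_prob P) v k - digit_sum pat (log_row_prob P) v l)"
    unfolding measure_approx_square[OF assms] by (simp add: digit_sum_def log_prob_def log_row_prob_def)
qed

end

section \<open>Geometry of approximate squares\<close>

lemma tendsto_ratio_subseq:
  fixes s :: "nat \<Rightarrow> real" and a :: "nat \<Rightarrow> nat"
  assumes s: "(\<lambda>k. s k / real k) \<longlonglongrightarrow> c" and a: "(\<lambda>k. real (a k) / real k) \<longlonglongrightarrow> x" and "0 < x"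
  shows "(\<lambda>k. s (a k) / real k) \<longlonglongrightarrow> c * x"
proof -
  have "LIM k sequentially. real (a k) / real k * real k :> at_top"
    by (rule filterlim_tendsto_pos_mult_at_top[OF a \<open>0 < x\<close> filterlim_real_sequentially])
  moreover have "\<forall>\<^sub>F k in sequentially. real (a k) / real k * real k = real (a k)"
    using eventually_gt_at_top[of 0] by eventually_elim simp
  ultimately have "LIM k sequentially. real (a k) :> at_top"
    using filterlim_cong[OF refl refl] by fast
  then have a_top: "filterlim a at_top sequentially"
    by (simp add: filterlim_sequentially_iff_filterlim_real)
  have "(\<lambda>k. s (a k) / real (a k) * (real (a k) / real k)) \<longlonglongrightarrow> c * x"
    by (intro tendsto_mult a filterlim_compose[OF s a_top])
  moreover have "\<forall>\<^sub>F k in sequentially. s (a k) / real (a k) * (real (a k) / real k) = s (a k) / real k"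
    using a_top[unfolded filterlim_at_top, rule_format, of 1] by eventually_elim simp
  ultimately show ?thesis by (rule Lim_transform_eventually)
qed

lemma eventually_less_if_ratio_less:
  fixes a b :: "nat \<Rightarrow> real"
  assumes "(\<lambda>k. a k / real k) \<longlonglongrightarrow> x" "(\<lambda>k. b k / real k) \<longlonglongrightarrow> y" "x < y"
  shows "\<forall>\<^sub>F k in sequentially. a k < b k"
proof -
  have "\<forall>\<^sub>F k in sequentially. a k / real k < (x + y) / 2"
    using assms by (intro order_tendstoD(2)) auto
  moreover have "\<forall>\<^sub>F k in sequentially. (x + y) / 2 < b k / real k"
    using assms by (intro order_tendstoD(1)) auto
  ultimately show ?thesis using eventually_gt_at_top[of 0]
  proof eventually_elim
    case (elim k)
    then have "a k / real k < b k / real k" by linarith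
    then show ?case using elim by (simp add: divide_less_cancel)
  qed
qed

lemma linear_ratio: "(\<lambda>k. real k * c / real k) \<longlonglongrightarrow> c"
proof -
  have "\<forall>\<^sub>F k in sequentially. real k * c / real k = c"
    using eventually_gt_at_top[of 0] by eventually_elim simp
  then show ?thesis by (simp add: tendsto_cong)
qed

lemma floor_ratio: "0 \<le> c \<Longrightarrow> (\<lambda>k. real (nat \<lfloor>c * real k\<rfloor>) / real k) \<longlonglongrightarrow> c"
  by (rule filterlim_compose[OF nat_floor_ratio_tendsto filterlim_real_sequentially])

context moran
begin

sublocale hor: mixed_radix "\<lambda>k. pat_n (pat k)" by unfold_locales (rule pat_n_ge_2)
sublocale vert: mixed_radix "\<lambda>k. pat_m (pat k)" by unfold_locales (rule pat_m_ge_2)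

abbreviation "n_prod k \<equiv> base_prod (\<lambda>k. pat_n (pat k)) k"
abbreviation "m_prod k \<equiv> base_prod (\<lambda>k. pat_m (pat k)) k"
abbreviation "col_num w k \<equiv> digit_num (\<lambda>k. pat_n (pat k)) (\<lambda>k. fst (w k)) k"
abbreviation "row_num w k \<equiv> digit_num (\<lambda>k. pat_m (pat k)) (\<lambda>k. snd (w k)) k"

abbreviation zeta :: real where "zeta \<equiv> moran_zeta (range pat) f"

definition mean_log_m :: real where "mean_log_m = freq_avg (\<lambda>\<gamma>. ln (real (pat_m \<gamma>)))"
definition mean_log_n :: real where "mean_log_n = freq_avg (\<lambda>\<gamma>. ln (real (pat_n \<gamma>)))"

text \<open>The number of column digits that goes with \<open>k\<close> row digits. The quotient of the width
  \<open>1 / n_prod (level k)\<close> and the height \<open>1 / m_prod k\<close> is \<open>e\<^bsup>o(k)\<^esup>\<close>, in general not bounded; in return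
  \<open>level k \<le> k\<close> holds for all \<open>k\<close>, even if \<open>\<zeta> = 1\<close>.\<close>

definition level :: "nat \<Rightarrow> nat" where "level k = nat \<lfloor>zeta * real k\<rfloor>"

lemma pat_m_pos: "0 < real (pat_m (pat k))" and pat_n_pos: "0 < real (pat_n (pat k))"
  using pat_m_ge_2[of k] pat_n_ge_2[of k] by auto

lemma mean_log_pos: "0 < mean_log_m" "0 < mean_log_n"
proof -
  have "freq_avg (\<lambda>_. ln 2) \<le> mean_log_m" "freq_avg (\<lambda>_. ln 2) \<le> mean_log_n"
    unfolding mean_log_m_def mean_log_n_def
    using pat_m_pos pat_n_pos pat_m_ge_2 pat_n_ge_2
    by (auto intro!: freq_avg_mono simp: ln_le_cancel_iff)
  moreover have "0 < ln (2::real)" by simp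
  ultimately show "0 < mean_log_m" "0 < mean_log_n" unfolding freq_avg_const by linarith+
qed

lemma zeta_eq: "zeta = mean_log_m / mean_log_n"
  by (simp add: moran_zeta_def mean_log_m_def mean_log_n_def freq_avg_def)

lemma zeta_pos: "0 < zeta" using mean_log_pos by (simp add: zeta_eq)

lemma level_ratio: "(\<lambda>k. real (level k) / real k) \<longlonglongrightarrow> zeta"
  unfolding level_def using zeta_pos by (intro floor_ratio) simp

lemma level_mono: "k \<le> l \<Longrightarrow> level k \<le> level l"
  unfolding level_def using zeta_pos by (intro nat_mono floor_mono mult_left_mono) auto

lemma ln_m_prod: "ln (m_prod k) = (\<Sum>l<k. ln (real (pat_m (pat l))))"
  unfolding base_prod_def using pat_m_pos by (intro ln_prod) auto

lemma ln_n_prod: "ln (n_prod k) = (\<Sum>l<k. ln (real (pat_n (pat l))))"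
  unfolding base_prod_def using pat_n_pos by (intro ln_prod) auto

lemma ln_m_prod_ratio: "(\<lambda>k. ln (m_prod k) / real k) \<longlonglongrightarrow> mean_log_m"
  unfolding ln_m_prod mean_log_m_def by (rule cesaro_tendsto_freq_avg)

lemma ln_n_prod_level_ratio: "(\<lambda>k. ln (n_prod (level k)) / real k) \<longlonglongrightarrow> mean_log_m"
proof -
  have "(\<lambda>k. ln (n_prod k) / real k) \<longlonglongrightarrow> mean_log_n"
    unfolding ln_n_prod mean_log_n_def by (rule cesaro_tendsto_freq_avg)
  from tendsto_ratio_subseq[OF this level_ratio zeta_pos] show ?thesis
    using mean_log_pos by (simp add: zeta_eq)
qed

lemma moran_proj_eq: "moran_proj pat w =
    (expansion (\<lambda>k. pat_n (pat k)) (\<lambda>k. fst (w k)), expansion (\<lambda>k. pat_m (pat k)) (\<lambda>k. snd (w k)))"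
  by (simp add: moran_proj_def expansion_def base_prod_def lessThan_Suc_atMost del: prod.lessThan_Suc)

lemma code_digit_less:
  assumes "w \<in> moran_code pat"
  shows "fst (w k) < pat_n (pat k)" "snd (w k) < pat_m (pat k)"
proof -
  have "w k \<in> {..<pat_n (pat k)} \<times> {..<pat_m (pat k)}"
    using assms pat_D_subset[of k] by (auto simp: moran_code_iff)
  then show "fst (w k) < pat_n (pat k)" "snd (w k) < pat_m (pat k)" by (auto simp: mem_Times_iff)
qed

lemma dist_moran_proj_less:
  assumes "dist (moran_proj pat u) (moran_proj pat v) < r"
  shows "\<bar>expansion (\<lambda>k. pat_n (pat k)) (\<lambda>k. fst (u k)) - expansion (\<lambda>k. pat_n (pat k)) (\<lambda>k. fst (v k))\<bar> < r"
    and "\<bar>expansion (\<lambda>k. pat_m (pat k)) (\<lambda>k. snd (u k)) - expansion (\<lambda>k. pat_m (pat k)) (\<lambda>k. snd (v k))\<bar> < r"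
  using assms dist_fst_le[of "moran_proj pat u" "moran_proj pat v"]
    dist_snd_le[of "moran_proj pat u" "moran_proj pat v"]
  by (auto simp: moran_proj_eq dist_real_def)

lemma col_num_adjacent:
  assumes "u \<in> moran_code pat" "v \<in> moran_code pat" "dist (moran_proj pat u) (moran_proj pat v) < 1 / n_prod k"
  shows "\<bar>col_num u k - col_num v k\<bar> \<le> 1"
  by (rule hor.digit_num_adjacent) (use assms in \<open>auto intro: code_digit_less dist_moran_proj_less\<close>)

lemma row_num_adjacent:
  assumes "u \<in> moran_code pat" "v \<in> moran_code pat" "dist (moran_proj pat u) (moran_proj pat v) < 1 / m_prod k"
  shows "\<bar>row_num u k - row_num v k\<bar> \<le> 1"
  by (rule vert.digit_num_adjacent) (use assms in \<open>auto intro: code_digit_less dist_moran_proj_less\<close>)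

lemma dist_approx_square_le:
  assumes "v \<in> moran_code pat" "u \<in> approx_square v l k"
  shows "dist (moran_proj pat u) (moran_proj pat v) \<le> 1 / n_prod l + 1 / m_prod k"
proof -
  have u: "u \<in> moran_code pat" "\<And>i. i < l \<Longrightarrow> u i = v i" "\<And>i. i < k \<Longrightarrow> snd (u i) = snd (v i)"
    using assms by (auto simp: approx_square_def)
  have "dist (moran_proj pat u) (moran_proj pat v) \<le>
      \<bar>fst (moran_proj pat u) - fst (moran_proj pat v)\<bar> + \<bar>snd (moran_proj pat u) - snd (moran_proj pat v)\<bar>"
    unfolding dist_prod_def dist_real_def by (rule order_trans[OF sqrt_sum_squares_le_sum_abs]) simp
  also have "\<dots> \<le> 1 / n_prod l + 1 / m_prod k"
    unfolding moran_proj_eq fst_conv snd_conv using u assms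
    by (intro add_mono hor.expansion_dist_same_num vert.expansion_dist_same_num digit_num_cong)
      (auto intro: code_digit_less)
  finally show ?thesis .
qed

lemma eventually_approx_square_small:
  assumes "0 < \<delta>"
  shows "\<forall>\<^sub>F k in sequentially. \<forall>v\<in>moran_code pat. \<forall>u\<in>approx_square v (level k) k.
           dist (moran_proj pat u) (moran_proj pat v) < exp (- real k * (mean_log_m - \<delta>))"
proof -
  have 0: "(\<lambda>k. ln 2 / real k) \<longlonglongrightarrow> 0" by (rule lim_const_over_n)
  have 1: "(\<lambda>k. (real k * (mean_log_m - \<delta>) + ln 2) / real k) \<longlonglongrightarrow> mean_log_m - \<delta> + 0"
    unfolding add_divide_distrib by (intro tendsto_add linear_ratio 0)
  have "\<forall>\<^sub>F k in sequentially. real k * (mean_log_m - \<delta>) + ln 2 < ln (m_prod k)"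
    by (rule eventually_less_if_ratio_less[OF 1 ln_m_prod_ratio]) (use assms in simp)
  moreover have "\<forall>\<^sub>F k in sequentially. real k * (mean_log_m - \<delta>) + ln 2 < ln (n_prod (level k))"
    by (rule eventually_less_if_ratio_less[OF 1 ln_n_prod_level_ratio]) (use assms in simp)
  ultimately show ?thesis
  proof eventually_elim
    case (elim k)
    have inv: "1 / x < exp (- real k * (mean_log_m - \<delta>)) / 2"
      if "0 < x" "real k * (mean_log_m - \<delta>) + ln 2 < ln x" for x
    proof -
      have "exp (real k * (mean_log_m - \<delta>) + ln 2) < x" using that by (metis exp_less_cancel_iff exp_ln)
      then have "2 * exp (real k * (mean_log_m - \<delta>)) < x" by (simp add: exp_add)
      then have "inverse x < inverse (2 * exp (real k * (mean_log_m - \<delta>)))"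
        by (rule less_imp_inverse_less) simp
      then show ?thesis unfolding mult_minus_left exp_minus by (simp add: inverse_eq_divide)
    qed
    have "1 / n_prod (level k) + 1 / m_prod k < exp (- real k * (mean_log_m - \<delta>))"
      using inv[OF hor.base_prod_pos elim(2)] inv[OF vert.base_prod_pos elim(1)] by linarith
    then show ?case using dist_approx_square_le by (meson le_less_trans)
  qed
qed

lemma eventually_radius_small:
  assumes "0 < \<delta>"
  shows "\<forall>\<^sub>F k in sequentially. exp (- real k * (mean_log_m + \<delta>)) < 1 / n_prod (level k) \<and>
           exp (- real k * (mean_log_m + \<delta>)) < 1 / m_prod (k + 2)"
proof -
  have inv: "exp (- real k * (mean_log_m + \<delta>)) < 1 / x"
    if "0 < x" "ln x < real k * (mean_log_m + \<delta>)" for x k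
  proof -
    have "x < exp (real k * (mean_log_m + \<delta>))" using that by (metis exp_less_cancel_iff exp_ln)
    then have "inverse (exp (real k * (mean_log_m + \<delta>))) < inverse x"
      using that by (intro less_imp_inverse_less)
    then show ?thesis unfolding mult_minus_left exp_minus by (simp add: inverse_eq_divide)
  qed
  have "(\<lambda>k. 1 + 2 / real k) \<longlonglongrightarrow> 1 + 0" by (intro tendsto_add tendsto_const lim_const_over_n)
  moreover have "\<forall>\<^sub>F k in sequentially. 1 + 2 / real k = real (k + 2) / real k"
    using eventually_gt_at_top[of 0] by eventually_elim (simp add: field_simps)
  ultimately have r2: "(\<lambda>k. real (k + 2) / real k) \<longlonglongrightarrow> 1" by (simp add: tendsto_cong)
  have h2: "(\<lambda>k. ln (m_prod (k + 2)) / real k) \<longlonglongrightarrow> mean_log_m * 1"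
    by (rule tendsto_ratio_subseq[OF ln_m_prod_ratio r2]) simp
  have "\<forall>\<^sub>F k in sequentially. ln (n_prod (level k)) < real k * (mean_log_m + \<delta>)"
    by (rule eventually_less_if_ratio_less[OF ln_n_prod_level_ratio linear_ratio]) (use assms in simp)
  moreover have "\<forall>\<^sub>F k in sequentially. ln (m_prod (k + 2)) < real k * (mean_log_m + \<delta>)"
    by (rule eventually_less_if_ratio_less[OF h2 linear_ratio]) (use assms in simp)
  ultimately show ?thesis
    by eventually_elim (intro conjI inv hor.base_prod_pos vert.base_prod_pos)
qed

lemma measure_moran_ball:
  "measure (moran_measure pat P) (ball x r) =
   measure (moran_code_measure pat P) {v \<in> moran_code pat. dist x (moran_proj pat v) < r}"
  unfolding moran_measure_def
  by (subst measure_distr[OF measurable_moran_proj])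
    (auto intro!: arg_cong[of _ _ "measure _"] simp: space_moran_code_measure)

lemma sets_code_ball:
  "{v \<in> moran_code pat. dist x (moran_proj pat v) < r} \<in> sets (moran_code_measure pat P)"
proof -
  have "{v \<in> moran_code pat. dist x (moran_proj pat v) < r} =
      moran_proj pat -` ball x r \<inter> space (moran_code_measure pat P)"
    by (auto simp: space_moran_code_measure)
  then show ?thesis using measurable_sets[OF measurable_moran_proj, of "ball x r" pat P] by simp
qed

subsection \<open>Local dimension at typical points\<close>

text \<open>The digits of a code that can take part in a carry with a code of a nearby point: the other code
  must have the digit at the opposite end of the alphabet, and this digit must be admissible. In the
  case of columns the two codes have the same row digits.\<close>

definition row_carry :: "(pattern \<Rightarrow> nat) \<Rightarrow> (pattern \<Rightarrow> nat) \<Rightarrow> pattern \<Rightarrow> (nat \<times> nat) set" where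
  "row_carry a b \<gamma> = {w \<in> pat_D \<gamma>. snd w = a \<gamma> \<and> (\<exists>i. (i, b \<gamma>) \<in> pat_D \<gamma>)}"

definition col_carry :: "(pattern \<Rightarrow> nat) \<Rightarrow> (pattern \<Rightarrow> nat) \<Rightarrow> pattern \<Rightarrow> (nat \<times> nat) set" where
  "col_carry a b \<gamma> = {w \<in> pat_D \<gamma>. fst w = a \<gamma> \<and> (b \<gamma>, snd w) \<in> pat_D \<gamma>}"

definition carry_sets :: "(pattern \<Rightarrow> (nat \<times> nat) set) set" where
  "carry_sets = {row_carry (\<lambda>_. 0) (\<lambda>\<gamma>. pat_m \<gamma> - 1), row_carry (\<lambda>\<gamma>. pat_m \<gamma> - 1) (\<lambda>_. 0),
     col_carry (\<lambda>_. 0) (\<lambda>\<gamma>. pat_n \<gamma> - 1), col_carry (\<lambda>\<gamma>. pat_n \<gamma> - 1) (\<lambda>_. 0)}"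

definition carry_sparse :: "(nat \<Rightarrow> nat \<times> nat) \<Rightarrow> bool" where
  "carry_sparse w \<longleftrightarrow> (\<forall>S\<in>carry_sets. \<exists>c<1.
     (\<lambda>k. digit_sum pat (\<lambda>\<gamma>. indicat_real (S \<gamma>)) w k / real k) \<longlonglongrightarrow> c)"

lemma finite_carry_sets: "finite carry_sets" by (simp add: carry_sets_def)

text \<open>A digit can take part in a carry only if the digit at the opposite end is admissible too, and then
  the latter has positive probability.\<close>

lemma carry_set_mean_less_1:
  assumes P: "positive_weights pat P" and S: "S \<in> carry_sets"
  shows "digit_mean P (\<lambda>\<gamma>. indicat_real (S \<gamma>)) (pat k) < 1"
proof -
  have "\<exists>w\<in>pat_D (pat k). w \<notin> S (pat k)"
  proof (rule ccontr)
    assume "\<not> ?thesis"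
    then have all: "w \<in> S (pat k)" if "w \<in> pat_D (pat k)" for w using that by blast
    obtain w where w: "w \<in> pat_D (pat k)" using pat_D_nonempty by blast
    have ne: "pat_m (pat k) - 1 \<noteq> 0" "pat_n (pat k) - 1 \<noteq> 0"
      using pat_m_ge_2[of k] pat_n_ge_2[of k] by auto
    show False using S ne all w all[OF w]
      by (fastforce simp: carry_sets_def row_carry_def col_carry_def)
  qed
  then obtain w where w: "w \<in> pat_D (pat k)" "w \<notin> S (pat k)" by blast
  have "digit_mean P (\<lambda>\<gamma>. indicat_real (S \<gamma>)) (pat k) < (\<Sum>w\<in>pat_D (pat k). P (pat k) w)"
    unfolding digit_mean_def using P w
    by (intro sum_strict_mono_ex1) (auto simp: positive_weights_def less_imp_le indicator_def)
  also have "\<dots> = 1" using P by (simp add: positive_weights_def)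
  finally show ?thesis .
qed

lemma freq_avg_less_1:
  assumes "\<And>k. \<phi> (pat k) < 1"
  shows "freq_avg \<phi> < 1"
proof -
  have fin: "finite (\<phi> ` range pat)" "\<phi> ` range pat \<noteq> {}" using finite_range_pat by auto
  have "freq_avg \<phi> \<le> freq_avg (\<lambda>_. Max (\<phi> ` range pat))"
    using fin by (intro freq_avg_mono Max_ge) auto
  also have "\<dots> < 1" using Max_in[OF fin] assms by (auto simp: freq_avg_const)
  finally show ?thesis .
qed

lemma AE_carry_sparse:
  assumes P: "positive_weights pat P"
  shows "AE w in moran_code_measure pat P. carry_sparse w"
  unfolding carry_sparse_def
proof (rule AE_finite_allI[OF finite_carry_sets])
  fix S assume S: "S \<in> carry_sets"
  have "freq_avg (digit_mean P (\<lambda>\<gamma>. indicat_real (S \<gamma>))) < 1"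
    by (rule freq_avg_less_1) (rule carry_set_mean_less_1[OF P S])
  with AE_digit_average[OF P, of "\<lambda>\<gamma>. indicat_real (S \<gamma>)"]
  show "AE w in moran_code_measure pat P. \<exists>c<1.
      (\<lambda>k. digit_sum pat (\<lambda>\<gamma>. indicat_real (S \<gamma>)) w k / real k) \<longlonglongrightarrow> c"
    by (auto elim!: eventually_mono)
qed

text \<open>A run \<open>[a k, b k)\<close> of carry digits would raise the sum of the indicators by \<open>b k - a k\<close>, whereas
  density \<open>c < 1\<close> allows only about \<open>c (b k - a k)\<close>.\<close>

lemma eventually_no_carry_run:
  fixes a b :: "nat \<Rightarrow> nat"
  assumes w: "carry_sparse w" and S: "S \<in> carry_sets"
    and a: "(\<lambda>k. real (a k) / real k) \<longlonglongrightarrow> x" and b: "(\<lambda>k. real (b k) / real k) \<longlonglongrightarrow> y"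
    and xy: "0 < x" "x < y"
  shows "\<forall>\<^sub>F k in sequentially. \<exists>l\<in>{a k..<b k}. w l \<notin> S (pat l)"
proof -
  let ?s = "digit_sum pat (\<lambda>\<gamma>. indicat_real (S \<gamma>)) w"
  obtain c where c: "c < 1" "(\<lambda>k. ?s k / real k) \<longlonglongrightarrow> c"
    using w S by (auto simp: carry_sparse_def)
  have 1: "(\<lambda>k. (?s (b k) - ?s (a k)) / real k) \<longlonglongrightarrow> c * y - c * x"
    unfolding diff_divide_distrib using xy by (intro tendsto_diff tendsto_ratio_subseq[OF c(2)] a b) auto
  have 2: "(\<lambda>k. (real (b k) - real (a k)) / real k) \<longlonglongrightarrow> y - x"
    unfolding diff_divide_distrib by (intro tendsto_diff a b)
  have "c * (y - x) < 1 * (y - x)" using c xy by (intro mult_strict_right_mono) auto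
  then have "\<forall>\<^sub>F k in sequentially. ?s (b k) - ?s (a k) < real (b k) - real (a k)"
    by (intro eventually_less_if_ratio_less[OF 1 2]) (simp add: algebra_simps)
  moreover have "\<forall>\<^sub>F k in sequentially. real (a k) < real (b k)"
    by (rule eventually_less_if_ratio_less[OF a b xy(2)])
  ultimately show ?thesis
  proof eventually_elim
    case (elim k)
    show ?case
    proof (rule ccontr)
      assume "\<not> ?thesis"
      then have *: "indicat_real (S (pat l)) (w l) = 1" if "l \<in> {a k..<b k}" for l using that by auto
      have "?s (b k) - ?s (a k) = (\<Sum>l\<in>{a k..<b k}. indicat_real (S (pat l)) (w l))"
        unfolding digit_sum_def using elim by (simp add: sum_diff_nat_ivl flip: atLeast0LessThan)
      also have "\<dots> = real (b k) - real (a k)" using * elim by (simp add: of_nat_diff)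
      finally show False using elim by simp
    qed
  qed
qed

lemma level_le: "level k \<le> k"
proof -
  have "zeta * real k \<le> 1 * real k" using zeta_le_1 by (intro mult_right_mono) auto
  then show ?thesis unfolding level_def by linarith
qed

text \<open>If a nearby code had another row number already at order \<open>\<theta>k\<close>, then the carry would make all row
  digits between \<open>\<theta>k\<close> and \<open>k\<close> carry digits. Once the row digits are known to agree up to \<open>\<theta>k\<close>, the same
  argument between the orders \<open>\<theta>\<^sup>2k\<close> and \<open>\<theta>k\<close> applies to the column digits.\<close>

lemma eventually_near_imp_same_square:
  assumes w: "w \<in> moran_code pat" and sparse: "carry_sparse w" and th: "0 < \<theta>" "\<theta> < 1" and "0 < \<delta>"
  shows "\<forall>\<^sub>F k in sequentially. \<forall>v\<in>moran_code pat.
           dist (moran_proj pat v) (moran_proj pat w) < exp (- real k * (mean_log_m + \<delta>)) \<longrightarrow>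
           v \<in> approx_square w (level (nat \<lfloor>\<theta>\<^sup>2 * real k\<rfloor>)) (nat \<lfloor>\<theta>\<^sup>2 * real k\<rfloor>)"
proof -
  let ?k1 = "\<lambda>k. nat \<lfloor>\<theta> * real k\<rfloor>" and ?k2 = "\<lambda>k. nat \<lfloor>\<theta>\<^sup>2 * real k\<rfloor>"
  have th2: "0 < \<theta>\<^sup>2" "\<theta>\<^sup>2 < \<theta>" using th by (auto simp: power2_eq_square)
  have k1: "(\<lambda>k. real (?k1 k) / real k) \<longlonglongrightarrow> \<theta>" using th by (intro floor_ratio) simp
  have k2: "(\<lambda>k. real (?k2 k) / real k) \<longlonglongrightarrow> \<theta>\<^sup>2" using th by (intro floor_ratio) simp
  have l1: "(\<lambda>k. real (level (?k1 k)) / real k) \<longlonglongrightarrow> zeta * \<theta>"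
    using tendsto_ratio_subseq[OF level_ratio k1 th(1)] .
  have l2: "(\<lambda>k. real (level (?k2 k)) / real k) \<longlonglongrightarrow> zeta * \<theta>\<^sup>2"
    using tendsto_ratio_subseq[OF level_ratio k2 th2(1)] .
  have k0: "(\<lambda>k. real k / real k) \<longlonglongrightarrow> 1" using linear_ratio[of 1] by simp
  let ?S1 = "row_carry (\<lambda>_. 0) (\<lambda>\<gamma>. pat_m \<gamma> - 1)" and ?S2 = "row_carry (\<lambda>\<gamma>. pat_m \<gamma> - 1) (\<lambda>_. 0)"
  let ?S3 = "col_carry (\<lambda>_. 0) (\<lambda>\<gamma>. pat_n \<gamma> - 1)" and ?S4 = "col_carry (\<lambda>\<gamma>. pat_n \<gamma> - 1) (\<lambda>_. 0)"
  have S: "?S1 \<in> carry_sets" "?S2 \<in> carry_sets" "?S3 \<in> carry_sets" "?S4 \<in> carry_sets"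
    by (simp_all add: carry_sets_def)
  have row: "\<forall>\<^sub>F k in sequentially. \<exists>l\<in>{?k1 k..<k}. w l \<notin> A (pat l)" if "A \<in> carry_sets" for A
    by (rule eventually_no_carry_run[OF sparse that k1 k0]) (use th in auto)
  have col: "\<forall>\<^sub>F k in sequentially. \<exists>l\<in>{level (?k2 k)..<level (?k1 k)}. w l \<notin> A (pat l)"
    if "A \<in> carry_sets" for A
    by (rule eventually_no_carry_run[OF sparse that l2 l1]) (use th2 zeta_pos in auto)
  from eventually_radius_small[OF \<open>0 < \<delta>\<close>] row[OF S(1)] row[OF S(2)] col[OF S(3)] col[OF S(4)]
  show ?thesis
  proof eventually_elim
    case (elim k)
    show ?case
    proof (intro ballI impI)
      fix v assume v: "v \<in> moran_code pat"
        and "dist (moran_proj pat v) (moran_proj pat w) < exp (- real k * (mean_log_m + \<delta>))"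
      then have near: "dist (moran_proj pat v) (moran_proj pat w) < 1 / n_prod (level k)"
        "dist (moran_proj pat v) (moran_proj pat w) < 1 / m_prod (k + 2)" using elim(1) by linarith+
      have v_in: "v l \<in> pat_D (pat l)" and w_in: "w l \<in> pat_D (pat l)" for l
        using v w by (simp_all add: moran_code_iff)
      have k1_le: "?k1 k \<le> k"
      proof -
        have "\<theta> * real k \<le> 1 * real k" using th by (intro mult_right_mono) auto
        then show ?thesis by linarith
      qed
      have k21: "?k2 k \<le> ?k1 k"
        using th2 by (intro nat_mono floor_mono mult_right_mono) auto
      have "1 / m_prod (k + 2) \<le> 1 / m_prod k"
        by (intro divide_left_mono vert.base_prod_mono mult_pos_pos vert.base_prod_pos) auto
      then have row_adj: "\<bar>row_num v k - row_num w k\<bar> \<le> 1"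
        using near(2) by (intro row_num_adjacent v w) linarith
      have row_eq: "row_num v (?k1 k) = row_num w (?k1 k)"
      proof (rule ccontr)
        assume "\<not> ?thesis"
        from vert.digit_num_carry[OF code_digit_less(2)[OF v] code_digit_less(2)[OF w] k1_le row_adj this]
        consider "\<forall>l\<in>{?k1 k..<k}. snd (v l) = 0 \<and> snd (w l) = pat_m (pat l) - 1"
          | "\<forall>l\<in>{?k1 k..<k}. snd (v l) = pat_m (pat l) - 1 \<and> snd (w l) = 0" by blast
        then show False
        proof cases
          case 1
          obtain l where l: "l \<in> {?k1 k..<k}" "w l \<notin> ?S2 (pat l)" using elim(3) by blast
          from 1 l(1) have "snd (v l) = 0" "snd (w l) = pat_m (pat l) - 1" by auto
          then show False using l(2) v_in[of l] w_in[of l]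
            by (cases "v l") (auto simp: row_carry_def)
        next
          case 2
          obtain l where l: "l \<in> {?k1 k..<k}" "w l \<notin> ?S1 (pat l)" using elim(2) by blast
          from 2 l(1) have "snd (v l) = pat_m (pat l) - 1" "snd (w l) = 0" by auto
          then show False using l(2) v_in[of l] w_in[of l]
            by (cases "v l") (auto simp: row_carry_def)
        qed
      qed
      have snd_eq: "snd (v l) = snd (w l)" if "l < ?k1 k" for l
        using vert.digit_num_inject[OF code_digit_less(2)[OF v] code_digit_less(2)[OF w] row_eq that] .
      have lev: "level (?k2 k) \<le> level (?k1 k)" "level (?k1 k) \<le> level k" "level (?k1 k) \<le> ?k1 k"
        using k21 k1_le level_le by (auto intro: level_mono)
      have "1 / n_prod (level k) \<le> 1 / n_prod (level (?k1 k))"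
        using hor.base_prod_pos lev by (intro divide_left_mono hor.base_prod_mono mult_pos_pos) auto
      then have col_adj: "\<bar>col_num v (level (?k1 k)) - col_num w (level (?k1 k))\<bar> \<le> 1"
        using near(1) by (intro col_num_adjacent v w) linarith
      have col_eq: "col_num v (level (?k2 k)) = col_num w (level (?k2 k))"
      proof (rule ccontr)
        assume "\<not> ?thesis"
        from hor.digit_num_carry[OF code_digit_less(1)[OF v] code_digit_less(1)[OF w] lev(1) col_adj this]
        consider "\<forall>l\<in>{level (?k2 k)..<level (?k1 k)}. fst (v l) = 0 \<and> fst (w l) = pat_n (pat l) - 1"
          | "\<forall>l\<in>{level (?k2 k)..<level (?k1 k)}. fst (v l) = pat_n (pat l) - 1 \<and> fst (w l) = 0" by blast
        then show False
        proof cases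
          case 1
          obtain l where l: "l \<in> {level (?k2 k)..<level (?k1 k)}" "w l \<notin> ?S4 (pat l)" using elim(5) by blast
          from 1 l(1) have "fst (v l) = 0" "fst (w l) = pat_n (pat l) - 1" by auto
          moreover have "snd (v l) = snd (w l)" using l(1) lev(3) by (intro snd_eq) auto
          ultimately show False using l(2) v_in[of l] w_in[of l]
            by (cases "v l") (auto simp: col_carry_def)
        next
          case 2
          obtain l where l: "l \<in> {level (?k2 k)..<level (?k1 k)}" "w l \<notin> ?S3 (pat l)" using elim(4) by blast
          from 2 l(1) have "fst (v l) = pat_n (pat l) - 1" "fst (w l) = 0" by auto
          moreover have "snd (v l) = snd (w l)" using l(1) lev(3) by (intro snd_eq) auto
          ultimately show False using l(2) v_in[of l] w_in[of l]
            by (cases "v l") (auto simp: col_carry_def)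
        qed
      qed
      have fst_eq: "fst (v l) = fst (w l)" if "l < level (?k2 k)" for l
        using hor.digit_num_inject[OF code_digit_less(1)[OF v] code_digit_less(1)[OF w] col_eq that] .
      show "v \<in> approx_square w (level (?k2 k)) (?k2 k)"
        using v fst_eq snd_eq lev k21 by (auto simp: approx_square_def intro!: prod_eqI)
    qed
  qed
qed

lemma ln_measure_level_square_ratio:
  assumes P: "positive_weights pat P" and w: "w \<in> moran_code pat"
    and c1: "(\<lambda>k. digit_sum pat (log_prob P) w k / real k) \<longlonglongrightarrow> c1"
    and c2: "(\<lambda>k. digit_sum pat (log_row_prob P) w k / real k) \<longlonglongrightarrow> c2"
  shows "(\<lambda>k. ln (measure (moran_code_measure pat P) (approx_square w (level k) k)) / real k)
           \<longlonglongrightarrow> zeta * c1 + (1 - zeta) * c2"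
proof -
  have "(\<lambda>k. digit_sum pat (log_prob P) w (level k) / real k +
      (digit_sum pat (log_row_prob P) w k / real k - digit_sum pat (log_row_prob P) w (level k) / real k))
      \<longlonglongrightarrow> c1 * zeta + (c2 - c2 * zeta)"
    by (intro tendsto_add tendsto_diff c2 tendsto_ratio_subseq[OF c1 level_ratio zeta_pos]
        tendsto_ratio_subseq[OF c2 level_ratio zeta_pos])
  then show ?thesis
    by (simp add: ln_measure_approx_square[OF P w level_le] add_divide_distrib diff_divide_distrib
        algebra_simps)
qed

text \<open>If long runs of carry digits are absent, a ball around the point is squeezed between two
  approximate squares of nearly the same order, so the masses of approximate squares give the local
  dimension.\<close>

lemma has_local_dim_if_carry_sparse:
  assumes P: "positive_weights pat P" and w: "w \<in> moran_code pat" and sparse: "carry_sparse w"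
    and c1: "(\<lambda>k. digit_sum pat (log_prob P) w k / real k) \<longlonglongrightarrow> c1"
    and c2: "(\<lambda>k. digit_sum pat (log_row_prob P) w k / real k) \<longlonglongrightarrow> c2"
  shows "has_local_dim (moran_measure pat P) (moran_proj pat w)
           (- (zeta * c1 + (1 - zeta) * c2) / mean_log_m)"
proof -
  let ?M = "moran_code_measure pat P" and ?x = "moran_proj pat w"
  interpret prob_space ?M using P by (rule prob_space_code)
  define h where "h = - (zeta * c1 + (1 - zeta) * c2)"
  define L where "L k = ln (measure ?M (approx_square w (level k) k))" for k
  have L: "(\<lambda>k. L k / real k) \<longlonglongrightarrow> - h"
    unfolding L_def h_def using ln_measure_level_square_ratio[OF P w c1 c2] by (simp add: add.commute)
  have meas: "measure ?M (approx_square w (level k) k) = exp (L k)" for k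
    unfolding L_def using measure_approx_square_pos[OF P w level_le] by simp
  have "has_local_dim (moran_measure pat P) ?x (h / mean_log_m)"
  proof (rule has_local_dim_geometricI)
    show "finite_measure (moran_measure pat P)"
      unfolding moran_measure_def by (intro finite_measure_distr measurable_moran_proj)
    show "sets (moran_measure pat P) = sets borel" by (simp add: moran_measure_def)
    show "0 < mean_log_m" by (rule mean_log_pos)
  next
    fix \<delta> :: real assume \<delta>: "0 < \<delta>"
    \<comment> \<open>The ball lies in a square of order \<open>\<theta>\<^sup>2k\<close>, so \<open>\<theta>\<close> has to be so close to 1 that \<open>h \<theta>\<^sup>2 > h - \<delta>\<close>.\<close>
    have "((\<lambda>\<theta>. - h * \<theta>\<^sup>2) \<longlongrightarrow> - h * 1\<^sup>2) (at_left 1)" by (intro tendsto_intros)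
    then have "\<forall>\<^sub>F \<theta> in at_left 1. - h * \<theta>\<^sup>2 < - (h - \<delta>)" using \<delta> by (intro order_tendstoD(2)) auto
    moreover have "\<forall>\<^sub>F \<theta> in at_left 1. 0 < \<theta> \<and> \<theta> < (1::real)"
      by (auto simp: eventually_at_left_field intro: exI[of _ 0])
    ultimately have "\<forall>\<^sub>F \<theta> in at_left 1. - h * \<theta>\<^sup>2 < - (h - \<delta>) \<and> 0 < \<theta> \<and> \<theta> < 1"
      by eventually_elim simp
    then obtain \<theta> where th: "- h * \<theta>\<^sup>2 < - (h - \<delta>)" "0 < \<theta>" "\<theta> < 1"
      using eventually_happens'[of "at_left (1::real)"] by force
    let ?k2 = "\<lambda>k. nat \<lfloor>\<theta>\<^sup>2 * real k\<rfloor>"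
    have k2: "(\<lambda>k. real (?k2 k) / real k) \<longlonglongrightarrow> \<theta>\<^sup>2" using th by (intro floor_ratio) simp
    have "(\<lambda>k. L (?k2 k) / real k) \<longlonglongrightarrow> - h * \<theta>\<^sup>2"
      using th by (intro tendsto_ratio_subseq[OF L k2]) simp
    then have "\<forall>\<^sub>F k in sequentially. L (?k2 k) < real k * - (h - \<delta>)"
      by (rule eventually_less_if_ratio_less[OF _ linear_ratio th(1)])
    with eventually_near_imp_same_square[OF w sparse th(2,3) \<delta>]
    show "\<forall>\<^sub>F k in sequentially. measure (moran_measure pat P) (ball ?x (exp (- real k * (mean_log_m + \<delta>))))
        \<le> exp (- real k * (h - \<delta>))"
    proof eventually_elim
      case (elim k)
      have "measure (moran_measure pat P) (ball ?x (exp (- real k * (mean_log_m + \<delta>)))) \<le>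
          measure ?M (approx_square w (level (?k2 k)) (?k2 k))"
        unfolding measure_moran_ball using elim(1)
        by (intro finite_measure_mono sets_approx_square P w level_le) (auto simp: dist_commute)
      also have "\<dots> = exp (L (?k2 k))" by (rule meas)
      also have "\<dots> \<le> exp (- real k * (h - \<delta>))" using elim(2) by (simp add: algebra_simps)
      finally show ?case .
    qed
  next
    fix \<delta> :: real assume \<delta>: "0 < \<delta>" "\<delta> < mean_log_m"
    have "\<forall>\<^sub>F k in sequentially. real k * - (h + \<delta>) < L k"
      by (rule eventually_less_if_ratio_less[OF linear_ratio L]) (use \<delta> in simp)
    with eventually_approx_square_small[OF \<delta>(1)]
    show "\<forall>\<^sub>F k in sequentially. exp (- real k * (h + \<delta>)) \<le>
        measure (moran_measure pat P) (ball ?x (exp (- real k * (mean_log_m - \<delta>))))"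
    proof eventually_elim
      case (elim k)
      have "exp (- real k * (h + \<delta>)) \<le> exp (L k)" using elim(2) by (simp add: algebra_simps)
      also have "\<dots> = measure ?M (approx_square w (level k) k)" by (rule meas[symmetric])
      also have "\<dots> \<le> measure (moran_measure pat P) (ball ?x (exp (- real k * (mean_log_m - \<delta>))))"
        unfolding measure_moran_ball
      proof (intro finite_measure_mono sets_code_ball subsetI CollectI conjI)
        fix u assume u: "u \<in> approx_square w (level k) k"
        then show "u \<in> moran_code pat" by (simp add: approx_square_def)
        show "dist ?x (moran_proj pat u) < exp (- real k * (mean_log_m - \<delta>))"
          using elim(1) w u by (auto simp: dist_commute)
      qed
      finally show ?case .
    qed
  qed
  then show ?thesis by (simp add: h_def)
qed

subsection \<open>The support\<close>

lemma compact_moran_code: "compact (moran_code pat)"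
proof -
  have "compactin (product_topology (\<lambda>_. euclidean) UNIV) (\<Pi>\<^sub>E k\<in>UNIV. pat_D (pat k))"
    unfolding compactin_PiE by (auto intro: finite_imp_compact)
  then show ?thesis by (simp add: moran_code_def euclidean_product_topology)
qed

lemma continuous_on_moran_proj: "continuous_on (moran_code pat) (moran_proj pat)"
proof -
  have digit: "continuous_on A (\<lambda>w. g (w k))" for A :: "(nat \<Rightarrow> nat \<times> nat) set"
    and k and g :: "nat \<times> nat \<Rightarrow> real"
  proof -
    have "continuous_on A (\<lambda>w::nat \<Rightarrow> nat \<times> nat. w k)"
      by (intro continuous_on_subset[OF continuous_on_product_coordinates]) simp
    moreover have "open S" for S :: "(nat \<times> nat) set"
    proof -
      have "open (\<Union>x\<in>S. {fst x} \<times> {snd x})" by (intro open_UN ballI open_Times) (rule discrete_topology_class.open_discrete)+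
      also have "(\<Union>x\<in>S. {fst x} \<times> {snd x}) = S" by auto
      finally show ?thesis .
    qed
    then have "continuous_on UNIV g" by (simp add: continuous_on_open_vimage)
    ultimately show ?thesis by (metis continuous_on_compose2 subset_UNIV)
  qed
  have series: "continuous_on (moran_code pat) (\<lambda>w. expansion b (\<lambda>k. d (w k)))"
    if b: "mixed_radix b" and d: "\<And>w k. w \<in> moran_code pat \<Longrightarrow> d (w k) < b k"
    for b :: "nat \<Rightarrow> nat" and d
  proof -
    interpret mixed_radix b by fact
    let ?B = "\<lambda>k. 1 / base_prod b k - 1 / base_prod b (Suc k)"
    have "uniform_limit (moran_code pat) (\<lambda>n w. \<Sum>k<n. real (d (w k)) / base_prod b (Suc k))
        (\<lambda>w. \<Sum>k. real (d (w k)) / base_prod b (Suc k)) sequentially"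
    proof (rule Weierstrass_m_test)
      show "summable ?B" using telescope_summable'[OF base_prod_tendsto_0] by simp
      fix k w assume w: "w \<in> moran_code pat"
      have "0 \<le> real (d (w k)) / base_prod b (Suc k)"
        by (intro divide_nonneg_pos base_prod_pos) simp
      then show "norm (real (d (w k)) / base_prod b (Suc k)) \<le> ?B k"
        using digit_term_le[of "\<lambda>k. d (w k)" k, OF d[OF w]] by (simp only: real_norm_def abs_of_nonneg)
    qed
    then show ?thesis unfolding expansion_def
      by (rule uniform_limit_theorem[rotated])
        (auto intro!: always_eventually continuous_on_sum digit)
  qed
  show ?thesis unfolding moran_proj_eq[abs_def]
    by (intro continuous_on_Pair series hor.mixed_radix_axioms vert.mixed_radix_axioms code_digit_less)
qed

text \<open>A point off the compact Moran set has a ball of mass 0.\<close>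

lemma has_local_dim_imp_in_moran_set:
  assumes "has_local_dim (moran_measure pat P) x \<alpha>"
  shows "\<exists>w\<in>moran_code pat. x = moran_proj pat w"
proof (rule ccontr)
  assume "\<not> ?thesis"
  then have "x \<in> - (moran_proj pat ` moran_code pat)" by blast
  moreover have "open (- (moran_proj pat ` moran_code pat))"
    by (intro open_Compl compact_imp_closed compact_continuous_image continuous_on_moran_proj
        compact_moran_code)
  ultimately obtain r where r: "0 < r" "ball x r \<subseteq> - (moran_proj pat ` moran_code pat)"
    using open_contains_ball by blast
  have "{v \<in> moran_code pat. dist x (moran_proj pat v) < r} = {}" using r(2) by auto
  then have "measure (moran_measure pat P) (ball x r) = 0" by (simp only: measure_moran_ball measure_empty)
  then show False using assms r(1) by (auto simp: has_local_dim_def)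
qed

end

section \<open>Tilted weights\<close>

locale weighted_moran = moran +
  fixes p :: "pattern \<Rightarrow> nat \<times> nat \<Rightarrow> real"
  assumes p: "positive_weights pat p"
begin

abbreviation lp :: "pattern \<Rightarrow> nat \<times> nat \<Rightarrow> real" where "lp \<equiv> log_prob p"
abbreviation lq :: "pattern \<Rightarrow> nat \<times> nat \<Rightarrow> real" where "lq \<equiv> log_row_prob p"

text \<open>From here on \<open>p\<^sup>t\<close> is written as \<open>exp (t * ln p)\<close> and the row ratio \<open>u\<close> through its logarithm
  \<open>ln_ratio\<close>, so that everything is visibly differentiable in \<open>t\<close>.\<close>

definition row_power_sum :: "pattern \<Rightarrow> real \<Rightarrow> nat \<Rightarrow> real" where
  "row_power_sum \<gamma> t j = (\<Sum>i | (i, j) \<in> pat_D \<gamma>. exp (t * lp \<gamma> (i, j)))"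

definition ln_ratio :: "real \<Rightarrow> pattern \<Rightarrow> nat \<times> nat \<Rightarrow> real" where
  "ln_ratio t \<gamma> w = t * lq \<gamma> w - ln (row_power_sum \<gamma> t (snd w))"

definition partition_sum :: "pattern \<Rightarrow> real \<Rightarrow> real" where
  "partition_sum \<gamma> t = (\<Sum>w\<in>pat_D \<gamma>. exp (t * lp \<gamma> w + (1 - zeta) * ln_ratio t \<gamma> w))"

text \<open>The weights \<open>m\<^bsup>-\<beta>(t)\<^esup> p\<^sup>t u(j)\<^bsup>1 - \<zeta>\<^esup>\<close>, since \<open>partition_sum\<close> is \<open>m\<^bsup>\<beta>(t)\<^esup>\<close>. With the exponent \<open>1 - \<zeta>\<close> the row
  ratios enter the mass of an approximate square as \<open>\<Prod>\<^sub>i\<^sub><\<^sub>l u(j\<^sub>i) / (\<Prod>\<^sub>i\<^sub><\<^sub>k u(j\<^sub>i))\<^bsup>\<zeta>\<^esup>\<close>, which is subexponential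
  along typical codes because \<open>l\<close> is about \<open>\<zeta>k\<close>.\<close>

definition tilted :: "real \<Rightarrow> pattern \<Rightarrow> nat \<times> nat \<Rightarrow> real" where
  "tilted t \<gamma> w = exp (t * lp \<gamma> w + (1 - zeta) * ln_ratio t \<gamma> w) / partition_sum \<gamma> t"

lemma p_pos: "w \<in> pat_D (pat k) \<Longrightarrow> 0 < p (pat k) w"
  using p by (simp add: positive_weights_def)

lemma row_power_sum_pos:
  assumes "w \<in> pat_D (pat k)"
  shows "0 < row_power_sum (pat k) t (snd w)"
  unfolding row_power_sum_def using assms
  by (intro sum_pos) (auto intro: exI[of _ "fst w"])

lemma partition_sum_pos: "0 < partition_sum (pat k) t"
  unfolding partition_sum_def using pat_D_nonempty by (intro sum_pos) auto

lemma positive_weights_tilted: "positive_weights pat (tilted t)"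
  unfolding positive_weights_def
proof (intro allI conjI ballI)
  fix k
  show "0 < tilted t (pat k) w" for w by (simp add: tilted_def partition_sum_pos)
  have "(\<Sum>w\<in>pat_D (pat k). tilted t (pat k) w) = partition_sum (pat k) t / partition_sum (pat k) t"
    unfolding tilted_def partition_sum_def by (rule sum_divide_distrib[symmetric])
  then show "(\<Sum>w\<in>pat_D (pat k). tilted t (pat k) w) = 1"
    using partition_sum_pos[of k t] by simp
qed

lemma powr_eq_exp: "w \<in> pat_D (pat k) \<Longrightarrow> p (pat k) w powr t = exp (t * lp (pat k) w)"
  using p_pos[of w k] by (simp add: powr_def log_prob_def)

lemma row_ratio_eq:
  assumes w: "w \<in> pat_D (pat k)"
  shows "row_ratio p (pat k) t (snd w) = exp (ln_ratio t (pat k) w)"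
proof -
  have "(\<Sum>i | (i, snd w) \<in> pat_D (pat k). p (pat k) (i, snd w) powr t) = row_power_sum (pat k) t (snd w)"
    unfolding row_power_sum_def by (intro sum.cong) (auto simp: powr_eq_exp)
  then show ?thesis using row_prob_pos[OF p w] row_power_sum_pos[OF w, of t]
    by (simp add: row_ratio_def ln_ratio_def exp_diff powr_def log_row_prob_def)
qed

lemma beta_pat_eq: "beta_pat zeta p (pat k) t * ln (real (pat_m (pat k))) = ln (partition_sum (pat k) t)"
proof -
  have "(\<Sum>(i, j)\<in>pat_D (pat k). p (pat k) (i, j) powr t * row_ratio p (pat k) t j powr (1 - zeta)) =
      partition_sum (pat k) t"
    unfolding partition_sum_def
  proof (intro sum.cong refl, clarify)
    fix i j assume "(i, j) \<in> pat_D (pat k)"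
    from powr_eq_exp[OF this] row_ratio_eq[OF this]
    show "p (pat k) (i, j) powr t * row_ratio p (pat k) t j powr (1 - zeta) =
        exp (t * lp (pat k) (i, j) + (1 - zeta) * ln_ratio t (pat k) (i, j))"
      by (simp add: exp_add powr_def)
  qed
  moreover have "beta_eq zeta p (pat k) t (beta_pat zeta p (pat k) t)"
    unfolding beta_pat_def
    by (rule theI', rule beta_eq_unique) (auto simp: p_pos pat_m_ge_2 pat_D_nonempty)
  ultimately have "real (pat_m (pat k)) powr (- beta_pat zeta p (pat k) t) * partition_sum (pat k) t = 1"
    by (simp add: beta_eq_def)
  then have "ln (real (pat_m (pat k)) powr (- beta_pat zeta p (pat k) t)) + ln (partition_sum (pat k) t) = 0"
    using partition_sum_pos[of k t] pat_m_pos[of k]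
    by (subst ln_mult_pos[symmetric]) auto
  then show ?thesis using pat_m_pos[of k] by (simp add: ln_powr)
qed

lemma moran_beta_eq:
  "moran_beta (range pat) f p t = freq_avg (\<lambda>\<gamma>. ln (partition_sum \<gamma> t)) / mean_log_m"
proof -
  have "freq_avg (\<lambda>\<gamma>. ln (partition_sum \<gamma> t)) =
      freq_avg (\<lambda>\<gamma>. beta_pat zeta p \<gamma> t * ln (real (pat_m \<gamma>)))"
    by (intro freq_avg_cong) (simp add: beta_pat_eq)
  then show ?thesis by (simp add: moran_beta_def freq_avg_def mean_log_m_def mult.assoc)
qed

lemma log_prob_tilted:
  "log_prob (tilted t) (pat k) w =
     t * lp (pat k) w + (1 - zeta) * ln_ratio t (pat k) w - ln (partition_sum (pat k) t)"
  using partition_sum_pos[of k t] by (simp add: log_prob_def tilted_def ln_divide_pos)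

lemma log_row_prob_tilted:
  assumes w: "w \<in> pat_D (pat k)"
  shows "log_row_prob (tilted t) (pat k) w =
     t * lq (pat k) w - zeta * ln_ratio t (pat k) w - ln (partition_sum (pat k) t)"
proof -
  let ?u = "ln_ratio t (pat k) w" and ?s = "row_power_sum (pat k) t (snd w)"
  have u: "ln_ratio t (pat k) (i, snd w) = ?u" for i
    by (simp add: ln_ratio_def log_row_prob_def)
  have "row_prob (tilted t) (pat k) (snd w) = ?s * exp ((1 - zeta) * ?u) / partition_sum (pat k) t"
    unfolding row_prob_def tilted_def u row_power_sum_def
    by (simp add: exp_add sum_divide_distrib sum_distrib_right)
  also have "?s = exp (ln ?s)" using row_power_sum_pos[OF w] by simp
  finally have "log_row_prob (tilted t) (pat k) w =
      ln ?s + (1 - zeta) * ?u - ln (partition_sum (pat k) t)"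
    using partition_sum_pos[of k t] by (simp add: log_row_prob_def ln_divide_pos ln_mult_pos)
  also have "ln ?s = t * lq (pat k) w - ?u" by (simp add: ln_ratio_def)
  finally show ?thesis by (simp add: algebra_simps)
qed

lemma sum_by_rows:
  "(\<Sum>w\<in>pat_D (pat k). h w) = (\<Sum>j\<in>snd ` pat_D (pat k). \<Sum>i | (i, j) \<in> pat_D (pat k). h (i, j))"
proof -
  have "(\<Sum>w\<in>pat_D (pat k). h w) =
      (\<Sum>j\<in>snd ` pat_D (pat k). \<Sum>w\<in>{w \<in> pat_D (pat k). snd w = j}. h w)"
    by (rule sum.group[symmetric]) auto
  then show ?thesis by (simp add: sum_row)
qed

lemma DERIV_ln_partition_sum:
  "((\<lambda>t. ln (partition_sum (pat k) t)) has_real_derivative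
      - digit_mean (tilted t) (digit_energy zeta p) (pat k)) (at t)"
proof -
  let ?D = "pat_D (pat k)" and ?s = "\<lambda>w. row_power_sum (pat k) t (snd w)"
  let ?R = "\<lambda>j. \<Sum>i | (i, j) \<in> ?D. exp (t * lp (pat k) (i, j)) * lp (pat k) (i, j)"
  let ?e = "\<lambda>w. exp (t * lp (pat k) w + (1 - zeta) * ln_ratio t (pat k) w)"
  have s: "((\<lambda>t. row_power_sum (pat k) t j) has_real_derivative ?R j) (at t)" for j
    unfolding row_power_sum_def by (auto intro!: derivative_eq_intros simp: mult.commute)
  have "((\<lambda>t. exp (t * lp (pat k) w + (1 - zeta) * ln_ratio t (pat k) w)) has_real_derivative
      ?e w * (lp (pat k) w + (1 - zeta) * (lq (pat k) w - ?R (snd w) / ?s w))) (at t)"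
    if "w \<in> ?D" for w
    unfolding ln_ratio_def using row_power_sum_pos[OF that, of t]
    by (auto intro!: derivative_eq_intros s)
  then have "(partition_sum (pat k) has_real_derivative
      (\<Sum>w\<in>?D. ?e w * (lp (pat k) w + (1 - zeta) * (lq (pat k) w - ?R (snd w) / ?s w)))) (at t)"
    unfolding partition_sum_def[abs_def] by (intro DERIV_sum)
  \<comment> \<open>The derivative of the row power sum averages \<open>lp\<close> over each row with the weights of the row,
    so its contribution merges with that of \<open>lp\<close>.\<close>
  moreover have "(\<Sum>w\<in>?D. ?e w * (?R (snd w) / ?s w)) = (\<Sum>w\<in>?D. ?e w * lp (pat k) w)"
    unfolding sum_by_rows
  proof (rule sum.cong[OF refl])
    fix j assume "j \<in> snd ` ?D"
    then obtain v where v: "v \<in> ?D" "snd v = j" by auto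
    let ?h = "exp ((1 - zeta) * (t * lq (pat k) v - ln (row_power_sum (pat k) t j)))"
    have e: "?e (i, j) = exp (t * lp (pat k) (i, j)) * ?h" for i
      using v(2) by (simp add: exp_add ln_ratio_def log_row_prob_def)
    have "(\<Sum>i | (i, j) \<in> ?D. ?e (i, j) * (?R (snd (i, j)) / ?s (i, j))) =
        row_power_sum (pat k) t j * (?h * (?R j / row_power_sum (pat k) t j))"
      unfolding e snd_conv row_power_sum_def by (simp only: sum_distrib_right mult.assoc)
    also have "\<dots> = ?h * ?R j" using row_power_sum_pos[OF v(1), of t] v(2) by simp
    also have "\<dots> = (\<Sum>i | (i, j) \<in> ?D. ?e (i, j) * lp (pat k) (i, j))"
      unfolding e by (simp add: sum_distrib_left mult_ac)
    finally show "(\<Sum>i | (i, j) \<in> ?D. ?e (i, j) * (?R (snd (i, j)) / ?s (i, j))) =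
        (\<Sum>i | (i, j) \<in> ?D. ?e (i, j) * lp (pat k) (i, j))" .
  qed
  then have "(\<Sum>w\<in>?D. ?e w * (lp (pat k) w + (1 - zeta) * (lq (pat k) w - ?R (snd w) / ?s w))) =
      - (\<Sum>w\<in>?D. ?e w * digit_energy zeta p (pat k) w)"
  proof -
    have lin: "(\<Sum>w\<in>?D. E w * (a w + c * (b w - d w))) =
        (\<Sum>w\<in>?D. E w * a w) + c * (\<Sum>w\<in>?D. E w * b w) - c * (\<Sum>w\<in>?D. E w * d w)"
      for E a b d :: "nat \<times> nat \<Rightarrow> real" and c
      by (simp add: sum_distrib_left sum.distrib sum_subtractf algebra_simps)
    have neg: "(\<Sum>w\<in>?D. E w * a w) + (1 - c) * (\<Sum>w\<in>?D. E w * b w) - (1 - c) * (\<Sum>w\<in>?D. E w * a w) =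
        - (\<Sum>w\<in>?D. E w * (- c * a w - (1 - c) * b w))"
      for E a b :: "nat \<times> nat \<Rightarrow> real" and c
      by (simp add: sum_distrib_left sum.distrib sum_subtractf sum_negf algebra_simps)
    assume eq: "(\<Sum>w\<in>?D. ?e w * (?R (snd w) / ?s w)) = (\<Sum>w\<in>?D. ?e w * lp (pat k) w)"
    have "(\<Sum>w\<in>?D. ?e w * (lp (pat k) w + (1 - zeta) * (lq (pat k) w - ?R (snd w) / ?s w))) =
        (\<Sum>w\<in>?D. ?e w * lp (pat k) w) + (1 - zeta) * (\<Sum>w\<in>?D. ?e w * lq (pat k) w)
        - (1 - zeta) * (\<Sum>w\<in>?D. ?e w * (?R (snd w) / ?s w))"
      by (rule lin)
    also have "\<dots> = - (\<Sum>w\<in>?D. ?e w * digit_energy zeta p (pat k) w)"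
      unfolding eq neg by (simp add: digit_energy_def log_prob_def log_row_prob_def)
    finally show ?thesis .
  qed
  ultimately have "(partition_sum (pat k) has_real_derivative
      - (\<Sum>w\<in>?D. ?e w * digit_energy zeta p (pat k) w)) (at t)" by simp
  from DERIV_chain2[OF DERIV_ln this] partition_sum_pos[of k t]
  show ?thesis
    by (simp add: digit_mean_def tilted_def sum_divide_distrib inverse_eq_divide mult_ac)
qed

text \<open>Keeping in the partition sum only the row of \<open>w\<close>, and in the power sum of this row only \<open>w\<close>, leaves
  \<open>(p\<^sup>t)\<^bsup>\<zeta>\<^esup> (q\<^sup>t)\<^bsup>1 - \<zeta>\<^esup>\<close>.\<close>

lemma ln_partition_sum_ge:
  assumes w: "w \<in> pat_D (pat k)"
  shows "- t * digit_energy zeta p (pat k) w \<le> ln (partition_sum (pat k) t)"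
proof -
  let ?s = "row_power_sum (pat k) t (snd w)"
  let ?h = "exp ((1 - zeta) * ln_ratio t (pat k) w)"
  have "t * lp (pat k) w \<le> ln ?s"
  proof -
    have "exp (t * lp (pat k) (fst w, snd w)) \<le> ?s"
      unfolding row_power_sum_def using w by (intro member_le_sum) auto
    then show ?thesis using row_power_sum_pos[OF w, of t] by (simp add: ln_ge_iff)
  qed
  then have "zeta * (t * lp (pat k) w) \<le> zeta * ln ?s" using zeta_pos by (intro mult_left_mono) auto
  then have "- t * digit_energy zeta p (pat k) w \<le> ln ?s + (1 - zeta) * ln_ratio t (pat k) w"
    by (simp add: digit_energy_def ln_ratio_def log_prob_def log_row_prob_def algebra_simps)
  also have "\<dots> = ln (?s * ?h)" using row_power_sum_pos[OF w, of t] by (simp add: ln_mult_pos)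
  also have "\<dots> \<le> ln (partition_sum (pat k) t)"
  proof -
    have "?s * ?h = (\<Sum>v | v \<in> pat_D (pat k) \<and> snd v = snd w.
        exp (t * lp (pat k) v + (1 - zeta) * ln_ratio t (pat k) v))"
      unfolding sum_row row_power_sum_def sum_distrib_right
      by (intro sum.cong refl) (simp add: exp_add ln_ratio_def log_row_prob_def row_power_sum_def)
    also have "\<dots> \<le> partition_sum (pat k) t"
      unfolding partition_sum_def by (intro sum_mono2) auto
    finally show ?thesis using row_power_sum_pos[OF w, of t] by (intro ln_mono) auto
  qed
  finally show ?thesis .
qed

text \<open>The function \<open>\<alpha>t + \<beta>(t)\<close> tends to infinity at both ends because \<open>\<beta>(t) \<ge> - t \<alpha>\<^sub>m\<^sub>i\<^sub>n\<close> and
  \<open>\<beta>(t) \<ge> - t \<alpha>\<^sub>m\<^sub>a\<^sub>x\<close>, hence it has a minimum. The derivative vanishes there, which says that the tilted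
  weights have mean energy \<open>\<alpha>\<close> in units of the mean of \<open>log m\<close>.\<close>

lemma exists_minimising_tilt:
  assumes "alpha_min (range pat) f p < \<alpha>" "\<alpha> < alpha_max (range pat) f p"
  obtains t where
    "(INF t::real. ereal (\<alpha> * t + moran_beta (range pat) f p t)) = ereal (\<alpha> * t + moran_beta (range pat) f p t)"
    "freq_avg (digit_mean (tilted t) (digit_energy zeta p)) = \<alpha> * mean_log_m"
proof -
  define F where "F t = \<alpha> * t + moran_beta (range pat) f p t" for t
  let ?E = "\<lambda>k. digit_energy zeta p (pat k) ` pat_D (pat k)"
  have fin: "finite (?E k)" "?E k \<noteq> {}" for k using pat_D_nonempty by auto
  have ge: "- t * x (pat k) \<le> ln (partition_sum (pat k) t)" if "x (pat k) \<in> ?E k" for x t k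
    using that ln_partition_sum_ge by auto
  have beta_ge: "- t * (freq_avg x / mean_log_m) \<le> moran_beta (range pat) f p t"
    if "\<And>k. x (pat k) \<in> ?E k" for x t
  proof -
    have "- t * freq_avg x \<le> freq_avg (\<lambda>\<gamma>. ln (partition_sum \<gamma> t))"
      unfolding freq_avg_linear(3)[symmetric] by (intro freq_avg_mono ge that)
    then have "- t * freq_avg x / mean_log_m \<le> freq_avg (\<lambda>\<gamma>. ln (partition_sum \<gamma> t)) / mean_log_m"
      using mean_log_pos by (intro divide_right_mono) auto
    then show ?thesis by (simp add: moran_beta_eq)
  qed
  have "alpha_min (range pat) f p =
      freq_avg (\<lambda>\<gamma>. Min (digit_energy zeta p \<gamma> ` pat_D \<gamma>)) / mean_log_m"
    "alpha_max (range pat) f p =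
      freq_avg (\<lambda>\<gamma>. Max (digit_energy zeta p \<gamma> ` pat_D \<gamma>)) / mean_log_m"
    by (simp_all add: alpha_min_def alpha_max_def freq_avg_def mean_log_m_def)
  then have F_ge: "t * (\<alpha> - alpha_min (range pat) f p) \<le> F t"
    "t * (\<alpha> - alpha_max (range pat) f p) \<le> F t" for t
    using beta_ge[of "\<lambda>\<gamma>. Min (digit_energy zeta p \<gamma> ` pat_D \<gamma>)" t]
      beta_ge[of "\<lambda>\<gamma>. Max (digit_energy zeta p \<gamma> ` pat_D \<gamma>)" t] Min_in[OF fin] Max_in[OF fin]
    by (auto simp: F_def algebra_simps)
  have F0: "0 \<le> F 0" using F_ge(1)[of 0] by simp
  define c where "c = min (\<alpha> - alpha_min (range pat) f p) (alpha_max (range pat) f p - \<alpha>)"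
  have c: "0 < c" using assms by (simp add: c_def)
  define R where "R = F 0 / c + 1"
  have R: "0 < R" using F0 c by (simp add: R_def add_nonneg_pos)
  have deriv: "(F has_real_derivative
      \<alpha> - freq_avg (digit_mean (tilted t) (digit_energy zeta p)) / mean_log_m) (at t)" for t
  proof -
    have "((\<lambda>t. freq_avg (\<lambda>\<gamma>. ln (partition_sum \<gamma> t))) has_real_derivative
        freq_avg (\<lambda>\<gamma>. - digit_mean (tilted t) (digit_energy zeta p) \<gamma>)) (at t)"
      unfolding freq_avg_def
      by (intro DERIV_sum DERIV_cmult) (auto intro: DERIV_ln_partition_sum)
    then show ?thesis using mean_log_pos unfolding F_def[abs_def] moran_beta_eq freq_avg_linear(4)
      by (auto intro!: derivative_eq_intros)
  qed
  have "continuous_on {- R..R} F"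
    using DERIV_isCont[OF deriv] by (intro continuous_at_imp_continuous_on) auto
  then obtain t0 where t0: "t0 \<in> {- R..R}" "\<And>t. t \<in> {- R..R} \<Longrightarrow> F t0 \<le> F t"
    using continuous_attains_inf[of "{- R..R}" F] R by auto
  have min: "F t0 \<le> F t" for t
  proof (cases "t \<in> {- R..R}")
    case False
    have "F t0 \<le> F 0" using t0(2)[of 0] R by simp
    also have "F 0 \<le> R * c" using c by (simp add: R_def field_simps)
    also have "\<dots> \<le> \<bar>t\<bar> * c" using False c by (intro mult_right_mono) auto
    also have "\<dots> \<le> F t"
    proof (cases "0 \<le> t")
      case True
      have "\<bar>t\<bar> * c \<le> t * (\<alpha> - alpha_min (range pat) f p)"
        using True by (simp add: c_def mult_left_mono)
      then show ?thesis using F_ge(1)[of t] by linarith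
    next
      case False
      have "\<bar>t\<bar> * c \<le> (- t) * (alpha_max (range pat) f p - \<alpha>)"
        using False by (simp add: c_def mult_left_mono)
      then show ?thesis using F_ge(2)[of t] by (simp add: algebra_simps)
    qed
    finally show ?thesis .
  qed (use t0 in auto)
  have "\<alpha> - freq_avg (digit_mean (tilted t0) (digit_energy zeta p)) / mean_log_m = 0"
    using DERIV_local_min[OF deriv zero_less_one] min by blast
  then have "freq_avg (digit_mean (tilted t0) (digit_energy zeta p)) = \<alpha> * mean_log_m"
    using mean_log_pos by (simp add: field_simps)
  moreover have "(INF t. ereal (F t)) = ereal (F t0)"
    by (intro antisym INF_lower INF_greatest) (simp_all add: min)
  ultimately show ?thesis using that unfolding F_def by blast
qed

end

section \<open>Row sums near their lower limit\<close>

text \<open>The number \<open>L\<close> is the lower limit of \<open>S k / k\<close>.\<close>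

lemma exists_liminf_ratio:
  fixes S :: "nat \<Rightarrow> real"
  assumes "\<And>k. \<bar>S k\<bar> \<le> C * real k"
  obtains L where "\<And>\<delta>. 0 < \<delta> \<Longrightarrow> \<forall>\<^sub>F k in sequentially. (L - \<delta>) * real k < S k"
    and "\<And>\<delta>. 0 < \<delta> \<Longrightarrow> \<exists>\<^sub>F k in sequentially. S k < (L + \<delta>) * real k"
proof -
  define X where "X = {x. \<forall>\<^sub>F k in sequentially. x * real k < S k}"
  have low: "- C - 1 \<in> X"
  proof -
    have "(- C - 1) * real k < S k" if "0 < k" for k
      using assms[of k] that by (simp add: algebra_simps abs_le_iff)
    then show ?thesis unfolding X_def mem_Collect_eq
      by (rule eventually_mono[OF eventually_gt_at_top])
  qed
  have bdd: "x \<le> C" if "x \<in> X" for x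
  proof -
    have "\<forall>\<^sub>F k in sequentially. x * real k < S k \<and> 0 < k"
      using that eventually_gt_at_top[of 0] by (auto simp: X_def eventually_conj)
    then obtain k where k: "x * real k < S k" "0 < k" using eventually_happens' sequentially_bot by blast
    with assms[of k] have "x * real k < C * real k" by linarith
    then show ?thesis using k(2) by simp
  qed
  show ?thesis
  proof (rule that[of "Sup X"])
    fix \<delta> :: real assume \<delta>: "0 < \<delta>"
    obtain x where x: "x \<in> X" "Sup X - \<delta> < x"
      using less_cSupE[of "Sup X - \<delta>" X] \<delta> low by auto
    have "\<forall>\<^sub>F k in sequentially. x * real k < S k" using x(1) by (simp add: X_def)
    then show "\<forall>\<^sub>F k in sequentially. (Sup X - \<delta>) * real k < S k"
    proof eventually_elim
      case (elim k)
      have "(Sup X - \<delta>) * real k \<le> x * real k" using x(2) by (intro mult_right_mono) auto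
      with elim show ?case by linarith
    qed
    have "Sup X + \<delta> / 2 \<notin> X"
    proof
      assume "Sup X + \<delta> / 2 \<in> X"
      then have "Sup X + \<delta> / 2 \<le> Sup X" using bdd by (intro cSup_upper) (auto simp: bdd_above_def)
      with \<delta> show False by simp
    qed
    then have "\<exists>\<^sub>F k in sequentially. \<not> (Sup X + \<delta> / 2) * real k < S k"
      by (simp add: X_def not_eventually)
    then have "\<exists>\<^sub>F k in sequentially. 0 < k \<and> \<not> (Sup X + \<delta> / 2) * real k < S k"
      using eventually_gt_at_top[of 0] by (rule frequently_eventually_conj)
    then show "\<exists>\<^sub>F k in sequentially. S k < (Sup X + \<delta>) * real k"
    proof (rule frequently_elim1)
      fix k assume k: "0 < k \<and> \<not> (Sup X + \<delta> / 2) * real k < S k"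
      have "(Sup X + \<delta> / 2) * real k < (Sup X + \<delta>) * real k"
        using k \<delta> by (intro mult_strict_right_mono) auto
      with k show "S k < (Sup X + \<delta>) * real k" by linarith
    qed
  qed
qed

text \<open>Along a run of \<open>Z\<close> the function \<open>S k - y k\<close> is affine, so a negative value inside the run forces a
  negative value at one of its two ends, up to a bounded error from moving one step out of the run.\<close>

lemma small_ratio_at_end_of_run:
  fixes S :: "nat \<Rightarrow> real"
  assumes step: "\<And>l. Z l \<Longrightarrow> S (Suc l) = S l + U" and bd: "\<And>l. \<bar>S (Suc l) - S l\<bar> \<le> C"
    and before: "\<not> Z n" "n < k" and "Z k" and after: "\<not> Z n'" "k < n'"
    and small: "S k < y * real k"
  obtains k' where "n \<le> k'" "Z k' \<noteq> Z (Suc k')" "S k' < y * real k' + (\<bar>y\<bar> + C)"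
proof -
  have C: "0 \<le> C" using bd[of 0] by linarith
  have lin: "S l = S a + real (l - a) * U" if "a \<le> l" "\<And>i. a \<le> i \<Longrightarrow> i < l \<Longrightarrow> Z i" for a l
    using that by (induction l rule: dec_induct) (auto simp: step Suc_diff_le algebra_simps)
  define e where "e = (LEAST l. k < l \<and> \<not> Z l)"
  have e: "k < e" "\<not> Z e" unfolding e_def using LeastI[of "\<lambda>l. k < l \<and> \<not> Z l" n'] after by auto
  have in_e: "Z l" if "k \<le> l" "l < e" for l
    using not_less_Least[of l "\<lambda>l. k < l \<and> \<not> Z l"] that \<open>Z k\<close> unfolding e_def by (cases "l = k") auto
  define s where "s = (GREATEST l. l < k \<and> \<not> Z l)"
  have s: "s < k" "\<not> Z s" unfolding s_def using GreatestI_nat[of "\<lambda>l. l < k \<and> \<not> Z l" n k] before by auto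
  have ge: "l \<le> s" if "l < k" "\<not> Z l" for l
    unfolding s_def using Greatest_le_nat[of "\<lambda>l. l < k \<and> \<not> Z l" l k] that by auto
  have in_s: "Z l" if "s < l" "l \<le> k" for l using ge[of l] that \<open>Z k\<close> by (cases "l = k") auto
  show ?thesis
  proof (cases "U \<le> y")
    case True
    have "S (e - 1) = S k + real (e - 1 - k) * U" using e in_e by (intro lin) auto
    also have "\<dots> \<le> S k + real (e - 1 - k) * y" using True by (intro add_left_mono mult_left_mono) auto
    also have "\<dots> < y * real (e - 1)" using small e by (simp add: of_nat_diff algebra_simps)
    finally have "S (e - 1) < y * real (e - 1) + (\<bar>y\<bar> + C)" using C by linarith
    moreover have "Z (e - 1)" "\<not> Z (Suc (e - 1))" using e in_e[of "e - 1"] by auto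
    moreover have "n \<le> e - 1" using e before by simp
    ultimately show ?thesis using that[of "e - 1"] by simp
  next
    case False
    have "S k = S (Suc s) + real (k - Suc s) * U" using s in_s by (intro lin) auto
    then have "S (Suc s) = S k - real (k - Suc s) * U" by simp
    also have "\<dots> \<le> S k - real (k - Suc s) * y" using False by (intro diff_left_mono mult_left_mono) auto
    also have "\<dots> < y * real (Suc s)" using small s by (simp add: of_nat_diff algebra_simps)
    also have "y * real (Suc s) = y * real s + y" by (simp add: algebra_simps)
    finally have "S s < y * real s + (\<bar>y\<bar> + C)" using bd[of s] by linarith
    moreover have "Z (Suc s)" using s by (intro in_s) auto
    moreover have "n \<le> s" using ge before by blast
    ultimately show ?thesis using that[of s] s by simp
  qed
qed

lemma (in mixed_radix) digit_num_mono:
  assumes "s \<le> k" "digit_num b d s \<le> digit_num b e s" "\<And>l. s \<le> l \<Longrightarrow> l < k \<Longrightarrow> d l \<le> e l"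
  shows "digit_num b d k \<le> digit_num b e k"
  using assms by (induction k rule: dec_induct) (auto intro!: add_mono mult_right_mono)

context moran
begin

lemma digit_sum_cong_rows:
  assumes "\<And>k w w'. w \<in> pat_D (pat k) \<Longrightarrow> w' \<in> pat_D (pat k) \<Longrightarrow> snd w = snd w' \<Longrightarrow>
      g (pat k) w = g (pat k) w'"
    and "v \<in> moran_code pat" "w \<in> moran_code pat" "\<And>l. l < k \<Longrightarrow> snd (v l) = snd (w l)" "j \<le> k"
  shows "digit_sum pat g v j = digit_sum pat g w j"
  unfolding digit_sum_def using assms by (intro sum.cong) (auto simp: moran_code_iff)

text \<open>If the row digits of \<open>w\<close> are at one end of the alphabet from \<open>s\<close> on, then a nearby code either has
  row digits at the opposite end, by a carry that starts before \<open>s\<close>, or the same digits: no code with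
  the same row number at order \<open>s\<close> can pass beyond the end of the alphabet.\<close>

lemma near_constant_tail:
  assumes w: "w \<in> moran_code pat" and v: "v \<in> moran_code pat" and "s \<le> k"
    and tail: "(\<forall>l\<ge>s. snd (w l) = 0) \<or> (\<forall>l\<ge>s. snd (w l) = pat_m (pat l) - 1)"
    and adj: "\<bar>row_num v (k + 2) - row_num w (k + 2)\<bar> \<le> 1"
  shows "(\<forall>l\<in>{s..<k}. snd (v l) = 0) \<or> (\<forall>l\<in>{s..<k}. snd (v l) = pat_m (pat l) - 1)"
proof (cases "row_num v s = row_num w s")
  case False
  from vert.digit_num_carry[OF code_digit_less(2)[OF v] code_digit_less(2)[OF w] _ adj this] \<open>s \<le> k\<close>
  show ?thesis by auto
next
  case True
  have "row_num v k = row_num w k"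
  proof (rule ccontr)
    assume ne: "\<not> ?thesis"
    have m: "pat_m (pat k) - 1 \<noteq> 0" using pat_m_ge_2[of k] by simp
    have kk: "k \<le> k + 2" "k \<in> {k..<k + 2}" by auto
    from vert.digit_num_carry[OF code_digit_less(2)[OF v] code_digit_less(2)[OF w] kk(1) adj ne]
    have carry: "(row_num v (k + 2) = row_num w (k + 2) + 1 \<and> snd (w k) = pat_m (pat k) - 1) \<or>
        (row_num v (k + 2) = row_num w (k + 2) - 1 \<and> snd (w k) = 0)"
      using kk(2) by blast
    show False
      using tail
    proof
      assume z: "\<forall>l\<ge>s. snd (w l) = 0"
      have "row_num w (k + 2) \<le> row_num v (k + 2)"
      proof (rule vert.digit_num_mono)
        show "s \<le> k + 2" using \<open>s \<le> k\<close> by simp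
        show "row_num w s \<le> row_num v s" using True by simp
        show "snd (w l) \<le> snd (v l)" if "s \<le> l" for l using z that by simp
      qed
      moreover have "snd (w k) = 0" using z \<open>s \<le> k\<close> by blast
      with carry m have "row_num v (k + 2) = row_num w (k + 2) - 1" by metis
      ultimately show False by linarith
    next
      assume z: "\<forall>l\<ge>s. snd (w l) = pat_m (pat l) - 1"
      have "row_num v (k + 2) \<le> row_num w (k + 2)"
      proof (rule vert.digit_num_mono)
        show "s \<le> k + 2" using \<open>s \<le> k\<close> by simp
        show "row_num v s \<le> row_num w s" using True by simp
        show "snd (v l) \<le> snd (w l)" if "s \<le> l" for l
          using z that code_digit_less(2)[OF v, of l] by simp
      qed
      moreover have "snd (w k) = pat_m (pat k) - 1" using z \<open>s \<le> k\<close> by blast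
      with carry m have "row_num v (k + 2) = row_num w (k + 2) + 1" by metis
      ultimately show False by linarith
    qed
  qed
  then have "snd (v l) = snd (w l)" if "l < k" for l
    using vert.digit_num_inject[OF code_digit_less(2)[OF v] code_digit_less(2)[OF w] _ that] by blast
  then show ?thesis using tail by auto
qed

text \<open>The key inequality of the upper bound. At the orders \<open>k\<close> where \<open>S\<^sub>k / k\<close> is close to its lower
  limit, \<open>S\<close> at \<open>\<zeta>k\<close> is at least \<open>\<zeta>S\<^sub>k - \<epsilon>k\<close>. To control nearby codes as well, the order is chosen so
  that the row digits \<open>k\<close> and \<open>k + 1\<close> are not at the same end of the alphabet: then no carry
  reaches back before \<open>k\<close> and nearby codes have the same row digits up to \<open>k\<close>. Inside a run of
  extreme digits there is no such \<open>k\<close>, but \<open>S\<^sub>k / k\<close> is almost as small next to one of the ends of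
  the run. If a run never ends, \<open>S\<close> is linear from its start on, for the code and for its neighbours.\<close>

lemma frequently_row_sum_ge:
  assumes w: "w \<in> moran_code pat" and "0 < \<epsilon>"
    and row_fun: "\<And>k w w'. w \<in> pat_D (pat k) \<Longrightarrow> w' \<in> pat_D (pat k) \<Longrightarrow> snd w = snd w' \<Longrightarrow>
      g (pat k) w = g (pat k) w'"
    and bottom: "\<And>k w. w \<in> pat_D (pat k) \<Longrightarrow> snd w = 0 \<Longrightarrow> g (pat k) w = U0"
    and top: "\<And>k w. w \<in> pat_D (pat k) \<Longrightarrow> snd w = pat_m (pat k) - 1 \<Longrightarrow> g (pat k) w = U1"
  shows "\<exists>\<^sub>F k in sequentially. \<forall>v\<in>moran_code pat. \<bar>row_num v (k + 2) - row_num w (k + 2)\<bar> \<le> 1 \<longrightarrow>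
           - \<epsilon> * real k \<le> digit_sum pat g v (level k) - zeta * digit_sum pat g v k"
proof -
  obtain C where C: "1 \<le> C" "\<And>k w. w \<in> pat_D (pat k) \<Longrightarrow> \<bar>g (pat k) w\<bar> \<le> C"
    using digit_function_bounded[of g] by blast
  have g_bd: "\<bar>g (pat l) (v l)\<bar> \<le> C" if "v \<in> moran_code pat" for v l
    using that C(2) by (simp add: moran_code_iff)
  have sum_bd: "\<bar>digit_sum pat g v k\<bar> \<le> C * real k" if "v \<in> moran_code pat" for v k
  proof -
    have "\<bar>digit_sum pat g v k\<bar> \<le> (\<Sum>l<k. C)"
      unfolding digit_sum_def using that by (intro order_trans[OF sum_abs] sum_mono g_bd)
    then show ?thesis by (simp add: mult.commute)
  qed
  have level_bounds: "zeta * real k - 1 \<le> real (level k)" "real (level k) \<le> zeta * real k" for k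
  proof -
    have "0 \<le> zeta * real k" using zeta_pos by simp
    then show "zeta * real k - 1 \<le> real (level k)" "real (level k) \<le> zeta * real k"
      unfolding level_def by linarith+
  qed
  have level_top: "filterlim level at_top sequentially"
  proof -
    have "LIM k sequentially. real (level k) / real k * real k :> at_top"
      by (rule filterlim_tendsto_pos_mult_at_top[OF level_ratio zeta_pos filterlim_real_sequentially])
    moreover have "\<forall>\<^sub>F k in sequentially. real (level k) / real k * real k = real (level k)"
      using eventually_gt_at_top[of 0] by eventually_elim simp
    ultimately have "LIM k sequentially. real (level k) :> at_top"
      using filterlim_cong[OF refl refl] by fast
    then show ?thesis by (simp add: filterlim_sequentially_iff_filterlim_real)
  qed
  have large: "\<forall>\<^sub>F k in sequentially. c \<le> \<epsilon> * real k" for c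
    using filterlim_tendsto_pos_mult_at_top[OF tendsto_const[of \<epsilon>] \<open>0 < \<epsilon>\<close> filterlim_real_sequentially]
    by (simp add: filterlim_at_top)
  let ?top = "\<lambda>l. snd (w l) = pat_m (pat l) - 1" and ?bot = "\<lambda>l. snd (w l) = 0"
  have excl: "\<not> (?top l \<and> ?bot l)" for l using pat_m_ge_2[of l] by auto
  show ?thesis
  proof (cases "\<exists>s. (\<forall>l\<ge>s. ?bot l) \<or> (\<forall>l\<ge>s. ?top l)")
    case True
    then obtain s where tail: "(\<forall>l\<ge>s. ?bot l) \<or> (\<forall>l\<ge>s. ?top l)" by blast
    define c where "c = \<bar>U0\<bar> + \<bar>U1\<bar>"
    have "\<forall>\<^sub>F k in sequentially. s \<le> level k"
      using level_top by (simp add: filterlim_at_top)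
    with large[of "C * real s + c * real s + c"]
    have "\<forall>\<^sub>F k in sequentially. \<forall>v\<in>moran_code pat. \<bar>row_num v (k + 2) - row_num w (k + 2)\<bar> \<le> 1 \<longrightarrow>
        - \<epsilon> * real k \<le> digit_sum pat g v (level k) - zeta * digit_sum pat g v k"
    proof eventually_elim
      case (elim k)
      show ?case
      proof (intro ballI impI)
        fix v assume v: "v \<in> moran_code pat" "\<bar>row_num v (k + 2) - row_num w (k + 2)\<bar> \<le> 1"
        have sk: "s \<le> k" using elim(2) level_le[of k] by simp
        have v_in: "v l \<in> pat_D (pat l)" for l using v(1) by (simp add: moran_code_iff)
        obtain U where U: "\<bar>U\<bar> \<le> c" "\<And>l. l \<in> {s..<k} \<Longrightarrow> g (pat l) (v l) = U"
        proof (cases "\<forall>l\<in>{s..<k}. snd (v l) = 0")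
          case True
          then show ?thesis using that[of U0] bottom[OF v_in] by (simp add: c_def)
        next
          case False
          with near_constant_tail[OF w v(1) sk tail v(2)]
          have "\<forall>l\<in>{s..<k}. snd (v l) = pat_m (pat l) - 1" by blast
          then show ?thesis using that[of U1] top[OF v_in] by (simp add: c_def)
        qed
        have lin: "digit_sum pat g v j = digit_sum pat g v s + real (j - s) * U" if "s \<le> j" "j \<le> k" for j
        proof -
          have "digit_sum pat g v j - digit_sum pat g v s = (\<Sum>l\<in>{s..<j}. g (pat l) (v l))"
            unfolding digit_sum_def using that by (simp add: sum_diff_nat_ivl flip: atLeast0LessThan)
          also have "\<dots> = real (j - s) * U" using that U(2) by simp
          finally show ?thesis by simp
        qed
        let ?Ss = "digit_sum pat g v s"
        have eq: "digit_sum pat g v (level k) - zeta * digit_sum pat g v k =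
            (1 - zeta) * ?Ss - (1 - zeta) * (real s * U) + (real (level k) - zeta * real k) * U"
          by (subst lin[OF elim(2) level_le], subst lin[OF sk order_refl])
            (use elim(2) sk in \<open>simp add: of_nat_diff algebra_simps\<close>)
        have z: "\<bar>1 - zeta\<bar> \<le> 1" using zeta_pos zeta_le_1 by simp
        have "\<bar>(1 - zeta) * ?Ss\<bar> \<le> 1 * (C * real s)"
          unfolding abs_mult using z sum_bd[OF v(1)] by (intro mult_mono) auto
        moreover have "\<bar>(1 - zeta) * (real s * U)\<bar> \<le> 1 * (real s * c)"
          unfolding abs_mult using z U(1) by (intro mult_mono) auto
        moreover have "\<bar>(real (level k) - zeta * real k) * U\<bar> \<le> 1 * c"
          unfolding abs_mult using U(1) level_bounds[of k] by (intro mult_mono) auto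
        ultimately show "- \<epsilon> * real k \<le> digit_sum pat g v (level k) - zeta * digit_sum pat g v k"
          using elim(1) unfolding eq by (simp add: mult.commute)
      qed
    qed
    then show ?thesis by (rule eventually_frequently[OF sequentially_bot])
  next
    case False
    let ?S = "digit_sum pat g w"
    let ?K = "\<lambda>k. \<not> (?bot k \<and> ?bot (Suc k)) \<and> \<not> (?top k \<and> ?top (Suc k))"
    have w_in: "w l \<in> pat_D (pat l)" for l using w by (simp add: moran_code_iff)
    obtain L where L: "\<And>\<delta>. 0 < \<delta> \<Longrightarrow> \<forall>\<^sub>F k in sequentially. (L - \<delta>) * real k < ?S k"
      "\<And>\<delta>. 0 < \<delta> \<Longrightarrow> \<exists>\<^sub>F k in sequentially. ?S k < (L + \<delta>) * real k"
      using exists_liminf_ratio[OF sum_bd[OF w]] by blast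
    have step: "?S (Suc l) = ?S l + g (pat l) (w l)" for l by (simp add: digit_sum_def)
    have step_bd: "\<bar>?S (Suc l) - ?S l\<bar> \<le> C" for l using g_bd[OF w] by (simp add: step)
    have K: "\<exists>\<^sub>F k in sequentially. ?K k \<and> ?S k < (L + \<delta>) * real k" if "0 < \<delta>" for \<delta>
      unfolding frequently_sequentially
    proof
      fix N
      let ?y = "L + \<delta> / 2"
      obtain N' where N': "N \<le> N'" "2 * (\<bar>?y\<bar> + C) \<le> \<delta> * real N'"
      proof -
        obtain N2 :: nat where "2 * (\<bar>?y\<bar> + C) / \<delta> \<le> real N2" using real_arch_simple by blast
        then have "2 * (\<bar>?y\<bar> + C) \<le> \<delta> * real N2" using that \<open>0 < \<delta>\<close> by (simp add: field_simps)
        also have "\<dots> \<le> \<delta> * real (max N N2)" using \<open>0 < \<delta>\<close> by (intro mult_left_mono) auto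
        finally show ?thesis using that[of "max N N2"] by simp
      qed
      obtain n0 where n0: "N' \<le> n0" "\<not> ?bot n0" using False by blast
      obtain n1 where n1: "N' \<le> n1" "\<not> ?top n1" using False by blast
      have "\<exists>k\<ge>Suc (max n0 n1). ?S k < ?y * real k"
        using L(2)[of "\<delta> / 2"] \<open>0 < \<delta>\<close> unfolding frequently_sequentially by simp
      then obtain k where k: "n0 < k" "n1 < k" "?S k < ?y * real k" by (auto simp: Suc_le_eq)
      \<comment> \<open>The choice of \<open>N'\<close> absorbs the bounded error at the end of a run into \<open>\<delta> / 2\<close>.\<close>
      have conclude: "?S k' < (L + \<delta>) * real k'" if "N' \<le> k'" "?S k' < ?y * real k' + (\<bar>?y\<bar> + C)" for k'
      proof -
        have "\<delta> * real N' \<le> \<delta> * real k'" using that \<open>0 < \<delta>\<close> by (intro mult_left_mono) auto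
        then have "\<bar>?y\<bar> + C \<le> \<delta> / 2 * real k'" using N'(2) by simp
        then show ?thesis using that(2) by (simp add: algebra_simps)
      qed
      consider "?K k" | "?bot k" | "?top k" by blast
      then show "\<exists>k'\<ge>N. ?K k' \<and> ?S k' < (L + \<delta>) * real k'"
      proof cases
        case 1
        have "?S k < ?y * real k + (\<bar>?y\<bar> + C)" using k(3) C(1) by linarith
        moreover have "N' \<le> k" using n0 k by simp
        ultimately show ?thesis using 1 conclude[of k] N'(1) by (intro exI[of _ k]) simp
      next
        case 2
        obtain n' where n': "k < n'" "\<not> ?bot n'" using False by (meson Suc_le_eq)
        have "?S (Suc l) = ?S l + U0" if "?bot l" for l using step bottom[OF w_in that] by simp
        from small_ratio_at_end_of_run[of ?bot, OF this step_bd n0(2) k(1) 2 n'(2,1) k(3)]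
        obtain k' where k': "n0 \<le> k'" "?bot k' \<noteq> ?bot (Suc k')" "?S k' < ?y * real k' + (\<bar>?y\<bar> + C)"
          by blast
        have "?K k'" using k'(2) excl[of k'] excl[of "Suc k'"] by blast
        moreover have "N' \<le> k'" using k'(1) n0(1) by simp
        ultimately show ?thesis using conclude[of k'] k'(3) N'(1) by (intro exI[of _ k']) simp
      next
        case 3
        obtain n' where n': "k < n'" "\<not> ?top n'" using False by (meson Suc_le_eq)
        have "?S (Suc l) = ?S l + U1" if "?top l" for l using step top[OF w_in that] by simp
        from small_ratio_at_end_of_run[of ?top, OF this step_bd n1(2) k(2) 3 n'(2,1) k(3)]
        obtain k' where k': "n1 \<le> k'" "?top k' \<noteq> ?top (Suc k')" "?S k' < ?y * real k' + (\<bar>?y\<bar> + C)"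
          by blast
        have "?K k'" using k'(2) excl[of k'] excl[of "Suc k'"] by blast
        moreover have "N' \<le> k'" using k'(1) n1(1) by simp
        ultimately show ?thesis using conclude[of k'] k'(3) N'(1) by (intro exI[of _ k']) simp
      qed
    qed
    have "\<forall>\<^sub>F k in sequentially. (L - \<epsilon> / 4) * real (level k) < ?S (level k)"
      by (rule eventually_compose_filterlim[OF L(1) level_top]) (use \<open>0 < \<epsilon>\<close> in simp)
    then have "\<forall>\<^sub>F k in sequentially. (L - \<epsilon> / 4) * real (level k) < ?S (level k) \<and>
        2 * \<bar>L\<bar> \<le> \<epsilon> * real k"
      using large by (rule eventually_conj)
    moreover have "0 < \<epsilon> / 4" using \<open>0 < \<epsilon>\<close> by simp
    ultimately
    have "\<exists>\<^sub>F k in sequentially. (?K k \<and> ?S k < (L + \<epsilon> / 4) * real k) \<and>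
        (L - \<epsilon> / 4) * real (level k) < ?S (level k) \<and> 2 * \<bar>L\<bar> \<le> \<epsilon> * real k"
      by (intro frequently_elim1[OF frequently_eventually_conj[OF K]]) (assumption+, elim conjE, intro conjI)
    then show ?thesis
    proof (rule frequently_elim1, intro ballI impI)
      fix k v
      assume k: "(?K k \<and> ?S k < (L + \<epsilon> / 4) * real k) \<and>
          (L - \<epsilon> / 4) * real (level k) < ?S (level k) \<and> 2 * \<bar>L\<bar> \<le> \<epsilon> * real k"
        and v: "v \<in> moran_code pat" "\<bar>row_num v (k + 2) - row_num w (k + 2)\<bar> \<le> 1"
      have "row_num v k = row_num w k"
      proof (rule ccontr)
        assume ne: "\<not> ?thesis"
        have "k \<le> k + 2" by simp
        from vert.digit_num_carry[OF code_digit_less(2)[OF v(1)] code_digit_less(2)[OF w] this v(2) ne]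
        show False using k by auto
      qed
      then have rows: "snd (v l) = snd (w l)" if "l < k" for l
        using vert.digit_num_inject[OF code_digit_less(2)[OF v(1)] code_digit_less(2)[OF w] _ that] by blast
      have eq: "digit_sum pat g v j = ?S j" if "j \<le> k" for j
        by (rule digit_sum_cong_rows[of g v w k j]) (use row_fun v(1) w rows that in blast)+
      have "zeta * ?S k \<le> zeta * ((L + \<epsilon> / 4) * real k)"
        using k zeta_pos by (intro mult_left_mono) auto
      moreover have "\<bar>L * (real (level k) - zeta * real k)\<bar> \<le> \<bar>L\<bar> * 1"
        unfolding abs_mult using level_bounds[of k] by (intro mult_left_mono) auto
      moreover have "\<epsilon> / 4 * real (level k) \<le> \<epsilon> / 4 * real k"
        using level_le[of k] \<open>0 < \<epsilon>\<close> by (intro mult_left_mono) auto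
      moreover have "\<epsilon> / 4 * (zeta * real k) \<le> \<epsilon> / 4 * (1 * real k)"
        using zeta_le_1 \<open>0 < \<epsilon>\<close> by (intro mult_left_mono mult_right_mono) auto
      ultimately have "- \<epsilon> * real k \<le> ?S (level k) - zeta * ?S k"
        using k by (simp add: algebra_simps abs_le_iff)
      then show "- \<epsilon> * real k \<le> digit_sum pat g v (level k) - zeta * digit_sum pat g v k"
        using eq[OF level_le] eq[of k] by simp
    qed
  qed
qed

end

section \<open>Covers by approximate squares of large mass\<close>

lemma (in prob_space) card_disjoint_heavy_sets:
  assumes sub: "\<Q> \<subseteq> events" and disj: "disjoint \<Q>" and heavy: "\<And>Q. Q \<in> \<Q> \<Longrightarrow> c \<le> prob Q" and "0 < c"
  shows "finite \<Q>" "real (card \<Q>) \<le> 1 / c"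
proof -
  have bd: "real (card \<F>) \<le> 1 / c" if \<F>: "\<F> \<subseteq> \<Q>" "finite \<F>" for \<F>
  proof -
    have "real (card \<F>) * c = (\<Sum>Q\<in>\<F>. c)" by simp
    also have "\<dots> \<le> (\<Sum>Q\<in>\<F>. prob Q)" using \<F> heavy by (intro sum_mono) auto
    also have "\<dots> = prob (\<Union>Q\<in>\<F>. Q)"
    proof (rule finite_measure_finite_Union[symmetric])
      show "disjoint_family_on (\<lambda>Q. Q) \<F>"
        using \<F>(1) disj unfolding disjoint_family_on_def disjoint_def by blast
    qed (use \<F> sub in auto)
    also have "\<dots> \<le> 1" by (rule prob_le_1)
    finally show ?thesis using \<open>0 < c\<close> by (simp add: field_simps)
  qed
  have "finite \<Q> \<and> card \<Q> \<le> nat \<lfloor>1 / c\<rfloor>"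
    by (rule finite_if_finite_subsets_card_bdd) (use bd in \<open>simp add: le_nat_floor\<close>)
  then show "finite \<Q>" ..
  then show "real (card \<Q>) \<le> 1 / c" by (intro bd) auto
qed

lemma ln_ball_ratio:
  assumes "has_local_dim \<nu> x \<alpha>" "0 < c"
  shows "(\<lambda>k. ln (measure \<nu> (ball x (exp (- real k * c)))) / real k) \<longlonglongrightarrow> - (c * \<alpha>)"
proof -
  have "LIM k sequentially. - real k * c :> at_bot"
    using filterlim_tendsto_pos_mult_at_top[OF tendsto_const[of c] \<open>0 < c\<close> filterlim_real_sequentially]
    by (simp add: filterlim_uminus_at_bot mult.commute)
  then have "(\<lambda>k. exp (- real k * c)) \<longlonglongrightarrow> 0" by (rule filterlim_compose[OF exp_at_bot])
  then have "filterlim (\<lambda>k. exp (- real k * c)) (at_right 0) sequentially"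
    by (simp add: filterlim_at)
  from filterlim_compose[OF _ this, of _ "nhds \<alpha>"] assms(1)
  have "(\<lambda>k. ln (measure \<nu> (ball x (exp (- real k * c)))) / ln (exp (- real k * c))) \<longlonglongrightarrow> \<alpha>"
    unfolding has_local_dim_def by blast
  from tendsto_mult[OF this tendsto_const[of "- c"]]
  have "(\<lambda>k. ln (measure \<nu> (ball x (exp (- real k * c)))) / (- real k * c) * (- c)) \<longlonglongrightarrow> - (c * \<alpha>)"
    by (simp add: mult.commute)
  moreover have "\<forall>\<^sub>F k in sequentially. ln (measure \<nu> (ball x (exp (- real k * c)))) / (- real k * c) * (- c)
      = ln (measure \<nu> (ball x (exp (- real k * c)))) / real k"
    using eventually_gt_at_top[of 0] by eventually_elim (use \<open>0 < c\<close> in simp)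
  ultimately show ?thesis by (rule Lim_transform_eventually)
qed

context moran
begin

text \<open>At order \<open>k\<close> there are at most \<open>e\<^bsup>k\<sigma>\<^esup>\<close> squares of mass at least \<open>e\<^bsup>-k\<sigma>\<^esup>\<close>, and neighbourhoods of
  them of diameter comparable to \<open>e\<^bsup>-ka\<^esup>\<close> cover the points in question.\<close>

lemma hausdorff_measure_eq_0_if_heavy_squares:
  assumes P: "positive_weights pat P" and s: "0 < s" and a: "0 < a" "a < mean_log_m" and "\<sigma> < s * a"
    and heavy: "\<And>x. x \<in> X \<Longrightarrow> \<exists>\<^sub>F k in sequentially. \<exists>v\<in>moran_code pat.
      exp (- real k * \<sigma>) \<le> measure (moran_code_measure pat P) (approx_square v (level k) k) \<and>
      dist x (moran_proj pat v) < exp (- real k * a)"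
  shows "hausdorff_measure s X = 0"
proof -
  let ?M = "moran_code_measure pat P"
  interpret prob_space ?M using P by (rule prob_space_code)
  define \<rho> where "\<rho> k = exp (- real k * a)" for k
  have "\<forall>\<^sub>F k in sequentially. \<forall>v\<in>moran_code pat. \<forall>u\<in>approx_square v (level k) k.
      dist (moran_proj pat u) (moran_proj pat v) < \<rho> k"
    using eventually_approx_square_small[of "mean_log_m - a"] a by (simp add: \<rho>_def)
  then obtain k0 where small: "\<And>k v u. k0 \<le> k \<Longrightarrow> v \<in> moran_code pat \<Longrightarrow> u \<in> approx_square v (level k) k \<Longrightarrow>
      dist (moran_proj pat u) (moran_proj pat v) < \<rho> k" by (auto simp: eventually_sequentially)
  define \<Q> where "\<Q> k = {approx_square v (level k) k | v.
      v \<in> moran_code pat \<and> exp (- real k * \<sigma>) \<le> prob (approx_square v (level k) k)}" for k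
  define nbhd where "nbhd k Q = {x. \<exists>v\<in>Q. dist x (moran_proj pat v) < \<rho> k}" for k Q
  have \<Q>: "finite (\<Q> k)" "real (card (\<Q> k)) \<le> 1 / exp (- real k * \<sigma>)" for k
  proof -
    have "\<Q> k \<subseteq> events" using sets_approx_square[OF P _ level_le] by (auto simp: \<Q>_def)
    moreover have "disjoint (\<Q> k)"
      unfolding disjoint_def \<Q>_def using approx_square_eq by blast
    moreover have "exp (- real k * \<sigma>) \<le> prob Q" if "Q \<in> \<Q> k" for Q using that by (auto simp: \<Q>_def)
    ultimately show "finite (\<Q> k)" "real (card (\<Q> k)) \<le> 1 / exp (- real k * \<sigma>)"
      using card_disjoint_heavy_sets[of "\<Q> k" "exp (- real k * \<sigma>)"] by auto
  qed
  define \<U> where "\<U> k = (if k0 \<le> k then nbhd k ` \<Q> k else {})" for k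
  have close: "dist x y \<le> 4 * \<rho> k" if U: "U \<in> \<U> k" "x \<in> U" "y \<in> U" for k U x y
  proof -
    from U obtain v where v: "k0 \<le> k" "v \<in> moran_code pat" "U = nbhd k (approx_square v (level k) k)"
      by (auto simp: \<U>_def \<Q>_def split: if_splits)
    from v U obtain u u' where u: "u \<in> approx_square v (level k) k" "dist x (moran_proj pat u) < \<rho> k"
      "u' \<in> approx_square v (level k) k" "dist y (moran_proj pat u') < \<rho> k"
      by (auto simp: nbhd_def)
    have "dist x y \<le> dist x (moran_proj pat u) + dist (moran_proj pat u) y"
      "dist (moran_proj pat u) y \<le> dist (moran_proj pat u) (moran_proj pat v) + dist (moran_proj pat v) y"
      "dist (moran_proj pat v) y \<le> dist (moran_proj pat u') (moran_proj pat v) + dist y (moran_proj pat u')"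
      using dist_triangle[of x y "moran_proj pat u"]
        dist_triangle[of "moran_proj pat u" y "moran_proj pat v"]
        dist_triangle[of "moran_proj pat v" y "moran_proj pat u'"]
      by (simp_all add: dist_commute)
    with small[OF v(1,2) u(1)] small[OF v(1,2) u(3)] u(2,4) show ?thesis by linarith
  qed
  have \<rho>_pos: "0 < \<rho> k" for k by (simp add: \<rho>_def)
  show ?thesis
  proof (rule hausdorff_measure_eq_0_if_limsup_cover[OF s, of \<U> "\<lambda>k. 4 * \<rho> k"])
    show "finite (\<U> k)" for k using \<Q> by (simp add: \<U>_def)
    show "bounded U \<and> diameter U \<le> 4 * \<rho> k" if "U \<in> \<U> k" for k U
    proof
      show "bounded U" unfolding bounded_two_points using close[OF that] by blast
      show "diameter U \<le> 4 * \<rho> k" using close[OF that] \<rho>_pos[of k] by (intro diameter_le) (auto simp: dist_norm)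
    qed
    have "LIM k sequentially. - real k * a :> at_bot"
      using filterlim_tendsto_pos_mult_at_top[OF tendsto_const[of a] a(1) filterlim_real_sequentially]
      by (simp add: filterlim_uminus_at_bot mult.commute)
    then have "\<rho> \<longlonglongrightarrow> 0" unfolding \<rho>_def by (rule filterlim_compose[OF exp_at_bot])
    from tendsto_mult[OF tendsto_const[of 4] this] show "(\<lambda>k. 4 * \<rho> k) \<longlonglongrightarrow> 0" by simp
    show "summable (\<lambda>k. real (card (\<U> k)) * (4 * \<rho> k) powr s)"
    proof (rule summable_comparison_test')
      show "summable (\<lambda>k. 4 powr s * exp (\<sigma> - s * a) ^ k)"
        using \<open>\<sigma> < s * a\<close> by (intro summable_mult summable_geometric) simp
      fix k
      have "card (\<U> k) \<le> card (\<Q> k)" using \<Q>(1) by (simp add: \<U>_def card_image_le)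
      then have card: "real (card (\<U> k)) \<le> exp (real k * \<sigma>)"
        using \<Q>(2)[of k] by (simp add: exp_minus inverse_eq_divide)
      have "(4 * \<rho> k) powr s = 4 powr s * exp (- real k * a * s)"
        unfolding \<rho>_def by (subst powr_mult) (simp_all add: powr_def mult_ac)
      then have "real (card (\<U> k)) * (4 * \<rho> k) powr s \<le> exp (real k * \<sigma>) * (4 powr s * exp (- real k * a * s))"
        using card by (simp add: mult_right_mono)
      also have "\<dots> = 4 powr s * exp (\<sigma> - s * a) ^ k"
        by (simp add: exp_of_nat_mult[symmetric] exp_add[symmetric] algebra_simps)
      finally show "norm (real (card (\<U> k)) * (4 * \<rho> k) powr s) \<le> 4 powr s * exp (\<sigma> - s * a) ^ k" by simp
    qed
    fix x assume "x \<in> X"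
    from frequently_eventually_conj[OF heavy[OF this] eventually_ge_at_top[of k0]]
    show "\<exists>\<^sub>F k in sequentially. x \<in> \<Union>(\<U> k)"
    proof (rule frequently_elim1)
      fix k assume "k0 \<le> k \<and> (\<exists>v\<in>moran_code pat.
        exp (- real k * \<sigma>) \<le> prob (approx_square v (level k) k) \<and>
        dist x (moran_proj pat v) < exp (- real k * a))"
      then obtain v where v: "k0 \<le> k" "v \<in> moran_code pat" "approx_square v (level k) k \<in> \<Q> k"
        "dist x (moran_proj pat v) < \<rho> k" by (auto simp: \<Q>_def \<rho>_def)
      then have "nbhd k (approx_square v (level k) k) \<in> \<U> k" by (auto simp: \<U>_def)
      moreover have "x \<in> nbhd k (approx_square v (level k) k)"
        using v approx_square_self[OF v(2)] by (auto simp: nbhd_def)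
      ultimately show "x \<in> \<Union>(\<U> k)" by blast
    qed
  qed
qed

text \<open>A ball of small radius meets at most nine approximate squares, numbered by the offsets of their
  row and column numbers, so one of them carries at least a ninth of its mass.\<close>

lemma exists_heavy_square:
  assumes P: "positive_weights pat P" and w: "w \<in> moran_code pat"
    and r: "0 < r" "r \<le> 1 / n_prod (level k)" "r \<le> 1 / m_prod k"
  obtains v where "v \<in> moran_code pat" "dist (moran_proj pat w) (moran_proj pat v) < r"
    "measure (moran_measure pat P) (ball (moran_proj pat w) r) \<le>
       9 * measure (moran_code_measure pat P) (approx_square v (level k) k)"
proof (rule ccontr)
  assume none: "\<not> thesis"
  note obtained = that
  let ?M = "moran_code_measure pat P"
  interpret prob_space ?M using P by (rule prob_space_code)
  let ?B = "{v \<in> moran_code pat. dist (moran_proj pat w) (moran_proj pat v) < r}"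
  let ?Q = "\<lambda>v. approx_square v (level k) k"
  let ?off = "\<lambda>v. (col_num v (level k) - col_num w (level k), row_num v k - row_num w k)"
  have light: "9 * prob (?Q v) < prob ?B" if "v \<in> ?B" for v
    using none obtained[of v] that by (force simp: measure_moran_ball)
  let ?C = "?off ` ?B"
  have C: "?C \<subseteq> {- 1..1} \<times> {- 1..1}"
  proof
    fix c assume "c \<in> ?C"
    then obtain v where v: "v \<in> moran_code pat" "dist (moran_proj pat v) (moran_proj pat w) < r" "c = ?off v"
      by (auto simp: dist_commute)
    have "\<bar>col_num v (level k) - col_num w (level k)\<bar> \<le> 1" "\<bar>row_num v k - row_num w k\<bar> \<le> 1"
      using v r by (auto intro!: col_num_adjacent row_num_adjacent w)
    then show "c \<in> {- 1..1} \<times> {- 1..1}" using v(3) by (simp add: abs_le_iff)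
  qed
  have fin: "finite ?C" by (rule finite_subset[OF C]) simp
  have card: "card ?C \<le> 9"
    using card_mono[OF _ C] by (simp add: card_cartesian_product)
  have "w \<in> ?B" using w r by simp
  then have ne: "?C \<noteq> {}" by blast
  have "\<forall>c\<in>?C. \<exists>v. v \<in> ?B \<and> ?off v = c" by blast
  from bchoice[OF this] obtain rep where rep: "\<And>c. c \<in> ?C \<Longrightarrow> rep c \<in> ?B \<and> ?off (rep c) = c" by blast
  have "?B \<subseteq> (\<Union>c\<in>?C. ?Q (rep c))"
  proof
    fix u assume u: "u \<in> ?B"
    have c: "?off u \<in> ?C" using u by blast
    let ?v = "rep (?off u)"
    have v: "?v \<in> moran_code pat" "col_num u (level k) = col_num ?v (level k)" "row_num u k = row_num ?v k"
      using rep[OF c] by auto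
    have u': "u \<in> moran_code pat" using u by simp
    have "fst (u l) = fst (?v l)" if "l < level k" for l
      using hor.digit_num_inject[OF code_digit_less(1)[OF u'] code_digit_less(1)[OF v(1)] v(2) that] .
    moreover have "snd (u l) = snd (?v l)" if "l < k" for l
      using vert.digit_num_inject[OF code_digit_less(2)[OF u'] code_digit_less(2)[OF v(1)] v(3) that] .
    ultimately have "u \<in> ?Q ?v"
      using u' level_le[of k] by (auto simp: approx_square_def intro!: prod_eqI)
    then show "u \<in> (\<Union>c\<in>?C. ?Q (rep c))" using c by blast
  qed
  moreover have sets: "?Q (rep c) \<in> sets ?M" if "c \<in> ?C" for c
    using rep[OF that] by (intro sets_approx_square P level_le) auto
  ultimately have "prob ?B \<le> prob (\<Union>c\<in>?C. ?Q (rep c))"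
    using fin by (intro finite_measure_mono sets.finite_UN) auto
  also have "\<dots> \<le> (\<Sum>c\<in>?C. prob (?Q (rep c)))"
    using fin sets by (intro finite_measure_subadditive_finite) auto
  also have "\<dots> < (\<Sum>c\<in>?C. prob ?B / 9)"
    using fin ne light rep by (intro sum_strict_mono) (auto simp: field_simps)
  also have "\<dots> = real (card ?C) / 9 * prob ?B" by simp
  also have "\<dots> \<le> 1 * prob ?B" using card by (intro mult_right_mono) auto
  finally show False by simp
qed

end

context weighted_moran
begin

lemma ln_measure_tilted_square:
  assumes v: "v \<in> moran_code pat" and "l \<le> k"
  shows "ln (measure (moran_code_measure pat (tilted t)) (approx_square v l k)) =
    t * ln (measure (moran_code_measure pat p) (approx_square v l k)) +
    (digit_sum pat (ln_ratio t) v l - zeta * digit_sum pat (ln_ratio t) v k) -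
    (\<Sum>i<k. ln (partition_sum (pat i) t))"
proof -
  have v_in: "v i \<in> pat_D (pat i)" for i using v by (simp add: moran_code_iff)
  have 1: "digit_sum pat (log_prob (tilted t)) v j = t * digit_sum pat lp v j +
      (1 - zeta) * digit_sum pat (ln_ratio t) v j - (\<Sum>i<j. ln (partition_sum (pat i) t))" for j
    by (simp add: digit_sum_def log_prob_tilted sum.distrib sum_subtractf sum_distrib_left)
  have 2: "digit_sum pat (log_row_prob (tilted t)) v j = t * digit_sum pat lq v j -
      zeta * digit_sum pat (ln_ratio t) v j - (\<Sum>i<j. ln (partition_sum (pat i) t))" for j
    by (simp add: digit_sum_def log_row_prob_tilted[OF v_in] sum_subtractf sum_distrib_left)
  show ?thesis
    unfolding ln_measure_approx_square[OF p v \<open>l \<le> k\<close>]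
      ln_measure_approx_square[OF positive_weights_tilted v \<open>l \<le> k\<close>] 1 2
    by (simp add: algebra_simps)
qed

text \<open>For \<open>t \<le> 0\<close> the mass of the square around the point itself has to be bounded above, for
  \<open>t \<ge> 0\<close> the mass of some nearby square has to be bounded below.\<close>

lemma eventually_near_square_mass:
  assumes w: "w \<in> moran_code pat" and dim: "has_local_dim (moran_measure pat p) (moran_proj pat w) \<alpha>"
    and \<epsilon>: "0 < \<epsilon>"
  shows "\<forall>\<^sub>F k in sequentially. \<exists>v\<in>moran_code pat. \<bar>row_num v (k + 2) - row_num w (k + 2)\<bar> \<le> 1 \<and>
     dist (moran_proj pat w) (moran_proj pat v) < exp (- real k * (mean_log_m - \<epsilon>)) \<and>
     - real k * (t * \<alpha> * mean_log_m + \<epsilon>) \<le>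
       t * ln (measure (moran_code_measure pat p) (approx_square v (level k) k))"
proof -
  let ?M = "moran_code_measure pat p" and ?x = "moran_proj pat w"
  interpret prob_space ?M using p by (rule prob_space_code)
  have "((\<lambda>\<delta>. \<bar>t * \<alpha>\<bar> * \<delta>) \<longlongrightarrow> \<bar>t * \<alpha>\<bar> * 0) (at_right 0)" by (intro tendsto_intros)
  then have "\<forall>\<^sub>F \<delta> in at_right 0. \<bar>t * \<alpha>\<bar> * \<delta> < \<epsilon>" using \<epsilon> by (intro order_tendstoD(2)) auto
  moreover have "\<forall>\<^sub>F \<delta> in at_right 0. 0 < \<delta> \<and> \<delta> < mean_log_m"
    using mean_log_pos by (auto simp: eventually_at_right_field)
  ultimately have "\<forall>\<^sub>F \<delta> in at_right 0. \<bar>t * \<alpha>\<bar> * \<delta> < \<epsilon> \<and> 0 < \<delta> \<and> \<delta> < mean_log_m"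
    by eventually_elim simp
  then obtain \<delta> where \<delta>: "\<bar>t * \<alpha>\<bar> * \<delta> < \<epsilon>" "0 < \<delta>" "\<delta> < mean_log_m"
    using eventually_happens'[of "at_right (0::real)"] by force
  have t\<alpha>: "\<bar>t * \<alpha> * \<delta>\<bar> < \<epsilon>" using \<delta> by (simp add: abs_mult)
  have ball_pos: "0 < measure (moran_measure pat p) (ball ?x r)" if "0 < r" for r
    using dim that by (simp add: has_local_dim_def)
  show ?thesis
  proof (cases "t \<le> 0")
    case True
    let ?b = "\<lambda>k. measure (moran_measure pat p) (ball ?x (exp (- real k * (mean_log_m - \<delta>))))"
    have "(\<lambda>k. t * (ln (?b k) / real k)) \<longlonglongrightarrow> t * - ((mean_log_m - \<delta>) * \<alpha>)"
      using \<delta> by (intro tendsto_mult tendsto_const ln_ball_ratio dim) auto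
    then have lim: "(\<lambda>k. t * ln (?b k) / real k) \<longlonglongrightarrow> t * - ((mean_log_m - \<delta>) * \<alpha>)" by simp
    have "\<forall>\<^sub>F k in sequentially. real k * - (t * \<alpha> * mean_log_m + \<epsilon>) < t * ln (?b k)"
      by (rule eventually_less_if_ratio_less[OF linear_ratio lim])
        (use t\<alpha> in \<open>simp add: algebra_simps abs_less_iff\<close>)
    with eventually_approx_square_small[OF \<delta>(2)]
    show ?thesis
    proof eventually_elim
      case (elim k)
      have "prob (approx_square w (level k) k) \<le> ?b k"
        unfolding measure_moran_ball
      proof (intro finite_measure_mono sets_code_ball subsetI CollectI conjI)
        fix u assume u: "u \<in> approx_square w (level k) k"
        then show "u \<in> moran_code pat" by (simp add: approx_square_def)
        show "dist ?x (moran_proj pat u) < exp (- real k * (mean_log_m - \<delta>))"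
          using elim(1) w u by (auto simp: dist_commute)
      qed
      then have "ln (prob (approx_square w (level k) k)) \<le> ln (?b k)"
        using measure_approx_square_pos[OF p w level_le] by (intro ln_mono) auto
      then have "t * ln (?b k) \<le> t * ln (prob (approx_square w (level k) k))"
        using True by (rule mult_left_mono_neg)
      moreover from elim(2) have "- real k * (t * \<alpha> * mean_log_m + \<epsilon>) < t * ln (?b k)"
        by (simp only: mult_minus_left mult_minus_right)
      ultimately have "- real k * (t * \<alpha> * mean_log_m + \<epsilon>) \<le> t * ln (prob (approx_square w (level k) k))"
        by linarith
      then show ?case by (intro bexI[OF _ w]) auto
    qed
  next
    case False
    let ?b = "\<lambda>k. measure (moran_measure pat p) (ball ?x (exp (- real k * (mean_log_m + \<delta>))))"
    have "(\<lambda>k. t * (ln (?b k) / real k) - t * ln 9 / real k) \<longlonglongrightarrow> t * - ((mean_log_m + \<delta>) * \<alpha>) - 0"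
      using \<delta> mean_log_pos
      by (intro tendsto_diff tendsto_mult tendsto_const ln_ball_ratio dim lim_const_over_n) auto
    then have lim: "(\<lambda>k. (t * ln (?b k) - t * ln 9) / real k) \<longlonglongrightarrow> t * - ((mean_log_m + \<delta>) * \<alpha>)"
      by (simp add: diff_divide_distrib)
    have "\<forall>\<^sub>F k in sequentially. real k * - (t * \<alpha> * mean_log_m + \<epsilon>) < t * ln (?b k) - t * ln 9"
      by (rule eventually_less_if_ratio_less[OF linear_ratio lim])
        (use t\<alpha> in \<open>simp add: algebra_simps abs_less_iff\<close>)
    with eventually_radius_small[OF \<delta>(2)]
    show ?thesis
    proof eventually_elim
      case (elim k)
      let ?r = "exp (- real k * (mean_log_m + \<delta>))"
      have "1 / m_prod (k + 2) \<le> 1 / m_prod k"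
        by (intro divide_left_mono vert.base_prod_mono mult_pos_pos vert.base_prod_pos) auto
      then have r: "?r \<le> 1 / n_prod (level k)" "?r \<le> 1 / m_prod k" using elim(1) by auto
      obtain v where v: "v \<in> moran_code pat" "dist ?x (moran_proj pat v) < ?r"
        "?b k \<le> 9 * prob (approx_square v (level k) k)"
        using exists_heavy_square[OF p w _ r] by auto
      have "\<bar>row_num v (k + 2) - row_num w (k + 2)\<bar> \<le> 1"
        using v elim(1) by (intro row_num_adjacent w) (auto simp: dist_commute)
      moreover have "dist ?x (moran_proj pat v) < exp (- real k * (mean_log_m - \<epsilon>))"
      proof (rule less_le_trans[OF v(2)])
        show "?r \<le> exp (- real k * (mean_log_m - \<epsilon>))" using \<delta> \<epsilon> by (simp add: mult_left_mono)
      qed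
      moreover have "ln (?b k) \<le> ln (9 * prob (approx_square v (level k) k))"
        using v(3) by (intro ln_mono ball_pos) simp_all
      then have "ln (?b k) - ln 9 \<le> ln (prob (approx_square v (level k) k))"
        using measure_approx_square_pos[OF p v(1) level_le] by (simp add: ln_mult_pos)
      then have "t * (ln (?b k) - ln 9) \<le> t * ln (prob (approx_square v (level k) k))"
        using False by (intro mult_left_mono) auto
      then have "- real k * (t * \<alpha> * mean_log_m + \<epsilon>) \<le> t * ln (prob (approx_square v (level k) k))"
        using elim(2) by (simp add: algebra_simps)
      ultimately show ?case by (intro bexI[OF _ v(1)] conjI)
    qed
  qed
qed

end

section \<open>The multifractal spectrum\<close>

lemma local_dim_nonneg:
  assumes "prob_space \<nu>" "has_local_dim \<nu> x \<alpha>"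
  shows "0 \<le> \<alpha>"
proof -
  interpret prob_space \<nu> by fact
  have "\<forall>\<^sub>F r in at_right 0. 0 < r \<and> r < (1::real)"
    by (auto simp: eventually_at_right_field intro: exI[of _ 1])
  then have "\<forall>\<^sub>F r in at_right 0. 0 \<le> ln (measure \<nu> (ball x r)) / ln r"
  proof eventually_elim
    case (elim r)
    have "ln (measure \<nu> (ball x r)) \<le> 0"
      using assms(2) elim prob_le_1 by (auto simp: has_local_dim_def ln_le_zero_iff)
    then show ?case using elim by (intro divide_nonpos_neg) auto
  qed
  then show ?thesis using assms(2)
    by (intro tendsto_lowerbound[of "\<lambda>r. ln (measure \<nu> (ball x r)) / ln r"]) (auto simp: has_local_dim_def)
qed

lemma row_prob_row_family: "row_prob P \<gamma> j = sum_mset (row_family P \<gamma> j)"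
  by (simp add: row_prob_def row_family_def sum_unfold_sum_mset)

context weighted_moran
begin

lemma ln_ratio_row_family:
  "ln_ratio t \<gamma> w = t * ln (sum_mset (row_family p \<gamma> (snd w))) -
     ln (\<Sum>x\<in>#row_family p \<gamma> (snd w). exp (t * ln x))"
  by (simp add: ln_ratio_def log_row_prob_def row_prob_row_family row_power_sum_def log_prob_def
      row_family_def sum_unfold_sum_mset image_mset.compositionality comp_def)

text \<open>The estimate of \<open>t log \<mu>(Q)\<close> is available at all large orders, that of the row ratios at infinitely
  many, for all nearby codes at once; hence both hold together for the code found by the former.\<close>

lemma frequently_heavy_tilted_square:
  assumes bottom: "\<And>k k'. row_family p (pat k) 0 = row_family p (pat k') 0"
    and top: "\<And>k k'. row_family p (pat k) (pat_m (pat k) - 1) = row_family p (pat k') (pat_m (pat k') - 1)"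
    and dim: "has_local_dim (moran_measure pat p) x \<alpha>" and \<epsilon>: "0 < \<epsilon>"
  shows "\<exists>\<^sub>F k in sequentially. \<exists>v\<in>moran_code pat.
    exp (- real k * ((\<alpha> * t + moran_beta (range pat) f p t) * mean_log_m + \<epsilon>)) \<le>
      measure (moran_code_measure pat (tilted t)) (approx_square v (level k) k) \<and>
    dist x (moran_proj pat v) < exp (- real k * (mean_log_m - \<epsilon>))"
proof -
  obtain w where w: "w \<in> moran_code pat" and x: "x = moran_proj pat w"
    using has_local_dim_imp_in_moran_set[OF dim] by blast
  let ?S = "digit_sum pat (ln_ratio t)" and ?\<epsilon> = "\<epsilon> / 3"
  let ?B = "moran_beta (range pat) f p t * mean_log_m"
  have \<epsilon>3: "0 < ?\<epsilon>" using \<epsilon> by simp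
  have "\<exists>\<^sub>F k in sequentially. \<forall>v\<in>moran_code pat. \<bar>row_num v (k + 2) - row_num w (k + 2)\<bar> \<le> 1 \<longrightarrow>
      - ?\<epsilon> * real k \<le> ?S v (level k) - zeta * ?S v k"
  proof (rule frequently_row_sum_ge[OF w \<epsilon>3])
    show "ln_ratio t (pat k) v = ln_ratio t (pat k) v'" if "snd v = snd v'" for k v v'
      using that by (simp add: ln_ratio_def log_row_prob_def)
    show "ln_ratio t (pat k) v = ln_ratio t (pat 0) (0, 0)" if "snd v = 0" for k v
      using that bottom[of k 0] by (simp add: ln_ratio_row_family)
    show "ln_ratio t (pat k) v = ln_ratio t (pat 0) (0, pat_m (pat 0) - 1)"
      if "snd v = pat_m (pat k) - 1" for k v
      using that top[of k 0] by (simp add: ln_ratio_row_family)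
  qed
  note fr = this
  have "\<forall>\<^sub>F k in sequentially. (\<Sum>i<k. ln (partition_sum (pat i) t)) < real k * (?B + ?\<epsilon>)"
  proof (rule eventually_less_if_ratio_less[OF _ linear_ratio])
    show "(\<lambda>k. (\<Sum>i<k. ln (partition_sum (pat i) t)) / real k) \<longlonglongrightarrow> ?B"
      using cesaro_tendsto_freq_avg[of "\<lambda>\<gamma>. ln (partition_sum \<gamma> t)"] mean_log_pos
      by (simp add: moran_beta_eq)
  qed (use \<epsilon> in simp)
  then have "\<forall>\<^sub>F k in sequentially. (\<Sum>i<k. ln (partition_sum (pat i) t)) < real k * (?B + ?\<epsilon>) \<and>
      (\<exists>v\<in>moran_code pat. \<bar>row_num v (k + 2) - row_num w (k + 2)\<bar> \<le> 1 \<and>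
       dist (moran_proj pat w) (moran_proj pat v) < exp (- real k * (mean_log_m - ?\<epsilon>)) \<and>
       - real k * (t * \<alpha> * mean_log_m + ?\<epsilon>) \<le>
         t * ln (measure (moran_code_measure pat p) (approx_square v (level k) k)))"
    by (intro eventually_conj eventually_near_square_mass[OF w dim[unfolded x] \<epsilon>3])
  from frequently_eventually_conj[OF fr this] show ?thesis
  proof (rule frequently_elim1)
    fix k
    assume k: "((\<Sum>i<k. ln (partition_sum (pat i) t)) < real k * (?B + ?\<epsilon>) \<and>
      (\<exists>v\<in>moran_code pat. \<bar>row_num v (k + 2) - row_num w (k + 2)\<bar> \<le> 1 \<and>
       dist (moran_proj pat w) (moran_proj pat v) < exp (- real k * (mean_log_m - ?\<epsilon>)) \<and>
       - real k * (t * \<alpha> * mean_log_m + ?\<epsilon>) \<le>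
         t * ln (measure (moran_code_measure pat p) (approx_square v (level k) k)))) \<and>
      (\<forall>v\<in>moran_code pat. \<bar>row_num v (k + 2) - row_num w (k + 2)\<bar> \<le> 1 \<longrightarrow>
        - ?\<epsilon> * real k \<le> ?S v (level k) - zeta * ?S v k)"
    from k obtain v where v: "v \<in> moran_code pat" "\<bar>row_num v (k + 2) - row_num w (k + 2)\<bar> \<le> 1"
      "dist x (moran_proj pat v) < exp (- real k * (mean_log_m - ?\<epsilon>))"
      "- real k * (t * \<alpha> * mean_log_m + ?\<epsilon>) \<le>
        t * ln (measure (moran_code_measure pat p) (approx_square v (level k) k))"
      unfolding x by blast
    have S: "- ?\<epsilon> * real k \<le> ?S v (level k) - zeta * ?S v k" using k v(1,2) by blast
    have Z: "(\<Sum>i<k. ln (partition_sum (pat i) t)) < real k * (?B + ?\<epsilon>)" using k by blast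
    let ?\<nu> = "measure (moran_code_measure pat (tilted t)) (approx_square v (level k) k)"
    have "- real k * ((\<alpha> * t + moran_beta (range pat) f p t) * mean_log_m + \<epsilon>) =
        - real k * (t * \<alpha> * mean_log_m + ?\<epsilon>) + (- ?\<epsilon> * real k) - real k * (?B + ?\<epsilon>)"
      by (simp add: algebra_simps)
    also have "\<dots> \<le> ln ?\<nu>"
      unfolding ln_measure_tilted_square[OF v(1) level_le] using v(4) S Z by linarith
    finally have "exp (- real k * ((\<alpha> * t + moran_beta (range pat) f p t) * mean_log_m + \<epsilon>)) \<le> ?\<nu>"
      using measure_approx_square_pos[OF positive_weights_tilted v(1) level_le]
      by (metis exp_le_cancel_iff exp_ln)
    moreover have "dist x (moran_proj pat v) < exp (- real k * (mean_log_m - \<epsilon>))"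
    proof (rule less_le_trans[OF v(3)])
      show "exp (- real k * (mean_log_m - ?\<epsilon>)) \<le> exp (- real k * (mean_log_m - \<epsilon>))"
        using \<epsilon> by (simp add: mult_left_mono)
    qed
    ultimately show "\<exists>v\<in>moran_code pat.
      exp (- real k * ((\<alpha> * t + moran_beta (range pat) f p t) * mean_log_m + \<epsilon>)) \<le>
        measure (moran_code_measure pat (tilted t)) (approx_square v (level k) k) \<and>
      dist x (moran_proj pat v) < exp (- real k * (mean_log_m - \<epsilon>))" using v(1) by blast
  qed
qed

lemma hausdorff_dim_level_le:
  assumes bottom: "\<And>k k'. row_family p (pat k) 0 = row_family p (pat k') 0"
    and top: "\<And>k k'. row_family p (pat k) (pat_m (pat k) - 1) = row_family p (pat k') (pat_m (pat k') - 1)"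
    and D: "0 \<le> \<alpha> * t + moran_beta (range pat) f p t"
  shows "hausdorff_dim (local_dim_level (moran_measure pat p) \<alpha>) \<le>
    ereal (\<alpha> * t + moran_beta (range pat) f p t)"
proof (rule hausdorff_dim_leI[OF D])
  let ?D = "\<alpha> * t + moran_beta (range pat) f p t"
  fix s assume s: "?D < s"
  \<comment> \<open>The strict inequality \<open>gap\<close> below needs \<open>\<epsilon> (s + 1) < mean_log_m * (s - ?D)\<close>.\<close>
  define \<epsilon> where "\<epsilon> = mean_log_m * (s - ?D) / (s + 2)"
  have "(s - ?D) / (s + 2) < 1" using s D by simp
  then have "mean_log_m * ((s - ?D) / (s + 2)) < mean_log_m * 1"
    using mean_log_pos by (intro mult_strict_left_mono)
  then have \<epsilon>: "0 < \<epsilon>" "\<epsilon> < mean_log_m"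
    using s D mean_log_pos by (auto simp: \<epsilon>_def)
  have "\<epsilon> * (s + 2) = mean_log_m * (s - ?D)" using s D by (simp add: \<epsilon>_def)
  then have gap: "?D * mean_log_m + \<epsilon> < s * (mean_log_m - \<epsilon>)"
    using \<epsilon> by (simp add: algebra_simps)
  show "hausdorff_measure s (local_dim_level (moran_measure pat p) \<alpha>) = 0"
  proof (rule hausdorff_measure_eq_0_if_heavy_squares[OF positive_weights_tilted _ _ _ gap])
    show "0 < s" "0 < mean_log_m - \<epsilon>" "mean_log_m - \<epsilon> < mean_log_m" using s D \<epsilon> by auto
    fix x assume "x \<in> local_dim_level (moran_measure pat p) \<alpha>"
    then have "has_local_dim (moran_measure pat p) x \<alpha>" by (simp add: local_dim_level_def)
    from frequently_heavy_tilted_square[OF bottom top this \<epsilon>(1)]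
    show "\<exists>\<^sub>F k in sequentially. \<exists>v\<in>moran_code pat.
      exp (- real k * (?D * mean_log_m + \<epsilon>)) \<le>
        measure (moran_code_measure pat (tilted t)) (approx_square v (level k) k) \<and>
      dist x (moran_proj pat v) < exp (- real k * (mean_log_m - \<epsilon>))" .
  qed
qed

text \<open>Almost every code for the tilted weights is typical for both measures at once. The mean energy
  gives the local dimension of \<open>\<mu>\<close>; in the local dimension of the tilted measure the contributions of
  the row ratios cancel, as \<open>\<zeta> (1 - \<zeta>) - (1 - \<zeta>) \<zeta> = 0\<close>.\<close>

lemma AE_tilted_local_dim:
  assumes energy: "freq_avg (digit_mean (tilted t) (digit_energy zeta p)) = \<alpha> * mean_log_m"
  shows "AE w in moran_code_measure pat (tilted t).
    has_local_dim (moran_measure pat p) (moran_proj pat w) \<alpha> \<and>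
    has_local_dim (moran_measure pat (tilted t)) (moran_proj pat w)
      (\<alpha> * t + moran_beta (range pat) f p t)"
proof -
  let ?avg = "\<lambda>g. freq_avg (digit_mean (tilted t) g)"
  note T = positive_weights_tilted[of t]
  have mean_const: "(\<Sum>w\<in>pat_D (pat k). tilted t (pat k) w * c) = c" for k c
    using T by (simp add: positive_weights_def flip: sum_distrib_right)
  have e: "?avg (digit_energy zeta p) = - (zeta * ?avg lp + (1 - zeta) * ?avg lq)"
  proof -
    have "?avg (digit_energy zeta p) =
        freq_avg (\<lambda>\<gamma>. - (zeta * digit_mean (tilted t) lp \<gamma> + (1 - zeta) * digit_mean (tilted t) lq \<gamma>))"
      by (intro freq_avg_cong) (simp add: digit_mean_def digit_energy_def log_prob_def log_row_prob_def
          sum_distrib_left sum_subtractf sum.distrib sum_negf algebra_simps)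
    then show ?thesis by (simp only: freq_avg_linear)
  qed
  let ?Z = "freq_avg (\<lambda>\<gamma>. ln (partition_sum \<gamma> t))" and ?U = "?avg (ln_ratio t)"
  have a: "?avg (log_prob (tilted t)) = t * ?avg lp + (1 - zeta) * ?U - ?Z"
  proof -
    have "digit_mean (tilted t) (log_prob (tilted t)) (pat k) =
        t * digit_mean (tilted t) lp (pat k) + (1 - zeta) * digit_mean (tilted t) (ln_ratio t) (pat k)
        - ln (partition_sum (pat k) t)" for k
    proof -
      have "digit_mean (tilted t) (log_prob (tilted t)) (pat k) =
          t * digit_mean (tilted t) lp (pat k) + (1 - zeta) * digit_mean (tilted t) (ln_ratio t) (pat k)
          - (\<Sum>w\<in>pat_D (pat k). tilted t (pat k) w * ln (partition_sum (pat k) t))"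
        unfolding digit_mean_def log_prob_tilted
        by (simp add: sum_distrib_left sum_subtractf sum.distrib algebra_simps)
      then show ?thesis by (simp only: mean_const)
    qed
    then have "?avg (log_prob (tilted t)) = freq_avg (\<lambda>\<gamma>. t * digit_mean (tilted t) lp \<gamma> +
        (1 - zeta) * digit_mean (tilted t) (ln_ratio t) \<gamma> - ln (partition_sum \<gamma> t))"
      by (rule freq_avg_cong)
    then show ?thesis by (simp only: freq_avg_linear)
  qed
  have b: "?avg (log_row_prob (tilted t)) = t * ?avg lq - zeta * ?U - ?Z"
  proof -
    have "digit_mean (tilted t) (log_row_prob (tilted t)) (pat k) =
        t * digit_mean (tilted t) lq (pat k) - zeta * digit_mean (tilted t) (ln_ratio t) (pat k)
        - ln (partition_sum (pat k) t)" for k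
    proof -
      have "digit_mean (tilted t) (log_row_prob (tilted t)) (pat k) =
          (\<Sum>w\<in>pat_D (pat k). tilted t (pat k) w *
            (t * lq (pat k) w - zeta * ln_ratio t (pat k) w - ln (partition_sum (pat k) t)))"
        unfolding digit_mean_def by (intro sum.cong refl) (simp add: log_row_prob_tilted)
      also have "\<dots> = t * digit_mean (tilted t) lq (pat k) -
          zeta * digit_mean (tilted t) (ln_ratio t) (pat k)
          - (\<Sum>w\<in>pat_D (pat k). tilted t (pat k) w * ln (partition_sum (pat k) t))"
        unfolding digit_mean_def by (simp add: sum_distrib_left sum_subtractf sum.distrib algebra_simps)
      finally show ?thesis by (simp only: mean_const)
    qed
    then have "?avg (log_row_prob (tilted t)) = freq_avg (\<lambda>\<gamma>. t * digit_mean (tilted t) lq \<gamma> -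
        zeta * digit_mean (tilted t) (ln_ratio t) \<gamma> - ln (partition_sum \<gamma> t))"
      by (rule freq_avg_cong)
    then show ?thesis by (simp only: freq_avg_linear)
  qed
  have dim1: "- (zeta * ?avg lp + (1 - zeta) * ?avg lq) / mean_log_m = \<alpha>"
    using energy mean_log_pos unfolding e by (simp add: field_simps)
  have "- (zeta * ?avg (log_prob (tilted t)) + (1 - zeta) * ?avg (log_row_prob (tilted t))) =
      t * - (zeta * ?avg lp + (1 - zeta) * ?avg lq) + ?Z"
    unfolding a b by (simp add: algebra_simps)
  also have "\<dots> = t * (\<alpha> * mean_log_m) + ?Z" using energy unfolding e by simp
  finally have dim2: "- (zeta * ?avg (log_prob (tilted t)) + (1 - zeta) * ?avg (log_row_prob (tilted t)))
      / mean_log_m = \<alpha> * t + moran_beta (range pat) f p t"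
    using mean_log_pos by (simp add: moran_beta_eq add_divide_distrib mult.commute)
  have "AE w in moran_code_measure pat (tilted t). w \<in> moran_code pat"
    using AE_space[of "moran_code_measure pat (tilted t)"] unfolding space_moran_code_measure .
  with AE_carry_sparse[OF T] AE_digit_average[OF T, of lp] AE_digit_average[OF T, of lq]
    AE_digit_average[OF T, of "log_prob (tilted t)"] AE_digit_average[OF T, of "log_row_prob (tilted t)"]
  show ?thesis
  proof eventually_elim
    case (elim w)
    then show ?case
      using has_local_dim_if_carry_sparse[OF p elim(6,1,2,3)]
        has_local_dim_if_carry_sparse[OF T elim(6,1,4,5)]
      unfolding dim1 dim2 by blast
  qed
qed

lemma hausdorff_dim_level_ge:
  assumes "freq_avg (digit_mean (tilted t) (digit_energy zeta p)) = \<alpha> * mean_log_m"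
  shows "0 \<le> \<alpha> * t + moran_beta (range pat) f p t"
    and "ereal (\<alpha> * t + moran_beta (range pat) f p t) \<le>
      hausdorff_dim (local_dim_level (moran_measure pat p) \<alpha>)"
proof -
  note T = positive_weights_tilted[of t]
  interpret prob_space "moran_code_measure pat (tilted t)" using T by (rule prob_space_code)
  have "prob_space (moran_measure pat (tilted t))"
    unfolding moran_measure_def by (rule prob_space_distr[OF measurable_moran_proj])
  moreover obtain w where "has_local_dim (moran_measure pat (tilted t)) (moran_proj pat w)
      (\<alpha> * t + moran_beta (range pat) f p t)"
    using eventually_happens'[OF ae_filter_bot AE_tilted_local_dim[OF assms]] by blast
  ultimately show "0 \<le> \<alpha> * t + moran_beta (range pat) f p t" by (rule local_dim_nonneg)
  show "ereal (\<alpha> * t + moran_beta (range pat) f p t) \<le>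
      hausdorff_dim (local_dim_level (moran_measure pat p) \<alpha>)"
    by (rule hausdorff_dim_ge_if_AE_local_dim[OF prob_space_axioms measurable_moran_proj])
      (use AE_tilted_local_dim[OF assms] in \<open>simp add: local_dim_level_def moran_measure_def\<close>)
qed

end

theorem theorem2p2:
  fixes pat :: "nat \<Rightarrow> pattern"
    and f :: "pattern \<Rightarrow> real"
    and p :: "pattern \<Rightarrow> nat \<times> nat \<Rightarrow> real"
    and G :: "pattern set"
    and \<alpha> :: real
  assumes "\<And>k. 2 \<le> pat_n (pat k)" and "\<And>k. 2 \<le> pat_m (pat k)"
    and "bdd_above (range (\<lambda>k. pat_n (pat k)))" and "bdd_above (range (\<lambda>k. pat_m (pat k)))"
    and "\<And>k. pat_D (pat k) \<subseteq> {0..pat_n (pat k) - 1} \<times> {0..pat_m (pat k) - 1}"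
    and "\<And>k. 2 \<le> card (pat_D (pat k))"
    and "G = range pat"
    and "\<And>\<gamma>. \<gamma> \<in> G \<Longrightarrow> pattern_freq pat \<gamma> \<longlonglongrightarrow> f \<gamma>"
    and "(\<Sum>\<gamma>\<in>G. f \<gamma>) = 1"
    and "\<And>\<gamma> w. \<gamma> \<in> G \<Longrightarrow> w \<in> pat_D \<gamma> \<Longrightarrow> 0 < p \<gamma> w"
    and "\<And>\<gamma>. \<gamma> \<in> G \<Longrightarrow> (\<Sum>w\<in>pat_D \<gamma>. p \<gamma> w) = 1"
    and "moran_zeta G f \<le> 1"
    and "\<And>\<gamma> \<gamma>'. \<gamma> \<in> G \<Longrightarrow> \<gamma>' \<in> G \<Longrightarrow> \<gamma> \<noteq> \<gamma>' \<Longrightarrow>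
           row_card \<gamma> 0 = row_card \<gamma>' 0 \<and>
           row_card \<gamma> (pat_m \<gamma> - 1) = row_card \<gamma>' (pat_m \<gamma>' - 1)"
    and "\<And>\<gamma> \<gamma>'. \<gamma> \<in> G \<Longrightarrow> \<gamma>' \<in> G \<Longrightarrow> \<gamma> \<noteq> \<gamma>' \<Longrightarrow>
           row_family p \<gamma>' 0 = row_family p \<gamma> 0 \<and>
           row_family p \<gamma>' (pat_m \<gamma>' - 1) = row_family p \<gamma> (pat_m \<gamma> - 1)"
    and "alpha_min G f p < \<alpha>" and "\<alpha> < alpha_max G f p"
  shows "hausdorff_dim (local_dim_level (moran_measure pat p) \<alpha>) =
           (INF t::real. ereal (\<alpha> * t + moran_beta G f p t))"
proof -
  note G = assms(7)
  have D: "pat_D (pat k) \<subseteq> {..<pat_n (pat k)} \<times> {..<pat_m (pat k)}" for k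
  proof -
    have "{0..pat_n (pat k) - 1} \<subseteq> {..<pat_n (pat k)}" "{0..pat_m (pat k) - 1} \<subseteq> {..<pat_m (pat k)}"
      using assms(1,2)[of k] by auto
    then show ?thesis using assms(5)[of k] by (meson Sigma_mono order_trans)
  qed
  have fin: "finite (range pat)"
  proof -
    obtain N M where N: "\<And>k. pat_n (pat k) \<le> N" and M: "\<And>k. pat_m (pat k) \<le> M"
      using assms(3,4) by (auto simp: bdd_above_def)
    have "range pat \<subseteq> (\<lambda>(n, m, D). Pattern n m D) ` ({..N} \<times> {..M} \<times> Pow ({..<N} \<times> {..<M}))"
    proof
      fix \<gamma> assume "\<gamma> \<in> range pat"
      then obtain k where k: "\<gamma> = pat k" by blast
      have "{..<pat_n (pat k)} \<times> {..<pat_m (pat k)} \<subseteq> {..<N} \<times> {..<M}"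
        using N[of k] M[of k] by auto
      then have "pat_D (pat k) \<in> Pow ({..<N} \<times> {..<M})" using D[of k] by blast
      then show "\<gamma> \<in> (\<lambda>(n, m, D). Pattern n m D) ` ({..N} \<times> {..M} \<times> Pow ({..<N} \<times> {..<M}))"
        using N[of k] M[of k] k
        by (intro image_eqI[of _ _ "(pat_n (pat k), pat_m (pat k), pat_D (pat k))"]) auto
    qed
    then show ?thesis by (rule finite_subset) auto
  qed
  have "pat_D (pat k) \<noteq> {}" for k using assms(6)[of k] by auto
  then interpret weighted_moran pat f p
    using assms(1,2,8-12) D fin by unfold_locales (auto simp: G positive_weights_def)
  have rows: "row_family p (pat k) 0 = row_family p (pat k') 0"
    "row_family p (pat k) (pat_m (pat k) - 1) = row_family p (pat k') (pat_m (pat k') - 1)" for k k'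
    using assms(14)[of "pat k'" "pat k"] by (cases "pat k = pat k'"; simp add: G)+
  obtain t where t: "(INF t::real. ereal (\<alpha> * t + moran_beta (range pat) f p t)) =
      ereal (\<alpha> * t + moran_beta (range pat) f p t)"
    "freq_avg (digit_mean (tilted t) (digit_energy zeta p)) = \<alpha> * mean_log_m"
    using exists_minimising_tilt[of \<alpha>] assms(15,16) unfolding G by blast
  have "hausdorff_dim (local_dim_level (moran_measure pat p) \<alpha>) =
      ereal (\<alpha> * t + moran_beta (range pat) f p t)"
    using hausdorff_dim_level_le[OF rows hausdorff_dim_level_ge(1)[OF t(2)]] hausdorff_dim_level_ge(2)[OF t(2)]
    by (rule antisym)
  then show ?thesis unfolding G t(1) .
qed

end
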